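(* Assume the Riemann hypothesis. Let $b\neq -1/2$ be a fixed real number. Then, as $n\to\infty$, $$k_{n,b}:=\sum_{\rho}\left(1-\Big(\frac{\rho+b}{\rho-1-b}\Big)^n\right)=\sum_{\rho}\left(1-\Big(\frac{\rho-b-1}{\rho+b}\Big)^n\right)=\frac{|2b+1|}{2}\,n\ln n+\frac{|2b+1|}{2}\Big(\gamma-1-\ln\frac{2\pi}{|2b+1|}\Big)n+o(n).$$
   Context: The sums run over the non-trivial zeros $\rho$ of the Riemann zeta-function, counted with multiplicity, with each zero $\rho$ paired with its complex conjugate $\bar\rho$ (i.e. summed symmetrically, as the limit over $|\operatorname{Im}\rho|\le T$, $T\to\infty$). $\gamma$ is the Euler–Mascheroni constant. *)

theory Defs
  imports "HOL-Complex_Analysis.Complex_Analysis" "HOL-Library.Landau_Symbols"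
begin

text \<open>
  The Riemann zeta function as the analytic continuation of its Dirichlet series. By the
  identity theorem the continuation to the plane punctured at \<open>1\<close> is unique; \<open>1\<close> is a pole, and
  the condition \<open>f 1 = 0\<close> merely fixes the otherwise meaningless value there, so that the
  function is uniquely determined.
\<close>

definition zeta :: "complex \<Rightarrow> complex" where
  "zeta = (THE f. f holomorphic_on (- {1}) \<and>
                  (\<forall>s. Re s > 1 \<longrightarrow> (\<lambda>n. 1 / of_nat (Suc n) powr s) sums f s) \<and>
                  f 1 = 0)"

text \<open>The trivial zeros are the negative even integers; the pole \<open>1\<close> is not a zero.\<close>

definition nontrivial_zeros :: "complex set" where
  "nontrivial_zeros =
     {\<rho>. \<rho> \<noteq> 1 \<and> zeta \<rho> = 0 \<and> \<not> (\<exists>k::nat. k \<ge> 1 \<and> \<rho> = - 2 * of_nat k)}"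

definition riemann_hypothesis :: bool where
  "riemann_hypothesis \<longleftrightarrow> (\<forall>\<rho>\<in>nontrivial_zeros. Re \<rho> = 1 / 2)"

text \<open>
  Sums over the non-trivial zeros, each counted with its multiplicity, are limits of symmetric
  partial sums. Each partial sum is over a finite set, as there are only finitely many
  non-trivial zeros up to a given height.
\<close>

definition zero_sum_upto :: "(complex \<Rightarrow> complex) \<Rightarrow> real \<Rightarrow> complex" where
  "zero_sum_upto f T =
     (\<Sum>\<rho> | \<rho> \<in> nontrivial_zeros \<and> \<bar>Im \<rho>\<bar> \<le> T. of_int (zorder zeta \<rho>) * f \<rho>)"

definition has_zero_sum :: "(complex \<Rightarrow> complex) \<Rightarrow> complex \<Rightarrow> bool" where
  "has_zero_sum f S \<longleftrightarrow> (zero_sum_upto f \<longlongrightarrow> S) at_top"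

definition zero_sum :: "(complex \<Rightarrow> complex) \<Rightarrow> complex" where
  "zero_sum f = (THE S. has_zero_sum f S)"

definition k_sum :: "nat \<Rightarrow> real \<Rightarrow> complex" where
  "k_sum n b =
     zero_sum (\<lambda>\<rho>. 1 - ((\<rho> + of_real b) / (\<rho> - 1 - of_real b)) ^ n)"

end

theory Submission imports Defs "HOL-Real_Asymp.Real_Asymp" begin

text \<open>
  Under the Riemann hypothesis every zero is \<open>1/2 + \<i> g\<close> with \<open>g\<close> real, and with
  \<open>a = \<bar>2 b + 1\<bar> / 2\<close> the real part of the summand at it is \<open>h(g)\<close>, where \<open>h(t) = Re H(\<i> t)\<close> and
  \<open>H(z) = 1 - ((z - a) / (z + a)) ^ n\<close> is holomorphic and bounded for \<open>Re z \<ge> 0\<close>; the imaginary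
  parts cancel in conjugate pairs. No counting function for the zeros is needed: since
  \<open>\<bar>H(x + \<i> g) - H(\<i> g)\<bar> \<le> min 2 (2 a x n / (a\<^sup>2 + g\<^sup>2))\<close> and \<open>\<Sum> 1 / (1 + g\<^sup>2)\<close> converges,
  replacing \<open>H(\<i> g)\<close> by \<open>H(x + \<i> g)\<close> for a fixed \<open>x > 0\<close> costs only \<open>o(n)\<close>. By the Poisson formula
  the new sum is \<open>1 / \<pi>\<close> times the integral of \<open>h(t)\<close> against
  \<open>\<Sum> x / (x\<^sup>2 + (t - g)\<^sup>2) = Re (xi' / xi) (1/2 + x + \<i> t)\<close>, and by Stirling's formula for the
  digamma function this differs from \<open>ln (\<bar>t\<bar> / (2 \<pi>)) / 2\<close> by \<open>O(2 powr (- x)) + O\<^sub>x(\<bar>t\<bar> powr (-1/2))\<close>.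
  Letting \<open>n \<rightarrow> \<infinity>\<close> and then \<open>x \<rightarrow> \<infinity>\<close> leaves the integral of \<open>h(t) ln \<bar>t\<bar>\<close>, in which \<open>h(n y)\<close> tends to
  \<open>1 - cos (2 a / y)\<close>.

  The functional equation comes from two evaluations of the Mellin transform of
  \<open>1 / t - 1 / (e\<^sup>t - 1)\<close> on \<open>0 < s < 1\<close>. Both \<open>e\<^sup>-\<^sup>u\<^sup>t\<close> and \<open>2 t / (t\<^sup>2 + 4 \<pi>\<^sup>2 u\<^sup>2)\<close>, as functions of
  \<open>u > 0\<close>, have this kernel as the difference between their integral and the sum of their values
  at the positive integers; all integrands are non-negative, so Tonelli's theorem applies.
\<close>

section \<open>The zeta function in the right half plane\<close>

text \<open>The Poisson sum must come without an additive constant, which a general Hadamard product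
  would leave undetermined. The symmetry of xi about 1/2 removes it, and this is why the functional
  equation has to be established at all. Non-negativity carries the interchanges of sums and
  integrals: h, the Poisson kernels and the Mellin kernels are all non-negative, so monotone
  convergence serves for the zeros just as Tonelli does for the functional equation. Origin of the
  main term: h has total mass 2 pi a n, and t = n y splits ln |t| into ln n + ln |y|. The first part
  gives a n ln n; the second gives a n (ln (2 a) + gamma - 1) in the limit, through the Mellin
  transform of 1 - cos, where gamma enters as Digamma 2 = 1 - gamma. Subtracting a n ln (2 pi)
  leaves ln (pi / a) with a = |2 b + 1| / 2. The limit in x comes last because the zeta'/zeta part
  of xi'/xi does not decay in t; it is small only when Re s is large.\<close>

lemma norm_powr_diff_le:
  fixes s :: complex and x y :: real
  assumes "0 < x" "x \<le> y" "Re s \<ge> -1"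
  shows "norm (of_real y powr (-s) - of_real x powr (-s)) \<le> norm s * x powr (- Re s - 1) * (y - x)"
proof -
  let ?S = "closed_segment (of_real x) (of_real y :: complex)"
  have "norm (of_real y powr (-s) - of_real x powr (-s)) \<le>
          norm s * x powr (- Re s - 1) * norm (of_real y - of_real x :: complex)"
  proof (rule field_differentiable_bound[where S = ?S])
    fix z assume "z \<in> ?S"
    then obtain u where u: "z = of_real u" "x \<le> u" "u \<le> y"
      using assms by (auto simp: closed_segment_of_real closed_segment_eq_real_ivl)
    have "u > 0" using u assms by simp
    then have "z \<notin> \<real>\<^sub>\<le>\<^sub>0" using u by (auto simp: complex_nonpos_Reals_iff)
    then show "((\<lambda>z. z powr (-s)) has_field_derivative (-s * z powr (-s-1))) (at z within ?S)"
      by (intro has_field_derivative_powr[THEN has_field_derivative_at_within, THEN DERIV_cong]) auto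
    have "norm (-s * z powr (-s-1)) = norm s * u powr (- Re s - 1)"
      using u \<open>u > 0\<close> by (simp add: norm_mult norm_powr_real_powr)
    also have "\<dots> \<le> norm s * x powr (- Re s - 1)"
      using u assms by (intro mult_left_mono powr_mono2') auto
    finally show "norm (-s * z powr (-s-1)) \<le> norm s * x powr (- Re s - 1)" .
  qed auto
  also have "norm (of_real y - of_real x :: complex) = y - x"
    using assms by (simp flip: of_real_diff)
  finally show ?thesis .
qed

definition zeta_term :: "nat \<Rightarrow> complex \<Rightarrow> complex" where
  "zeta_term n s = (s - 1) * of_nat (Suc n) powr (-s) -
     (of_nat (Suc n) powr (1 - s) - of_nat (Suc (Suc n)) powr (1 - s))"

text \<open>For \<open>Re s > 0\<close> this is \<open>(s - 1) * zeta s\<close>, since the bracket in \<open>zeta_term n s\<close> is \<open>s - 1\<close> times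
  the integral of \<open>u powr - s\<close> from \<open>n + 1\<close> to \<open>n + 2\<close>.\<close>

definition zeta_reg :: "complex \<Rightarrow> complex" where
  "zeta_reg s = 1 + (\<Sum>n. zeta_term n s)"

text \<open>\<open>\<Phi>\<close> is chosen so that its increment from \<open>N\<close> to
  \<open>N + 1\<close> is the term, while its derivative is
  \<open>(s - 1) * (N powr (-s) - w powr (-s))\<close>. The difference of powers gains one power of
  \<open>N\<close> by the preceding lemma, which extends convergence from \<open>Re s > 1\<close> to
  \<open>Re s > 0\<close>.\<close>

lemma norm_zeta_term_le:
  assumes "Re s > 0"
  shows "norm (zeta_term n s) \<le> norm (s - 1) * norm s * real (Suc n) powr (- Re s - 1)"
proof -
  define N where "N = real (Suc n)"
  have N: "N > 0" unfolding N_def by simp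
  let ?S = "closed_segment (of_real N) (of_real (N + 1) :: complex)"
  define \<Phi> where "\<Phi> = (\<lambda>w. (s - 1) * w * of_real N powr (-s) + w powr (1 - s))"
  have "norm (\<Phi> (of_real (N + 1)) - \<Phi> (of_real N)) \<le>
          (norm (s - 1) * norm s * N powr (- Re s - 1)) * norm (of_real (N + 1) - of_real N :: complex)"
  proof (rule field_differentiable_bound[where S = ?S])
    fix z assume "z \<in> ?S"
    then obtain u where u: "z = of_real u" "N \<le> u" "u \<le> N + 1"
      unfolding closed_segment_of_real closed_segment_eq_real_ivl by auto
    have "u > 0" using u N by simp
    then have z: "z \<notin> \<real>\<^sub>\<le>\<^sub>0" using u by (auto simp: complex_nonpos_Reals_iff)
    show "(\<Phi> has_field_derivative ((s - 1) * (of_real N powr (-s) - z powr (-s)))) (at z within ?S)"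
      unfolding \<Phi>_def using z by (auto intro!: derivative_eq_intros simp: algebra_simps)
    have "norm (of_real N powr (-s) - z powr (-s)) \<le> norm s * N powr (- Re s - 1) * (u - N)"
      using norm_powr_diff_le[of N u s] u N assms by (simp add: norm_minus_commute)
    also have "\<dots> \<le> norm s * N powr (- Re s - 1) * 1"
      using u by (intro mult_left_mono) auto
    finally show "norm ((s - 1) * (of_real N powr (-s) - z powr (-s)))
        \<le> norm (s - 1) * norm s * N powr (- Re s - 1)"
      by (simp add: norm_mult mult_left_mono mult.assoc)
  qed auto
  also have "\<Phi> (of_real (N + 1)) - \<Phi> (of_real N) = zeta_term n s"
    by (simp add: \<Phi>_def zeta_term_def N_def algebra_simps)
  finally show ?thesis by (simp add: N_def)
qed

lemma summable_Suc_powr: "c > 1 \<Longrightarrow> summable (\<lambda>n. real (Suc n) powr (-c))"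
  using summable_Suc_iff[of "\<lambda>n. real n powr (-c)"] summable_real_powr_iff[of "-c"] by simp

lemma zeta_term_sums:
  assumes "Re s > 0"
  shows "(\<lambda>n. zeta_term n s) sums (zeta_reg s - 1)"
proof -
  have "summable (\<lambda>n. norm (s - 1) * norm s * real (Suc n) powr (- Re s - 1))"
    using summable_Suc_powr[of "Re s + 1"] assms by (intro summable_mult) simp
  then have "summable (\<lambda>n. zeta_term n s)"
    by (rule summable_comparison_test[rotated]) (use norm_zeta_term_le[OF assms] in auto)
  then show ?thesis by (simp add: zeta_reg_def summable_sums)
qed

text \<open>Growth is only quadratic in \<open>s\<close> on a half plane, so the size of
  \<open>xi\<close> will be governed by its Gamma factor.\<close>

lemma norm_zeta_reg_le:
  assumes "Re s \<ge> \<sigma>" "\<sigma> > 0"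
  shows "norm (zeta_reg s) \<le> 1 + norm (s - 1) * norm s * (\<Sum>n. real (Suc n) powr (- \<sigma> - 1))"
proof -
  have S: "summable (\<lambda>n. norm (s - 1) * norm s * real (Suc n) powr (- \<sigma> - 1))"
    using summable_Suc_powr[of "\<sigma> + 1"] assms by (intro summable_mult) simp
  have le: "norm (zeta_term n s) \<le> norm (s - 1) * norm s * real (Suc n) powr (- \<sigma> - 1)" for n
  proof -
    have "norm (zeta_term n s) \<le> norm (s - 1) * norm s * real (Suc n) powr (- Re s - 1)"
      using assms by (intro norm_zeta_term_le) auto
    also have "\<dots> \<le> norm (s - 1) * norm s * real (Suc n) powr (- \<sigma> - 1)"
      using assms by (intro mult_left_mono powr_mono) auto
    finally show ?thesis .
  qed
  have "norm (\<Sum>n. zeta_term n s) \<le> (\<Sum>n. norm (s - 1) * norm s * real (Suc n) powr (- \<sigma> - 1))"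
    by (rule norm_suminf_le[OF le S])
  also have "\<dots> = norm (s - 1) * norm s * (\<Sum>n. real (Suc n) powr (- \<sigma> - 1))"
    using summable_Suc_powr[of "\<sigma> + 1"] assms by (intro suminf_mult) simp
  finally show ?thesis
    unfolding zeta_reg_def by (intro norm_triangle_le) simp
qed

lemma holomorphic_zeta_reg: "zeta_reg holomorphic_on {s. Re s > 0}"
proof -
  have "(\<lambda>s. \<Sum>n. zeta_term n s) holomorphic_on {s. Re s > 0}"
  proof (rule holomorphic_uniform_sequence[where f = "\<lambda>N s. \<Sum>n<N. zeta_term n s"])
    show "open {s. Re s > 0}" by (rule open_halfspace_Re_gt)
    show "(\<lambda>s. \<Sum>n<N. zeta_term n s) holomorphic_on {s. Re s > 0}" for N
      unfolding zeta_term_def by (intro holomorphic_intros)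
    fix z assume "z \<in> {s. Re s > 0}"
    then have z: "Re z > 0" by simp
    define d where "d = Re z / 2"
    define B where "B = (norm z + d + 1) * (norm z + d)"
    have d: "d > 0" using z by (simp add: d_def)
    have re: "Re w \<ge> d" "norm w \<le> norm z + d" "norm (w - 1) \<le> norm z + d + 1" if "w \<in> cball z d" for w
    proof -
      have *: "norm (z - w) \<le> d" using that by (simp add: dist_norm)
      then show "Re w \<ge> d" using abs_Re_le_cmod[of "z - w"] by (simp add: d_def)
      show a: "norm w \<le> norm z + d" using * norm_triangle_ineq4[of z "z - w"] by simp
      show "norm (w - 1) \<le> norm z + d + 1" using a norm_triangle_ineq4[of w 1] by simp
    qed
    have "uniform_limit (cball z d) (\<lambda>N s. \<Sum>n<N. zeta_term n s) (\<lambda>s. \<Sum>n. zeta_term n s) sequentially"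
    proof (rule Weierstrass_m_test)
      fix n w assume w: "w \<in> cball z d"
      have "norm (zeta_term n w) \<le> norm (w - 1) * norm w * real (Suc n) powr (- Re w - 1)"
        using re(1)[OF w] d by (intro norm_zeta_term_le) auto
      also have "\<dots> \<le> B * real (Suc n) powr (- d - 1)"
        unfolding B_def using re[OF w] d by (intro mult_mono powr_mono) auto
      finally show "norm (zeta_term n w) \<le> B * real (Suc n) powr (- d - 1)" .
    next
      show "summable (\<lambda>n. B * real (Suc n) powr (- d - 1))"
        using summable_Suc_powr[of "d + 1"] d by (intro summable_mult) simp
    qed
    moreover have "cball z d \<subseteq> {s. Re s > 0}" using re(1) d by force
    ultimately show "\<exists>d>0. cball z d \<subseteq> {s. 0 < Re s} \<and>
        uniform_limit (cball z d) (\<lambda>N s. \<Sum>n<N. zeta_term n s) (\<lambda>s. \<Sum>n. zeta_term n s) sequentially"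
      using d by blast
  qed
  then show ?thesis unfolding zeta_reg_def by (intro holomorphic_intros)
qed

text \<open>The brackets telescope. The last term vanishes in the limit for \<open>Re s > 1\<close>;
  on \<open>0 < s < 1\<close> it compensates the divergence of the Dirichlet sum.\<close>

lemma sum_zeta_term:
  "1 + (\<Sum>n<N. zeta_term n s) =
     (s - 1) * (\<Sum>n<N. of_nat (Suc n) powr (-s)) + of_nat (Suc N) powr (1 - s)"
proof (induction N)
  case 0 then show ?case by simp
next
  case (Suc N)
  have "1 + (\<Sum>n<Suc N. zeta_term n s) = (1 + (\<Sum>n<N. zeta_term n s)) + zeta_term N s" by simp
  also have "\<dots> = (s - 1) * (\<Sum>n<Suc N. of_nat (Suc n) powr (-s)) + of_nat (Suc (Suc N)) powr (1 - s)"
    by (subst Suc) (simp add: zeta_term_def algebra_simps)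
  finally show ?case .
qed

lemma Suc_powr_tendsto_0:
  fixes s :: complex
  assumes "Re s < 0"
  shows "(\<lambda>N. of_nat (Suc N) powr s :: complex) \<longlonglongrightarrow> 0"
proof (rule tendsto_norm_zero_cancel)
  have "(\<lambda>N. real N powr Re s) \<longlonglongrightarrow> 0"
    by (rule tendsto_neg_powr[OF assms filterlim_real_sequentially])
  then have "(\<lambda>N. real (Suc N) powr Re s) \<longlonglongrightarrow> 0" by (rule LIMSEQ_Suc)
  moreover have "norm (of_nat (Suc N) powr s :: complex) = real (Suc N) powr Re s" for N
    by (subst norm_powr_real_powr) auto
  ultimately show "(\<lambda>N. norm (of_nat (Suc N) powr s :: complex)) \<longlonglongrightarrow> 0" by simp
qed

lemma zeta_reg_dirichlet:
  assumes "Re s > 1"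
  shows "(\<lambda>n. 1 / of_nat (Suc n) powr s) sums (zeta_reg s / (s - 1))"
proof -
  have "(\<lambda>N. 1 + (\<Sum>n<N. zeta_term n s)) \<longlonglongrightarrow> 1 + (zeta_reg s - 1)"
    by (intro tendsto_add tendsto_const zeta_term_sums[unfolded sums_def]) (use assms in auto)
  then have "(\<lambda>N. (1 + (\<Sum>n<N. zeta_term n s) - of_nat (Suc N) powr (1 - s)) / (s - 1)) \<longlonglongrightarrow>
      (1 + (zeta_reg s - 1) - 0) / (s - 1)"
    using assms by (intro tendsto_divide tendsto_diff tendsto_const Suc_powr_tendsto_0) auto
  moreover have "((s - 1) * S + x - x) / (s - 1) = S" for S x
    using assms by auto
  ultimately show ?thesis
    unfolding sum_zeta_term sums_def by (simp add: powr_minus_divide)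
qed

section \<open>Mellin transforms of non-negative kernels\<close>

lemma nn_integral_set_swap:
  fixes g :: "real \<Rightarrow> real \<Rightarrow> ennreal"
  assumes [measurable]: "(\<lambda>(x, y). g x y) \<in> borel_measurable (lborel \<Otimes>\<^sub>M lborel)"
    "A \<in> sets borel" "B \<in> sets borel"
  shows "(\<integral>\<^sup>+x\<in>A. (\<integral>\<^sup>+y\<in>B. g x y \<partial>lborel) \<partial>lborel) = (\<integral>\<^sup>+y\<in>B. (\<integral>\<^sup>+x\<in>A. g x y \<partial>lborel) \<partial>lborel)"
proof -
  have "(\<integral>\<^sup>+x\<in>A. (\<integral>\<^sup>+y\<in>B. g x y \<partial>lborel) \<partial>lborel) =
      (\<integral>\<^sup>+x. (\<integral>\<^sup>+y. g x y * indicator B y * indicator A x \<partial>lborel) \<partial>lborel)"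
    by (subst nn_integral_multc) (auto intro!: borel_measurable_times_ennreal)
  also have "\<dots> = (\<integral>\<^sup>+y. (\<integral>\<^sup>+x. g x y * indicator B y * indicator A x \<partial>lborel) \<partial>lborel)"
    by (subst lborel_pair.Fubini'[symmetric]) auto
  also have "\<dots> = (\<integral>\<^sup>+y. (\<integral>\<^sup>+x. g x y * indicator A x * indicator B y \<partial>lborel) \<partial>lborel)"
    by (simp add: mult_ac)
  also have "\<dots> = (\<integral>\<^sup>+y\<in>B. (\<integral>\<^sup>+x\<in>A. g x y \<partial>lborel) \<partial>lborel)"
    by (subst nn_integral_multc) (auto intro!: borel_measurable_times_ennreal)
  finally show ?thesis .
qed

lemma nn_integral_Gamma:
  fixes x u :: real
  assumes "x > 0" "u > 0"
  shows "(\<integral>\<^sup>+t\<in>{0<..}. ennreal (t powr (x - 1) * exp (- u * t)) \<partial>lborel) = ennreal (Gamma x * u powr (-x))"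
proof -
  have "((\<lambda>t. t powr (x - 1) * exp (-t)) has_integral Gamma x) {0<..}"
    using Gamma_integral_real[OF assms(1)]
    by (subst has_integral_spike_set_eq[where T = "{0..}"])
       (auto simp: exp_minus divide_inverse intro: negligible_subset[of "{0}"])
  then have G: "(\<integral>\<^sup>+t\<in>{0<..}. ennreal (t powr (x - 1) * exp (-t)) \<partial>lborel) = ennreal (Gamma x)"
    by (intro nn_integral_has_integral_lebesgue') auto
  have eq: "ennreal ((t / u) powr (x - 1) * exp (- u * (t / u))) * indicator {0<..} (t / u) =
      ennreal (u powr (1 - x)) * (ennreal (t powr (x - 1) * exp (-t)) * indicator {0<..} t)" for t
  proof (cases "t > 0")
    case True
    then have "(t / u) powr (x - 1) = u powr (1 - x) * t powr (x - 1)"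
      using assms by (simp add: powr_divide powr_diff divide_simps)
    then show ?thesis using True assms by (simp add: ennreal_mult[symmetric] mult_ac)
  qed (use assms in \<open>auto simp: zero_less_divide_iff\<close>)
  have "(\<integral>\<^sup>+t\<in>{0<..}. ennreal (t powr (x - 1) * exp (- u * t)) \<partial>lborel) =
      ennreal (1 / u) * (\<integral>\<^sup>+t. ennreal ((t / u) powr (x - 1) * exp (- u * (t / u))) * indicator {0<..} (t / u) \<partial>lborel)"
    using assms by (subst nn_integral_real_affine[where c = "1 / u" and t = 0]) auto
  also have "\<dots> = ennreal (1 / u) * (ennreal (u powr (1 - x)) * ennreal (Gamma x))"
    unfolding eq by (subst nn_integral_cmult) (simp_all add: G)
  also have "\<dots> = ennreal (Gamma x * u powr (-x))"
    using assms by (simp add: ennreal_mult[symmetric] Gamma_real_pos powr_diff powr_minus divide_simps)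
  finally show ?thesis .
qed

lemma nn_integral_exp_inverse:
  fixes u :: real
  assumes "u > 0"
  shows "(\<integral>\<^sup>+t\<in>{0<..}. ennreal (exp (- u * t)) \<partial>lborel) = ennreal (1 / u)"
proof -
  have "(\<integral>\<^sup>+t\<in>{0<..}. ennreal (exp (- u * t)) \<partial>lborel) =
      (\<integral>\<^sup>+t\<in>{0<..}. ennreal (t powr (1 - 1) * exp (- u * t)) \<partial>lborel)"
    by (intro nn_integral_cong) (auto split: split_indicator)
  also have "\<dots> = ennreal (1 / u)"
    by (subst nn_integral_Gamma) (use assms in \<open>auto simp: powr_minus_divide\<close>)
  finally show ?thesis .
qed

text \<open>Writing \<open>1 / (v + c)\<close> as the integral of \<open>exp (- (v + c) * w)\<close>
  over \<open>w > 0\<close> and exchanging the order produces two Gamma integrals. The value is kept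
  in Gamma form rather than as \<open>pi / sin (pi * a)\<close>, since it will meet the duplication
  formula.\<close>

lemma nn_integral_Beta_half_line:
  fixes a c :: real
  assumes "0 < a" "a < 1" "c > 0"
  shows "(\<integral>\<^sup>+v\<in>{0<..}. ennreal (v powr (a - 1) / (v + c)) \<partial>lborel) =
     ennreal (Gamma a * Gamma (1 - a) * c powr (a - 1))"
proof -
  have "(\<integral>\<^sup>+v\<in>{0<..}. ennreal (v powr (a - 1) / (v + c)) \<partial>lborel) =
      (\<integral>\<^sup>+v\<in>{0<..}. (\<integral>\<^sup>+w\<in>{0<..}. ennreal (v powr (a - 1) * exp (- (v + c) * w)) \<partial>lborel) \<partial>lborel)"
  proof (intro nn_integral_cong)
    fix v :: real
    have "(\<integral>\<^sup>+w\<in>{0<..}. ennreal (v powr (a - 1) * exp (- (v + c) * w)) \<partial>lborel) =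
        ennreal (v powr (a - 1) / (v + c))" if "v > 0"
    proof -
      have "(\<integral>\<^sup>+w\<in>{0<..}. ennreal (v powr (a - 1) * exp (- (v + c) * w)) \<partial>lborel) =
         (\<integral>\<^sup>+w. ennreal (v powr (a - 1)) * (ennreal (exp (- (v + c) * w)) * indicator {0<..} w) \<partial>lborel)"
        by (simp add: ennreal_mult mult_ac)
      also have "\<dots> = ennreal (v powr (a - 1)) * ennreal (1 / (v + c))"
        by (subst nn_integral_cmult, simp, subst nn_integral_exp_inverse) (use that assms in auto)
      finally show ?thesis using that assms by (simp add: ennreal_mult[symmetric])
    qed
    then show "ennreal (v powr (a - 1) / (v + c)) * indicator {0<..} v =
       (\<integral>\<^sup>+w\<in>{0<..}. ennreal (v powr (a - 1) * exp (- (v + c) * w)) \<partial>lborel) * indicator {0<..} v"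
      by (auto split: split_indicator)
  qed
  also have "\<dots> = (\<integral>\<^sup>+w\<in>{0<..}. (\<integral>\<^sup>+v\<in>{0<..}. ennreal (v powr (a - 1) * exp (- (v + c) * w)) \<partial>lborel) \<partial>lborel)"
    by (rule nn_integral_set_swap) auto
  also have "\<dots> = (\<integral>\<^sup>+w. ennreal (Gamma a) * (ennreal (w powr ((1 - a) - 1) * exp (- c * w)) * indicator {0<..} w) \<partial>lborel)"
  proof (intro nn_integral_cong)
    fix w :: real
    have "(\<integral>\<^sup>+v\<in>{0<..}. ennreal (v powr (a - 1) * exp (- (v + c) * w)) \<partial>lborel) =
        ennreal (Gamma a) * ennreal (w powr ((1 - a) - 1) * exp (- c * w))" if "w > 0"
    proof -
      have "(\<integral>\<^sup>+v\<in>{0<..}. ennreal (v powr (a - 1) * exp (- (v + c) * w)) \<partial>lborel) =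
         (\<integral>\<^sup>+v. ennreal (exp (- c * w)) * (ennreal (v powr (a - 1) * exp (- w * v)) * indicator {0<..} v) \<partial>lborel)"
        by (intro nn_integral_cong)
           (simp add: ennreal_mult[symmetric] mult_ac exp_add[symmetric] algebra_simps split: split_indicator)
      also have "\<dots> = ennreal (exp (- c * w)) * ennreal (Gamma a * w powr (-a))"
        by (subst nn_integral_cmult) (use that assms in \<open>auto simp: nn_integral_Gamma[simplified]\<close>)
      finally show ?thesis using that assms by (simp add: ennreal_mult[symmetric] Gamma_real_pos mult_ac)
    qed
    then show "(\<integral>\<^sup>+v\<in>{0<..}. ennreal (v powr (a - 1) * exp (- (v + c) * w)) \<partial>lborel) * indicator {0<..} w =
       ennreal (Gamma a) * (ennreal (w powr ((1 - a) - 1) * exp (- c * w)) * indicator {0<..} w)"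
      by (auto split: split_indicator)
  qed
  also have "\<dots> = ennreal (Gamma a) * ennreal (Gamma (1 - a) * c powr (- (1 - a)))"
    by (subst nn_integral_cmult) (simp_all only: nn_integral_Gamma assms diff_gt_0_iff_gt, auto)
  also have "\<dots> = ennreal (Gamma a * Gamma (1 - a) * c powr (a - 1))"
    using assms by (simp add: ennreal_mult[symmetric] Gamma_real_pos mult_ac)
  finally show ?thesis .
qed

text \<open>On \<open>[0, N]\<close> the squares fill \<open>[0, N\<^sup>2]\<close>; monotone
  convergence in \<open>N\<close> passes to the half line.\<close>

lemma nn_integral_square_substitution:
  fixes \<phi> :: "real \<Rightarrow> real"
  assumes [measurable]: "\<phi> \<in> borel_measurable borel" and nn: "\<And>v. v > 0 \<Longrightarrow> \<phi> v \<ge> 0"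
  shows "(\<integral>\<^sup>+v\<in>{0<..}. ennreal (\<phi> v) \<partial>lborel) = (\<integral>\<^sup>+t\<in>{0<..}. ennreal (\<phi> (t\<^sup>2) * (2 * t)) \<partial>lborel)"
proof -
  define \<psi> where "\<psi> v = (if v > 0 then \<phi> v else 0)" for v
  have [measurable]: "\<psi> \<in> borel_measurable borel" unfolding \<psi>_def by measurable
  have \<psi>: "\<psi> v \<ge> 0" for v using nn by (simp add: \<psi>_def)
  have ind: "(\<lambda>N. indicator {0..real (N::nat) ^ k} v :: ennreal) \<longlonglongrightarrow> indicator {0..} v" 
    if "k > 0" for v :: real and k
  proof -
    obtain M :: nat where M: "real M \<ge> max \<bar>v\<bar> 1" using real_arch_simple by blast
    have "eventually (\<lambda>N. indicator {0..real (N::nat) ^ k} v = (indicator {0..} v :: ennreal)) sequentially"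
      using eventually_ge_at_top[of M]
    proof eventually_elim
      case (elim N)
      have "\<bar>v\<bar> \<le> real N" "real N \<ge> 1" using elim M by linarith+
      moreover have "real N ^ 1 \<le> real N ^ k" using that \<open>real N \<ge> 1\<close> by (intro power_increasing) auto
      ultimately have "\<bar>v\<bar> \<le> real N ^ k" by (metis order_trans power_one_right)
      then show ?case by (auto simp only: atLeastAtMost_iff atLeast_iff abs_le_iff split: split_indicator)
    qed
    then show ?thesis by (rule tendsto_eventually)
  qed
  have inc: "incseq (\<lambda>N v. ennreal (f v) * indicator {0..real (N::nat) ^ k} v)" for f :: "real \<Rightarrow> real" and k
    by (intro incseq_SucI le_funI mult_left_mono)
       (auto split: split_indicator intro: order_trans[OF _ power_mono])
  have lim: "(\<lambda>N. ennreal (f v) * indicator {0..real (N::nat) ^ k} v) \<longlonglongrightarrow> ennreal (f v) * indicator {0..} v"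
    if "k > 0" for f :: "real \<Rightarrow> real" and v k
    using ind[OF that, of v] by (intro tendsto_mult_ennreal) (auto split: split_indicator)
  have "(\<lambda>N. (\<integral>\<^sup>+v. ennreal (\<psi> v) * indicator {0..real N ^ 2} v \<partial>lborel)) \<longlonglongrightarrow>
     (\<integral>\<^sup>+v. ennreal (\<psi> v) * indicator {0..} v \<partial>lborel)"
    by (rule nn_integral_LIMSEQ[OF inc _ lim]) auto
  moreover have "(\<lambda>N. (\<integral>\<^sup>+t. ennreal (\<psi> (t\<^sup>2) * (2 * t)) * indicator {0..real N ^ 1} t \<partial>lborel)) \<longlonglongrightarrow>
     (\<integral>\<^sup>+t. ennreal (\<psi> (t\<^sup>2) * (2 * t)) * indicator {0..} t \<partial>lborel)"
    by (rule nn_integral_LIMSEQ[OF inc _ lim]) auto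
  moreover have "(\<integral>\<^sup>+v. ennreal (\<psi> v) * indicator {0..real N ^ 2} v \<partial>lborel) =
    (\<integral>\<^sup>+t. ennreal (\<psi> (t\<^sup>2) * (2 * t)) * indicator {0..real N ^ 1} t \<partial>lborel)" for N :: nat
  proof -
    have "(\<integral>\<^sup>+v. ennreal (\<psi> v * indicator {0\<^sup>2..(real N)\<^sup>2} v) \<partial>lborel) =
        (\<integral>\<^sup>+t. ennreal (\<psi> (t\<^sup>2) * (2 * t) * indicator {0..real N} t) \<partial>lborel)"
      by (rule nn_integral_substitution)
         (auto intro!: derivative_eq_intros continuous_intros simp: set_borel_measurable_def)
    moreover have "ennreal (x * indicator A y) = ennreal x * indicator A y" for x y :: real and A
      by (auto split: split_indicator)
    ultimately show ?thesis by simp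
  qed
  ultimately have "(\<integral>\<^sup>+v. ennreal (\<psi> v) * indicator {0..} v \<partial>lborel) =
     (\<integral>\<^sup>+t. ennreal (\<psi> (t\<^sup>2) * (2 * t)) * indicator {0..} t \<partial>lborel)"
    using LIMSEQ_unique by simp
  moreover have "(\<integral>\<^sup>+v. ennreal (\<psi> v) * indicator {0..} v \<partial>lborel) = (\<integral>\<^sup>+v\<in>{0<..}. ennreal (\<phi> v) \<partial>lborel)"
    by (intro nn_integral_cong) (auto simp: \<psi>_def split: split_indicator)
  moreover have "(\<integral>\<^sup>+t. ennreal (\<psi> (t\<^sup>2) * (2 * t)) * indicator {0..} t \<partial>lborel) =
     (\<integral>\<^sup>+t\<in>{0<..}. ennreal (\<phi> (t\<^sup>2) * (2 * t)) \<partial>lborel)"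
    by (intro nn_integral_cong) (auto simp: \<psi>_def split: split_indicator)
  ultimately show ?thesis by simp
qed

text \<open>The beta integral with \<open>v = t\<^sup>2\<close> and exponent
  \<open>(1 + s) / 2\<close>. It serves three times: for the functional equation, for the Mellin
  transform of \<open>1 - cos\<close>, and for the integrability of
  \<open>\<bar>y\<bar> powr e / (1 + y\<^sup>2)\<close>.\<close>

lemma nn_integral_Mellin_kernel:
  fixes s c :: real
  assumes "-1 < s" "s < 1" "c > 0"
  shows "(\<integral>\<^sup>+t\<in>{0<..}. ennreal (t powr (s - 1) * (2 * t / (t\<^sup>2 + c\<^sup>2))) \<partial>lborel) =
     ennreal (Gamma ((1 + s) / 2) * Gamma ((1 - s) / 2) * c powr (s - 1))"
proof -
  define a where "a = (1 + s) / 2"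
  have a: "0 < a" "a < 1" using assms by (auto simp: a_def)
  have pw: "(t\<^sup>2) powr (a - 1) = t powr (s - 1)" if "t > 0" for t :: real
  proof -
    have "(t\<^sup>2) powr (a - 1) = t powr (2 * (a - 1))"
      using that powr_powr[of t 2 "a - 1"] by simp
    also have "2 * (a - 1) = s - 1" by (simp add: a_def field_simps)
    finally show ?thesis .
  qed
  have "ennreal (Gamma a * Gamma (1 - a) * (c\<^sup>2) powr (a - 1)) =
     (\<integral>\<^sup>+v\<in>{0<..}. ennreal (v powr (a - 1) / (v + c\<^sup>2)) \<partial>lborel)"
    by (rule nn_integral_Beta_half_line[symmetric]) (use a assms in auto)
  also have "\<dots> = (\<integral>\<^sup>+t\<in>{0<..}. ennreal ((t\<^sup>2) powr (a - 1) / (t\<^sup>2 + c\<^sup>2) * (2 * t)) \<partial>lborel)"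
    by (rule nn_integral_square_substitution) auto
  also have "\<dots> = (\<integral>\<^sup>+t\<in>{0<..}. ennreal (t powr (s - 1) * (2 * t / (t\<^sup>2 + c\<^sup>2))) \<partial>lborel)"
    by (intro nn_integral_cong)
       (auto split: split_indicator simp: pw)
  also have "(c\<^sup>2) powr (a - 1) = c powr (s - 1)"
    using assms by (intro pw) auto
  finally show ?thesis by (simp add: a_def field_simps)
qed

text \<open>\<open>L\<close> is the limit of integral minus sum for a decreasing \<open>f\<close>
  with primitive \<open>F\<close>. Between \<open>n\<close> and \<open>n + 1\<close> the ceiling is
  constantly \<open>n + 1\<close>, so each unit interval contributes one non-negative number
  \<open>d n\<close>. Only \<open>F\<close> has to be continuous at \<open>0\<close>, which admits
  the singular \<open>u powr (-s)\<close>. The lower bound keeps the first unit interval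
  alone.\<close>

lemma nn_integral_ceil_diff:
  fixes f F :: "real \<Rightarrow> real"
  assumes anti: "\<And>u v. 0 < u \<Longrightarrow> u \<le> v \<Longrightarrow> f v \<le> f u"
    and cont: "continuous_on {0..} F"
    and deriv: "\<And>u. u > 0 \<Longrightarrow> (F has_real_derivative f u) (at u)"
    and meas[measurable]: "f \<in> borel_measurable borel"
    and lim: "(\<lambda>N. F (real N) - F 0 - (\<Sum>n<N. f (real (Suc n)))) \<longlonglongrightarrow> L"
  shows "(\<integral>\<^sup>+u\<in>{0<..}. ennreal (f u - f (real_of_int \<lceil>u\<rceil>)) \<partial>lborel) = ennreal L"
    and "L \<ge> F 1 - F 0 - f 1" and "L \<ge> 0"
proof -
  define d where "d n = F (real (Suc n)) - F (real n) - f (real (Suc n))" for n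
  have int: "(\<integral>\<^sup>+u\<in>{real n<..real (Suc n)}. ennreal (f u - f (real_of_int \<lceil>u\<rceil>)) \<partial>lborel) = ennreal (d n)"
    and d: "d n \<ge> 0" for n
  proof -
    have "(f has_integral (F (real (Suc n)) - F (real n))) {real n..real (Suc n)}"
    proof (rule fundamental_theorem_of_calculus_interior)
      show "continuous_on {real n..real (Suc n)} F"
        by (rule continuous_on_subset[OF cont]) auto
      show "(F has_vector_derivative f x) (at x)" if "x \<in> {real n<..<real (Suc n)}" for x
        using deriv[of x] that by (auto simp: has_real_derivative_iff_has_vector_derivative)
    qed auto
    from has_integral_diff[OF this has_integral_const_real[of "f (real (Suc n))"]]
    have "((\<lambda>u. f u - f (real (Suc n))) has_integral d n) {real n..real (Suc n)}"
      by (simp add: d_def)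
    then have "((\<lambda>u. f u - f (real (Suc n))) has_integral d n) {real n<..real (Suc n)}"
      by (subst has_integral_spike_set_eq[where T = "{real n..real (Suc n)}"])
         (auto intro: negligible_subset[of "{real n}"])
    moreover have "f u - f (real_of_int \<lceil>u\<rceil>) = f u - f (real (Suc n))" if "u \<in> {real n<..real (Suc n)}" for u
    proof -
      have "\<lceil>u\<rceil> = int (Suc n)" using that by (intro ceiling_unique) auto
      then show ?thesis by simp
    qed
    ultimately have I: "((\<lambda>u. f u - f (real_of_int \<lceil>u\<rceil>)) has_integral d n) {real n<..real (Suc n)}"
      by (subst has_integral_cong)
    have nn: "f u - f (real_of_int \<lceil>u\<rceil>) \<ge> 0" if "u \<in> {real n<..real (Suc n)}" for u
      using anti[of u "real_of_int \<lceil>u\<rceil>"] that by auto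
    show "(\<integral>\<^sup>+u\<in>{real n<..real (Suc n)}. ennreal (f u - f (real_of_int \<lceil>u\<rceil>)) \<partial>lborel) = ennreal (d n)"
      by (rule nn_integral_has_integral_lebesgue'[OF nn I])
    show "d n \<ge> 0" by (rule has_integral_nonneg[OF I nn])
  qed
  have sum_d: "(\<Sum>n<N. d n) = F (real N) - F 0 - (\<Sum>n<N. f (real (Suc n)))" for N
    by (induction N) (auto simp: d_def)
  have sums: "d sums L" using lim by (simp add: sums_def sum_d)
  have ind: "ennreal c * indicator {0<..} u = (\<Sum>n. ennreal c * indicator {real n<..real (Suc n)} u)" for u c
  proof -
    have U: "(\<Union>n. {real n<..real (Suc n)}) = {0<..}"
    proof (intro equalityI subsetI)
      fix u :: real assume u: "u \<in> {0<..}"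
      define n where "n = nat (\<lceil>u\<rceil> - 1)"
      have "real n < u \<and> u \<le> real (Suc n)" using u unfolding n_def by simp linarith
      then show "u \<in> (\<Union>n. {real n<..real (Suc n)})" by auto
    qed auto
    have "disjoint_family (\<lambda>n. {real n<..real (Suc n)})"
      unfolding disjoint_family_on_def
    proof (intro ballI impI)
      fix m n :: nat assume "m \<noteq> n"
      then have "real (Suc m) \<le> real n \<or> real (Suc n) \<le> real m" by linarith
      then show "{real m<..real (Suc m)} \<inter> {real n<..real (Suc n)} = {}" by auto
    qed
    then have "(\<Sum>n. indicator {real n<..real (Suc n)} u :: ennreal) = indicator {0<..} u"
      by (simp only: suminf_indicator U)
    then show ?thesis by (simp add: ennreal_suminf_cmult)
  qed
  have "(\<integral>\<^sup>+u\<in>{0<..}. ennreal (f u - f (real_of_int \<lceil>u\<rceil>)) \<partial>lborel) =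
     (\<Sum>n. \<integral>\<^sup>+u\<in>{real n<..real (Suc n)}. ennreal (f u - f (real_of_int \<lceil>u\<rceil>)) \<partial>lborel)"
    unfolding ind by (subst nn_integral_suminf) auto
  also have "\<dots> = (\<Sum>n. ennreal (d n))" by (simp only: int)
  also have "\<dots> = ennreal L"
    by (rule suminf_ennreal_eq[OF d sums])
  finally show "(\<integral>\<^sup>+u\<in>{0<..}. ennreal (f u - f (real_of_int \<lceil>u\<rceil>)) \<partial>lborel) = ennreal L" .
  show "L \<ge> F 1 - F 0 - f 1"
    using sum_le_suminf[OF sums_summable[OF sums], of "{0}"] d sums_unique[OF sums] by (simp add: d_def)
  show "L \<ge> 0"
    using suminf_nonneg[OF sums_summable[OF sums] d] sums_unique[OF sums] by simp
qed

lemma zeta_reg_of_real: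
  fixes s :: real
  assumes "s > 0"
  shows "zeta_reg (of_real s) = of_real (Re (zeta_reg (of_real s)))"
    and "(\<lambda>N. (s - 1) * (\<Sum>n<N. real (Suc n) powr (-s)) + real (Suc N) powr (1 - s))
           \<longlonglongrightarrow> Re (zeta_reg (of_real s))"
proof -
  define r where "r N = (s - 1) * (\<Sum>n<N. real (Suc n) powr (-s)) + real (Suc N) powr (1 - s)" for N
  have "1 + (\<Sum>n<N. zeta_term n (of_real s)) = of_real (r N)" for N
  proof -
    have "(of_nat (Suc n) :: complex) powr of_real x = of_real (real (Suc n) powr x)" for n x
      using powr_of_real[of "real (Suc n)" x] by (simp del: of_nat_Suc)
    from this[of _ "-s"] this[of _ "1 - s"] show ?thesis
      unfolding sum_zeta_term r_def by simp
  qed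
  moreover have "(\<lambda>N. 1 + (\<Sum>n<N. zeta_term n (of_real s))) \<longlonglongrightarrow> 1 + (zeta_reg (of_real s) - 1)"
    by (intro tendsto_add tendsto_const zeta_term_sums[unfolded sums_def]) (use assms in auto)
  ultimately have lim: "(\<lambda>N. complex_of_real (r N)) \<longlonglongrightarrow> zeta_reg (of_real s)" by simp
  from tendsto_Re[OF lim] have "r \<longlonglongrightarrow> Re (zeta_reg (of_real s))" by simp
  then show "(\<lambda>N. (s - 1) * (\<Sum>n<N. real (Suc n) powr (-s)) + real (Suc N) powr (1 - s))
           \<longlonglongrightarrow> Re (zeta_reg (of_real s))" unfolding r_def .
  have "(\<lambda>N. 0) \<longlonglongrightarrow> Im (zeta_reg (of_real s))" using tendsto_Im[OF lim] by simp
  then show "zeta_reg (of_real s) = of_real (Re (zeta_reg (of_real s)))"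
    using LIMSEQ_unique tendsto_const by (intro complex_eqI) auto
qed

text \<open>\<open>L\<close> is \<open>- zeta s\<close>, the excess of the integral of
  \<open>u powr (-s)\<close> over the sum. Its positivity makes \<open>zeta_reg\<close> non-zero on
  the interval, in particular at \<open>1 / 2\<close>.\<close>

lemma nn_integral_zeta_reg:
  fixes s :: real
  assumes s: "0 < s" "s < 1"
  defines "L \<equiv> Re (zeta_reg (of_real s)) / (1 - s)"
  shows "(\<integral>\<^sup>+u\<in>{0<..}. ennreal (u powr (-s) - real_of_int \<lceil>u\<rceil> powr (-s)) \<partial>lborel) = ennreal L"
    and "L > 0"
proof -
  let ?F = "\<lambda>u. u powr (1 - s) / (1 - s)"
  have anti: "\<And>u v. 0 < u \<Longrightarrow> u \<le> v \<Longrightarrow> v powr (-s) \<le> u powr (-s)"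
    using s by (intro powr_mono2') auto
  have cont: "continuous_on {0..} ?F"
    using s by (intro continuous_intros continuous_on_powr') auto
  have deriv: "(?F has_real_derivative u powr (-s)) (at u)" if "u > 0" for u
    using that s by (auto intro!: derivative_eq_intros)
  have lim: "(\<lambda>N. ?F (real N) - ?F 0 - (\<Sum>n<N. real (Suc n) powr (-s))) \<longlonglongrightarrow> L"
  proof -
    \<comment> \<open>The partial sums of \<open>zeta_reg\<close> carry
      \<open>(N + 1) powr (1 - s)\<close>, the primitive carries \<open>N powr (1 - s)\<close>. The
      shift by one is harmless, since the difference is \<open>O(N powr (-s))\<close>.\<close>
    have "(\<lambda>N. real (Suc N) powr (1 - s) - real N powr (1 - s)) \<longlonglongrightarrow> 0"
    proof (rule Lim_null_comparison)
      show "eventually (\<lambda>N. norm (real (Suc N) powr (1 - s) - real N powr (1 - s)) \<le> \<bar>s - 1\<bar> * real N powr (-s)) sequentially"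
        using eventually_gt_at_top[of 0]
      proof eventually_elim
        case (elim N)
        have "norm (complex_of_real (real (Suc N)) powr (-(of_real (s - 1))) - of_real (real N) powr (-(of_real (s-1))))
           \<le> norm (complex_of_real (s - 1)) * real N powr (- Re (of_real (s - 1)) - 1) * (real (Suc N) - real N)"
          using elim s by (intro norm_powr_diff_le) auto
        moreover have "complex_of_real x powr (-(of_real (s - 1))) = of_real (x powr (1 - s))" if "x \<ge> 0" for x
          using that powr_of_real[of x "1 - s"] by simp
        ultimately have "norm (complex_of_real (real (Suc N) powr (1 - s) - real N powr (1 - s))) \<le>
            norm (complex_of_real (s - 1)) * real N powr (- Re (of_real (s - 1)) - 1) * (real (Suc N) - real N)"
          by (simp only: of_nat_0_le_iff of_real_diff)
        then show ?case by (simp only: norm_of_real real_norm_def) simp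
      qed
      show "(\<lambda>N. \<bar>s - 1\<bar> * real N powr (-s)) \<longlonglongrightarrow> 0"
        by (intro tendsto_mult_right_zero tendsto_neg_powr filterlim_real_sequentially) (use s in auto)
    qed
    from tendsto_diff[OF zeta_reg_of_real(2)[OF s(1)] this]
    have "(\<lambda>N. ((s - 1) * (\<Sum>n<N. real (Suc n) powr (-s)) + real N powr (1 - s)) / (1 - s)) \<longlonglongrightarrow>
       Re (zeta_reg (of_real s)) / (1 - s)"
      using s by (intro tendsto_divide) auto
    moreover have "((s - 1) * S + x) / (1 - s) = x / (1 - s) - S" for S x :: real
      using s by (simp add: field_simps)
    ultimately show ?thesis using s by (simp add: L_def)
  qed
  note * = nn_integral_ceil_diff[OF anti cont deriv _ lim, simplified]
  from *(1) show "(\<integral>\<^sup>+u\<in>{0<..}. ennreal (u powr (-s) - real_of_int \<lceil>u\<rceil> powr (-s)) \<partial>lborel) = ennreal L"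
    by simp
  have "1 / (1 - s) - 1 \<le> L" using *(2) by simp
  moreover have "1 / (1 - s) - 1 > 0" using s by (simp add: field_simps)
  ultimately show "L > 0" by linarith
qed

section \<open>Two families of functions with the same difference between integral and sum\<close>

definition mellin_kernel :: "real \<Rightarrow> real" where
  "mellin_kernel t = 1 / t - 1 / (exp t - 1)"

text \<open>The primitive contributes \<open>1 / t\<close>, the geometric series
  \<open>1 / (exp t - 1)\<close>.\<close>

lemma nn_integral_exp_ceil:
  assumes t: "t > 0"
  shows "(\<integral>\<^sup>+u\<in>{0<..}. ennreal (exp (- u * t) - exp (- real_of_int \<lceil>u\<rceil> * t)) \<partial>lborel) = ennreal (mellin_kernel t)"
proof -
  let ?F = "\<lambda>u. - exp (- u * t) / t"
  have anti: "\<And>u v. 0 < u \<Longrightarrow> u \<le> v \<Longrightarrow> exp (- v * t) \<le> exp (- u * t)" using t by simp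
  have cont: "continuous_on {0..} ?F" using t by (intro continuous_intros) auto
  have deriv: "(?F has_real_derivative exp (- u * t)) (at u)" if "u > 0" for u
    using that t by (auto intro!: derivative_eq_intros)
  have e: "norm (exp (- t)) < 1" using t by simp
  have "(\<lambda>n. exp (-t) * exp (-t) ^ n) sums (exp (-t) * (1 / (1 - exp (-t))))"
    by (intro sums_mult geometric_sums e)
  moreover have "exp (- real (Suc n) * t) = exp (-t) * exp (-t) ^ n" for n
  proof -
    have "- real (Suc n) * t = of_nat (Suc n) * (- t)" by (simp only: mult_minus_left mult_minus_right)
    then show ?thesis by (simp only: exp_of_nat_mult power_Suc)
  qed
  moreover have "exp (-t) * (1 / (1 - exp (-t))) = 1 / (exp t - 1)"
    using t by (simp add: exp_minus field_simps)
  ultimately have "(\<lambda>N. \<Sum>n<N. exp (- real (Suc n) * t)) \<longlonglongrightarrow> 1 / (exp t - 1)"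
    by (simp add: sums_def)
  moreover have "(\<lambda>N. exp (- real N * t)) \<longlonglongrightarrow> 0"
  proof -
    have "exp (- real N * t) = exp (-t) ^ N" for N using exp_of_nat_mult[of N "-t"] by simp
    then show ?thesis using LIMSEQ_power_zero[OF e] by simp
  qed
  ultimately have "(\<lambda>N. ?F (real N) - ?F 0 - (\<Sum>n<N. exp (- real (Suc n) * t)))
       \<longlonglongrightarrow> - 0 / t - (- 1 / t) - 1 / (exp t - 1)"
    using t by (intro tendsto_intros) auto
  then have lim: "(\<lambda>N. ?F (real N) - ?F 0 - (\<Sum>n<N. exp (- real (Suc n) * t))) \<longlonglongrightarrow> mellin_kernel t"
    by (simp add: mellin_kernel_def)
  show ?thesis by (rule nn_integral_ceil_diff(1)[OF anti cont deriv _ lim]) auto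
qed

text \<open>Logarithmic derivative of the reflection formula for
  \<open>Gamma z * Gamma (1 - z)\<close>.\<close>

lemma Digamma_reflection:
  fixes z :: complex
  assumes "z \<notin> \<int>"
  shows "Digamma (1 - z) - Digamma z = of_real pi * cot (of_real pi * z)"
proof -
  have z: "z \<notin> \<int>\<^sub>\<le>\<^sub>0" "1 - z \<notin> \<int>\<^sub>\<le>\<^sub>0"
    using assms nonpos_Ints_Int[of z] nonpos_Ints_Int[of "1 - z"] Ints_diff[of 1 "1 - z"] by auto
  have s: "sin (of_real pi * z) \<noteq> 0"
  proof
    assume "sin (of_real pi * z) = 0"
    then obtain n :: int where "of_real pi * z = of_real (of_int n * pi)"
      by (auto simp: sin_eq_0)
    then have "z = of_int n" by simp
    then show False using assms by simp
  qed
  have "((\<lambda>z. Gamma z * Gamma (1 - z)) has_field_derivative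
      Gamma z * Digamma z * Gamma (1 - z) - Gamma z * (Gamma (1 - z) * Digamma (1 - z))) (at z)"
    using z by (auto intro!: derivative_eq_intros)
  moreover have "(\<lambda>z::complex. Gamma z * Gamma (1 - z)) = (\<lambda>z. of_real pi / sin (of_real pi * z))"
    by (rule ext) (rule Gamma_reflection_complex)
  moreover have "((\<lambda>z. of_real pi / sin (of_real pi * z)) has_field_derivative
      - (of_real pi * (cos (of_real pi * z) * of_real pi)) / (sin (of_real pi * z) * sin (of_real pi * z))) (at z)"
    using s by (auto intro!: derivative_eq_intros)
  ultimately have "Gamma z * Digamma z * Gamma (1 - z) - Gamma z * (Gamma (1 - z) * Digamma (1 - z)) =
      - (of_real pi * (cos (of_real pi * z) * of_real pi)) / (sin (of_real pi * z) * sin (of_real pi * z))"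
    using DERIV_unique by metis
  then have "(Gamma z * Gamma (1 - z)) * (Digamma (1 - z) - Digamma z) =
      (of_real pi / sin (of_real pi * z)) * (of_real pi * cot (of_real pi * z))"
    using s by (simp add: cot_def field_simps)
  then show ?thesis
    unfolding Gamma_reflection_complex using s by simp
qed

text \<open>The difference of the Digamma series at \<open>1 - z\<close> and at \<open>z\<close> is
  the cotangent by reflection. Adding the telescoping series \<open>B\<close> moves the index in
  \<open>1 / (z + n)\<close> up by one and splits off \<open>1 / z\<close>.\<close>

lemma cot_partial_fractions:
  fixes z :: complex
  assumes z: "z \<notin> \<int>"
  shows "(\<lambda>n. 1 / (of_nat (Suc n) - z) - 1 / (of_nat (Suc n) + z)) sums (1 / z - of_real pi * cot (of_real pi * z))"
proof -
  have z0: "z \<noteq> 0" "1 - z \<noteq> 0" using z by auto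
  have d: "(\<lambda>n. inverse (of_nat (Suc n)) - inverse (z + of_nat n)) sums (Digamma z + euler_mascheroni)"
    if "z \<noteq> 0" for z :: complex
    using summable_Digamma[OF that] by (simp add: Digamma_def summable_sums)
  have "(\<lambda>n. inverse (z + of_nat n) - inverse (1 - z + of_nat n)) sums (Digamma (1 - z) - Digamma z)"
    using sums_diff[OF d[OF z0(2)] d[OF z0(1)]] by simp
  then have A: "(\<lambda>n. inverse (z + of_nat n) - inverse (1 - z + of_nat n)) sums (of_real pi * cot (of_real pi * z))"
    by (simp add: Digamma_reflection[OF z])
  have B: "(\<lambda>n. inverse (z + of_nat (Suc n)) - inverse (z + of_nat n)) sums (0 - inverse (z + of_nat 0))"
    by (intro telescope_sums filterlim_compose[OF tendsto_inverse_0]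
              tendsto_add_filterlim_at_infinity[OF tendsto_const] tendsto_of_nat)
  from sums_minus[OF sums_add[OF A B]] show ?thesis
    by (simp add: inverse_eq_divide algebra_simps)
qed

text \<open>Expansion of \<open>coth (t / 2) / 2 = 1 / 2 + 1 / (exp t - 1)\<close>, read off from
  the cotangent at the imaginary point \<open>\<i> * t / (2 * pi)\<close>.\<close>

lemma coth_partial_fractions:
  fixes t :: real
  assumes t: "t > 0"
  shows "(\<lambda>n. 2 * t / (t\<^sup>2 + (2 * pi * real (Suc n))\<^sup>2)) sums (1 / 2 - mellin_kernel t)"
proof -
  define y where "y = t / (2 * pi)"
  have y: "y > 0" using t by (simp add: y_def)
  define z where "z = \<i> * complex_of_real y"
  have "z \<notin> \<int>" using y by (auto simp: z_def Ints_def complex_eq_iff)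
  note sums = cot_partial_fractions[OF this]
  have summand: "1 / (of_nat (Suc n) - z) - 1 / (of_nat (Suc n) + z) = \<i> * of_real (2 * y / (y\<^sup>2 + (real (Suc n))\<^sup>2))" for n
  proof -
    define m where "m = complex_of_real (real (Suc n))"
    have nz: "m - z \<noteq> 0" "m + z \<noteq> 0"
      using y by (auto simp: m_def z_def complex_eq_iff)
    have "1 / (m - z) - 1 / (m + z) = 2 * z / (m\<^sup>2 - z\<^sup>2)"
      using nz by (simp add: diff_frac_eq power2_eq_square algebra_simps)
    also have "m\<^sup>2 - z\<^sup>2 = of_real (y\<^sup>2 + (real (Suc n))\<^sup>2)"
      by (simp add: m_def z_def power_mult_distrib)
    finally show ?thesis by (simp add: m_def z_def)
  qed
  have lim: "1 / z - of_real pi * cot (of_real pi * z) = \<i> * of_real (pi * (1 + 2 / (exp t - 1)) - 1 / y)"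
  proof -
    \<comment> \<open>\<open>E\<close> equals \<open>exp (t / 2)\<close>, so
      \<open>exp (\<i> * pi * z) = inverse E\<close> and the cotangent becomes rational in
      \<open>E * E = exp t\<close>.\<close>
    define E where "E = exp (complex_of_real (pi * y))"
    have E: "E * E = of_real (exp t)" by (simp add: E_def exp_of_real y_def flip: exp_add)
    have E0: "E \<noteq> 0" by (simp add: E_def)
    have E1: "E * E \<noteq> 1" unfolding E using t by simp
    have e: "\<i> * (of_real pi * z) = - of_real (pi * y)" by (simp add: z_def complex_eq_iff)
    have "exp (\<i> * (of_real pi * z)) = inverse E" "exp (- (\<i> * (of_real pi * z))) = E"
      unfolding e by (simp_all add: E_def exp_minus)
    then have "cot (of_real pi * z) = ((inverse E + E) / 2) / ((inverse E - E) / (2 * \<i>))"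
      by (simp only: cot_def cos_exp_eq sin_exp_eq)
    also have "\<dots> = \<i> * ((inverse E + E) / (inverse E - E))"
    proof -
      have "(x / 2) / (y / (2 * \<i>)) = \<i> * (x / y)" for x y :: complex
      proof -
        have "(x / 2) / (y / (2 * \<i>)) = (x / 2 * (2 * \<i>)) / y" by (rule divide_divide_eq_right)
        also have "x / 2 * (2 * \<i>) = \<i> * x" by simp
        finally show ?thesis by simp
      qed
      then show ?thesis .
    qed
    also have "(inverse E + E) / (inverse E - E) = (1 + E * E) / (1 - E * E)"
      using E0 E1 by (simp add: divide_simps)
    also have "\<dots> = - of_real (1 + 2 / (exp t - 1))"
    proof -
      have "complex_of_real (exp t) \<noteq> 1" using E1 by (simp add: E)
      then show ?thesis unfolding E by (simp add: field_simps)
    qed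
    finally have "cot (of_real pi * z) = - (\<i> * of_real (1 + 2 / (exp t - 1)))"
      by (simp only: mult_minus_right)
    moreover have "1 / z = - (\<i> * of_real (1 / y))" using y by (simp add: z_def field_simps)
    moreover have "- (\<i> * of_real v) - of_real pi * - (\<i> * of_real c) = \<i> * of_real (pi * c - v)" for c v :: real
      by (simp add: algebra_simps)
    ultimately show ?thesis by (simp only:)
  qed
  have "(\<lambda>n. \<i> * of_real (2 * y / (y\<^sup>2 + (real (Suc n))\<^sup>2))) sums (\<i> * complex_of_real (pi * (1 + 2 / (exp t - 1)) - 1 / y))"
    using sums unfolding summand lim .
  then have "(\<lambda>n. complex_of_real (2 * y / (y\<^sup>2 + (real (Suc n))\<^sup>2))) sums complex_of_real (pi * (1 + 2 / (exp t - 1)) - 1 / y)"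
    by (subst (asm) sums_mult_iff) auto
  then have "(\<lambda>n. 2 * y / (y\<^sup>2 + (real (Suc n))\<^sup>2)) sums (pi * (1 + 2 / (exp t - 1)) - 1 / y)"
    by (simp only: sums_of_real_iff)
  from sums_mult[OF this, of "1 / (2 * pi)"]
  have "(\<lambda>n. 1 / (2 * pi) * (2 * y / (y\<^sup>2 + (real (Suc n))\<^sup>2))) sums (1 / (2 * pi) * (pi * (1 + 2 / (exp t - 1)) - 1 / y))" .
  moreover have "1 / (2 * pi) * (2 * y / (y\<^sup>2 + (real (Suc n))\<^sup>2)) = 2 * t / (t\<^sup>2 + (2 * pi * real (Suc n))\<^sup>2)" for n
  proof -
    have "t = 2 * pi * y" by (simp add: y_def)
    moreover have "(2 * pi * y)\<^sup>2 + (2 * pi * m)\<^sup>2 = (2 * pi)\<^sup>2 * (y\<^sup>2 + m\<^sup>2)" for m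
      by (simp add: power_mult_distrib distrib_left)
    ultimately have "t\<^sup>2 + (2 * pi * real (Suc n))\<^sup>2 = (2 * pi)\<^sup>2 * (y\<^sup>2 + (real (Suc n))\<^sup>2)"
      by (simp only:)
    moreover have "1 / (2 * pi) * (2 * y / Q) = 2 * (2 * pi * y) / ((2 * pi)\<^sup>2 * Q)" for Q
      by (simp add: power2_eq_square)
    ultimately show ?thesis using \<open>t = 2 * pi * y\<close> by simp
  qed
  moreover have "1 / (2 * pi) * (pi * (1 + 2 / (exp t - 1)) - 1 / y) = 1 / 2 - mellin_kernel t"
    using t by (simp add: mellin_kernel_def y_def field_simps)
  ultimately show ?thesis by simp
qed

text \<open>The full integral over \<open>u\<close> is \<open>1 / 2\<close>, from the arctangent
  tending to \<open>pi / 2\<close>. It cancels the \<open>1 / 2\<close> in the expansion of coth and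
  leaves the same function as the exponential family.\<close>

lemma nn_integral_cauchy_ceil:
  assumes t: "t > 0"
  shows "(\<integral>\<^sup>+u\<in>{0<..}. ennreal (2 * t / (t\<^sup>2 + (2 * pi * u)\<^sup>2) - 2 * t / (t\<^sup>2 + (2 * pi * real_of_int \<lceil>u\<rceil>)\<^sup>2)) \<partial>lborel)
     = ennreal (mellin_kernel t)"
proof -
  let ?F = "\<lambda>u. arctan (2 * pi * u / t) / pi"
  have anti: "2 * t / (t\<^sup>2 + (2 * pi * v)\<^sup>2) \<le> 2 * t / (t\<^sup>2 + (2 * pi * u)\<^sup>2)" if "0 < u" "u \<le> v" for u v
    using t that by (intro divide_left_mono add_left_mono power_mono mult_left_mono mult_pos_pos add_pos_nonneg) auto
  have cont: "continuous_on {0..} ?F" using t by (intro continuous_intros) auto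
  have deriv: "(?F has_real_derivative 2 * t / (t\<^sup>2 + (2 * pi * u)\<^sup>2)) (at u)" if "u > 0" for u
  proof -
    have 1: "(2 * pi / t) / (1 + (2 * pi * u / t)\<^sup>2) / pi = 2 * t / (t\<^sup>2 + (2 * pi * u)\<^sup>2)"
    proof -
      have "1 + (2 * pi * u / t)\<^sup>2 = (t\<^sup>2 + (2 * pi * u)\<^sup>2) / t\<^sup>2"
        using t by (simp add: power_divide add_divide_distrib)
      moreover have "(2 * pi / t) / (Q / t\<^sup>2) / pi = 2 * t / Q" for Q
        using t by (cases "Q = 0") (simp_all add: power2_eq_square)
      ultimately show ?thesis by simp
    qed
    have "((\<lambda>u. 2 * pi * u / t) has_real_derivative (2 * pi / t)) (at u)"
      using t by (auto intro!: derivative_eq_intros)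
    from DERIV_cdivide[OF DERIV_chain2[OF DERIV_arctan this], of pi]
    show ?thesis
      by (rule DERIV_cong) (simp only: 1[symmetric], simp add: divide_inverse mult_ac)
  qed
  have "(\<lambda>N. arctan (2 * pi / t * real N)) \<longlonglongrightarrow> pi / 2"
    using t by (intro filterlim_compose[OF tendsto_arctan_at_top]
       filterlim_tendsto_pos_mult_at_top[OF tendsto_const] filterlim_real_sequentially) auto
  then have "(\<lambda>N. ?F (real N) - ?F 0 - (\<Sum>n<N. 2 * t / (t\<^sup>2 + (2 * pi * real (Suc n))\<^sup>2)))
     \<longlonglongrightarrow> pi / 2 / pi - ?F 0 - (1 / 2 - mellin_kernel t)"
    using coth_partial_fractions[OF t] unfolding sums_def by (intro tendsto_diff tendsto_divide tendsto_const) auto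
  then have lim: "(\<lambda>N. ?F (real N) - ?F 0 - (\<Sum>n<N. 2 * t / (t\<^sup>2 + (2 * pi * real (Suc n))\<^sup>2))) \<longlonglongrightarrow> mellin_kernel t"
    by simp
  show ?thesis by (rule nn_integral_ceil_diff(1)[OF anti cont deriv _ lim]) auto
qed

section \<open>The functional equation\<close>

lemma nn_integral_ennreal_diff:
  fixes f g :: "real \<Rightarrow> real"
  assumes [measurable]: "f \<in> borel_measurable borel" "g \<in> borel_measurable borel" "A \<in> sets borel"
    and le: "\<And>x. x \<in> A \<Longrightarrow> 0 \<le> g x \<and> g x \<le> f x" and "b \<ge> 0"
    and f: "(\<integral>\<^sup>+x\<in>A. ennreal (f x) \<partial>lborel) = ennreal a"
    and g: "(\<integral>\<^sup>+x\<in>A. ennreal (g x) \<partial>lborel) = ennreal b"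
  shows "(\<integral>\<^sup>+x\<in>A. ennreal (f x - g x) \<partial>lborel) = ennreal (a - b)"
proof -
  have "(\<integral>\<^sup>+x\<in>A. ennreal (f x - g x) \<partial>lborel) =
      (\<integral>\<^sup>+x. ennreal (f x) * indicator A x - ennreal (g x) * indicator A x \<partial>lborel)"
    using le by (intro nn_integral_cong) (auto split: split_indicator simp: ennreal_minus)
  also have "\<dots> = ennreal a - ennreal b"
    using le by (subst nn_integral_diff) (auto simp: f g intro!: AE_I2 split: split_indicator intro: ennreal_leI)
  finally show ?thesis using \<open>b \<ge> 0\<close> by (simp add: ennreal_minus)
qed

text \<open>Taking the Mellin transform in \<open>t\<close> first turns each section
  \<open>k u\<close> into \<open>C * u powr (-p)\<close>, so the difference between integral and sum
  over \<open>u\<close> becomes \<open>C\<close> times \<open>- zeta p\<close>. Monotonicity in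
  \<open>u\<close> makes the double integrand non-negative, which permits the exchange.\<close>

lemma mellin_transform_ceil_diff:
  fixes k :: "real \<Rightarrow> real \<Rightarrow> real" and s p C :: real
  assumes meas[measurable]: "(\<lambda>(u, t). k u t) \<in> borel_measurable (borel \<Otimes>\<^sub>M borel)"
    and nn: "\<And>u t. u > 0 \<Longrightarrow> t > 0 \<Longrightarrow> k u t \<ge> 0"
    and anti: "\<And>u v t. 0 < u \<Longrightarrow> u \<le> v \<Longrightarrow> t > 0 \<Longrightarrow> k v t \<le> k u t"
    and mellin: "\<And>u. u > 0 \<Longrightarrow> (\<integral>\<^sup>+t\<in>{0<..}. ennreal (t powr (s - 1) * k u t) \<partial>lborel) = ennreal (C * u powr (-p))"
    and ceil: "\<And>t. t > 0 \<Longrightarrow> (\<integral>\<^sup>+u\<in>{0<..}. ennreal (k u t - k (real_of_int \<lceil>u\<rceil>) t) \<partial>lborel) = ennreal (\<kappa> t)"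
    and "C > 0" and p: "0 < p" "p < 1"
  shows "(\<integral>\<^sup>+t\<in>{0<..}. ennreal (t powr (s - 1)) * ennreal (\<kappa> t) \<partial>lborel) =
     ennreal (C * (Re (zeta_reg (of_real p)) / (1 - p)))"
proof -
  have [measurable]: "(\<lambda>(u, t). k u t) \<in> borel_measurable (lborel \<Otimes>\<^sub>M lborel)"
    using meas by simp
  have m1[measurable]: "k u \<in> borel_measurable borel" for u by measurable
  have m2[measurable]: "(\<lambda>u. k u t) \<in> borel_measurable borel" for t by measurable
  have cu: "0 < u \<Longrightarrow> u \<le> real_of_int \<lceil>u\<rceil> \<and> 0 < real_of_int \<lceil>u\<rceil>" for u :: real by auto
  have "(\<integral>\<^sup>+t\<in>{0<..}. ennreal (t powr (s - 1)) * ennreal (\<kappa> t) \<partial>lborel) =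
     (\<integral>\<^sup>+t\<in>{0<..}. (\<integral>\<^sup>+u\<in>{0<..}. ennreal (t powr (s - 1) * (k u t - k (real_of_int \<lceil>u\<rceil>) t)) \<partial>lborel) \<partial>lborel)"
  proof (intro nn_integral_cong)
    fix t :: real
    have "(\<integral>\<^sup>+u\<in>{0<..}. ennreal (t powr (s - 1) * (k u t - k (real_of_int \<lceil>u\<rceil>) t)) \<partial>lborel) =
       ennreal (t powr (s - 1)) * ennreal (\<kappa> t)" if "t > 0"
      unfolding ceil[OF that, symmetric]
      by (subst nn_integral_cmult[symmetric])
         (auto intro!: nn_integral_cong split: split_indicator simp: ennreal_mult' mult_ac)
    then show "ennreal (t powr (s - 1)) * ennreal (\<kappa> t) * indicator {0<..} t =
      (\<integral>\<^sup>+u\<in>{0<..}. ennreal (t powr (s - 1) * (k u t - k (real_of_int \<lceil>u\<rceil>) t)) \<partial>lborel) * indicator {0<..} t"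
      by (auto split: split_indicator)
  qed
  also have "\<dots> = (\<integral>\<^sup>+u\<in>{0<..}. (\<integral>\<^sup>+t\<in>{0<..}. ennreal (t powr (s - 1) * (k u t - k (real_of_int \<lceil>u\<rceil>) t)) \<partial>lborel) \<partial>lborel)"
    by (rule nn_integral_set_swap) auto
  also have "\<dots> = (\<integral>\<^sup>+u\<in>{0<..}. ennreal C * ennreal (u powr (-p) - real_of_int \<lceil>u\<rceil> powr (-p)) \<partial>lborel)"
  proof (intro nn_integral_cong)
    fix u :: real
    have "(\<integral>\<^sup>+t\<in>{0<..}. ennreal (t powr (s - 1) * (k u t - k (real_of_int \<lceil>u\<rceil>) t)) \<partial>lborel) =
       ennreal C * ennreal (u powr (-p) - real_of_int \<lceil>u\<rceil> powr (-p))" if u: "u > 0"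
    proof -
      have "(\<integral>\<^sup>+t\<in>{0<..}. ennreal (t powr (s - 1) * k u t - t powr (s - 1) * k (real_of_int \<lceil>u\<rceil>) t) \<partial>lborel) =
         ennreal (C * u powr (-p) - C * real_of_int \<lceil>u\<rceil> powr (-p))"
      proof (rule nn_integral_ennreal_diff)
        show "0 \<le> t powr (s - 1) * k (real_of_int \<lceil>u\<rceil>) t \<and> t powr (s - 1) * k (real_of_int \<lceil>u\<rceil>) t \<le> t powr (s - 1) * k u t"
          if "t \<in> {0<..}" for t
          using cu[OF u] nn[of "real_of_int \<lceil>u\<rceil>" t] anti[of u "real_of_int \<lceil>u\<rceil>" t] that u
          by (auto intro!: mult_left_mono)
      qed (use mellin[OF u] mellin[of "real_of_int \<lceil>u\<rceil>"] cu[OF u] \<open>C > 0\<close> in auto)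
      then show ?thesis using \<open>C > 0\<close> by (simp add: ennreal_mult' flip: right_diff_distrib)
    qed
    then show "(\<integral>\<^sup>+t\<in>{0<..}. ennreal (t powr (s - 1) * (k u t - k (real_of_int \<lceil>u\<rceil>) t)) \<partial>lborel) * indicator {0<..} u =
       ennreal C * ennreal (u powr (-p) - real_of_int \<lceil>u\<rceil> powr (-p)) * indicator {0<..} u"
      by (auto split: split_indicator)
  qed
  also have "\<dots> = ennreal C * (\<integral>\<^sup>+u\<in>{0<..}. ennreal (u powr (-p) - real_of_int \<lceil>u\<rceil> powr (-p)) \<partial>lborel)"
    by (subst nn_integral_cmult[symmetric]) (auto simp: mult_ac)
  also have "\<dots> = ennreal C * ennreal (Re (zeta_reg (of_real p)) / (1 - p))"
    by (subst nn_integral_zeta_reg(1)[OF p]) (rule refl)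
  also have "\<dots> = ennreal (C * (Re (zeta_reg (of_real p)) / (1 - p)))"
    using \<open>C > 0\<close> by (intro ennreal_mult'[symmetric]) simp
  finally show ?thesis .
qed

text \<open>In terms of zeta this reads \<open>Gamma s * zeta s = C * zeta (1 - s)\<close>, both
  sides with the opposite sign. The exponential family gives the exponent \<open>p = s\<close>, the
  Cauchy family \<open>p = 1 - s\<close>.\<close>

lemma zeta_functional_equation_real:
  fixes s :: real
  assumes s: "0 < s" "s < 1"
  shows "Gamma s * (Re (zeta_reg (of_real s)) / (1 - s)) =
     (2 * pi) powr (s - 1) * Gamma ((1 + s) / 2) * Gamma ((1 - s) / 2) * (Re (zeta_reg (of_real (1 - s))) / s)"
proof -
  define C where "C = (2 * pi) powr (s - 1) * Gamma ((1 + s) / 2) * Gamma ((1 - s) / 2)"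
  have C: "C > 0" using s by (auto simp: C_def intro!: mult_pos_pos Gamma_real_pos)
  have A: "(\<integral>\<^sup>+t\<in>{0<..}. ennreal (t powr (s - 1)) * ennreal (mellin_kernel t) \<partial>lborel) =
     ennreal (Gamma s * (Re (zeta_reg (of_real s)) / (1 - s)))"
  proof (rule mellin_transform_ceil_diff)
    show "(\<integral>\<^sup>+t\<in>{0<..}. ennreal (t powr (s - 1) * exp (- u * t)) \<partial>lborel) = ennreal (Gamma s * u powr (- s))" if "u > 0" for u
      by (rule nn_integral_Gamma) (use s that in auto)
    show "(\<integral>\<^sup>+u\<in>{0<..}. ennreal (exp (- u * t) - exp (- real_of_int \<lceil>u\<rceil> * t)) \<partial>lborel) = ennreal (mellin_kernel t)" if "t > 0" for t
      by (rule nn_integral_exp_ceil[OF that])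
  qed (use s in \<open>auto simp: Gamma_real_pos\<close>)
  have B: "(\<integral>\<^sup>+t\<in>{0<..}. ennreal (t powr (s - 1)) * ennreal (mellin_kernel t) \<partial>lborel) =
     ennreal (C * (Re (zeta_reg (of_real (1 - s))) / (1 - (1 - s))))"
  proof (rule mellin_transform_ceil_diff)
    show "(\<integral>\<^sup>+t\<in>{0<..}. ennreal (t powr (s - 1) * (2 * t / (t\<^sup>2 + (2 * pi * u)\<^sup>2))) \<partial>lborel) =
        ennreal (C * u powr (- (1 - s)))" if "u > 0" for u
      using nn_integral_Mellin_kernel[of s "2 * pi * u"] s that by (simp add: C_def powr_mult mult_ac)
    show "(\<integral>\<^sup>+u\<in>{0<..}. ennreal (2 * t / (t\<^sup>2 + (2 * pi * u)\<^sup>2) - 2 * t / (t\<^sup>2 + (2 * pi * real_of_int \<lceil>u\<rceil>)\<^sup>2)) \<partial>lborel)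
        = ennreal (mellin_kernel t)" if "t > 0" for t
      by (rule nn_integral_cauchy_ceil[OF that])
    show "2 * t / (t\<^sup>2 + (2 * pi * v)\<^sup>2) \<le> 2 * t / (t\<^sup>2 + (2 * pi * u)\<^sup>2)" if "0 < u" "u \<le> v" "t > 0" for u v t :: real
      using that by (intro divide_left_mono add_left_mono power_mono mult_left_mono mult_pos_pos add_pos_nonneg) auto
  qed (use s C in auto)
  from A B have "ennreal (Gamma s * (Re (zeta_reg (of_real s)) / (1 - s))) =
     ennreal (C * (Re (zeta_reg (of_real (1 - s))) / s))" by simp
  moreover have "0 \<le> Gamma s * (Re (zeta_reg (of_real s)) / (1 - s))"
    using nn_integral_zeta_reg(2)[OF s] Gamma_real_pos[OF s(1)] by (intro mult_nonneg_nonneg) linarith+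
  moreover have "0 \<le> C * (Re (zeta_reg (of_real (1 - s))) / s)"
    using nn_integral_zeta_reg(2)[of "1 - s"] s C by (intro mult_nonneg_nonneg) auto
  ultimately have "Gamma s * (Re (zeta_reg (of_real s)) / (1 - s)) = C * (Re (zeta_reg (of_real (1 - s))) / s)"
    using ennreal_inj by blast
  then show ?thesis by (simp only: C_def)
qed

section \<open>Riemann's xi function and its relation to the non-trivial zeros\<close>

definition xi_right :: "complex \<Rightarrow> complex" where
  "xi_right s = zeta_reg s * of_real pi powr (- s / 2) * Gamma (s / 2 + 1)"

text \<open>\<open>xi_right\<close> is Riemann's xi: \<open>Gamma (s / 2 + 1)\<close> absorbs the
  factor \<open>s / 2\<close> of the usual formula and \<open>zeta_reg\<close> the factor
  \<open>s - 1\<close>. Since \<open>zeta_reg\<close> is controlled only for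
  \<open>Re s > 0\<close>, the rest of the plane is filled in by reflection; consistency on the
  critical strip is the functional equation.\<close>

definition xi :: "complex \<Rightarrow> complex" where
  "xi s = (if Re s > 0 then xi_right s else xi_right (1 - s))"

lemma Gamma_duplication_real:
  fixes s :: real
  assumes "s > 0"
  shows "Gamma (s / 2) * Gamma ((1 + s) / 2) = 2 powr (1 - s) * sqrt pi * Gamma s"
proof -
  have "complex_of_real s / 2 \<notin> \<int>\<^sub>\<le>\<^sub>0" "complex_of_real s / 2 + 1 / 2 \<notin> \<int>\<^sub>\<le>\<^sub>0"
    using assms by (auto elim!: nonpos_Ints_cases' simp: complex_eq_iff)
  from Gamma_legendre_duplication[OF this]
  have "complex_of_real (Gamma (s / 2) * Gamma (s / 2 + 1 / 2)) =
     of_real (exp ((1 - s) * ln 2) * sqrt pi * Gamma s)"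
    by (simp flip: Gamma_complex_of_real exp_of_real)
  then have "Gamma (s / 2) * Gamma (s / 2 + 1 / 2) = exp ((1 - s) * ln 2) * sqrt pi * Gamma s"
    by (simp only: of_real_eq_iff)
  then show ?thesis by (simp add: powr_def field_simps)
qed

text \<open>Duplication expresses \<open>Gamma s\<close> through \<open>Gamma (s / 2)\<close> and
  \<open>Gamma ((1 + s) / 2)\<close>; the latter also occurs on the other side of the functional
  equation and cancels. The factors \<open>s / 2\<close> and \<open>(1 - s) / 2\<close> are absorbed
  by the recurrence of Gamma, and the powers of \<open>pi\<close> then balance.\<close>

lemma xi_right_symmetric_real:
  fixes s :: real
  assumes s: "0 < s" "s < 1"
  shows "xi_right (of_real s) = xi_right (of_real (1 - s))"
proof -
  define R where "R s = Re (zeta_reg (of_real s))" for s :: real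
  define X where "X s = R s * pi powr (- s / 2) * Gamma (s / 2 + 1)" for s
  have xi: "xi_right (of_real s) = of_real (X s)" if "s > 0" for s
  proof -
    have "of_real pi powr (- complex_of_real s / 2) = of_real (pi powr (- s / 2))"
      using powr_of_real[of pi "- s / 2"] by simp
    moreover have "Gamma (complex_of_real s / 2 + 1) = of_real (Gamma (s / 2 + 1))"
      by (simp flip: Gamma_complex_of_real)
    ultimately show ?thesis
      unfolding xi_right_def X_def by (subst zeta_reg_of_real(1)[OF that]) (simp add: R_def)
  qed
  define G1 G2 where "G1 = Gamma ((1 + s) / 2)" and "G2 = Gamma ((1 - s) / 2)"
  have G: "G1 > 0" "G2 > 0" "Gamma (s / 2) > 0" using s by (auto simp: G1_def G2_def intro!: Gamma_real_pos)
  have "Gamma s = 2 powr (s - 1) / sqrt pi * (Gamma (s / 2) * G1)"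
    using Gamma_duplication_real[OF s(1)] by (simp add: G1_def powr_diff field_simps)
  with zeta_functional_equation_real[OF s]
  have "2 powr (s - 1) / sqrt pi * (Gamma (s / 2) * G1) * (R s / (1 - s)) =
     (2 * pi) powr (s - 1) * G1 * G2 * (R (1 - s) / s)"
    by (simp add: R_def G1_def G2_def)
  then have "(G1 * 2 powr (s - 1)) * (Gamma (s / 2) / sqrt pi * (R s / (1 - s))) =
     (G1 * 2 powr (s - 1)) * (pi powr (s - 1) * G2 * (R (1 - s) / s))"
    using pi_gt_zero by (simp add: powr_mult mult_ac)
  then have "Gamma (s / 2) / sqrt pi * (R s / (1 - s)) = pi powr (s - 1) * G2 * (R (1 - s) / s)"
    using G by (subst (asm) mult_cancel_left) auto
  then have "(s / 2 * Gamma (s / 2)) * R s / sqrt pi = pi powr (s - 1) * ((1 - s) / 2 * G2) * R (1 - s)"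
    using s by (simp add: field_simps)
  moreover have "s / 2 * Gamma (s / 2) = Gamma (s / 2 + 1)"
    by (subst Gamma_plus1) (use s in \<open>auto elim!: nonpos_Ints_cases'\<close>)
  moreover have "(1 - s) / 2 * G2 = Gamma ((1 - s) / 2 + 1)"
    unfolding G2_def by (subst Gamma_plus1) (use s in \<open>auto elim!: nonpos_Ints_cases'\<close>)
  ultimately have "Gamma (s / 2 + 1) * R s / sqrt pi = pi powr (s - 1) * Gamma ((1 - s) / 2 + 1) * R (1 - s)"
    by metis
  then have eq: "Gamma (s / 2 + 1) * R s / sqrt pi = pi powr (s - 1) * (Gamma ((1 - s) / 2 + 1) * R (1 - s))"
    by (simp only: mult.assoc)
  have p1: "pi powr (- s / 2) = pi powr ((1 - s) / 2) / sqrt pi"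
    by (simp add: powr_half_sqrt[symmetric] flip: powr_diff) (simp add: diff_divide_distrib)
  have p2: "pi powr (- (1 - s) / 2) = pi powr ((1 - s) / 2) * pi powr (s - 1)"
  proof -
    have "(1 - s) / 2 + (s - 1) = - (1 - s) / 2" by (simp add: field_simps)
    then show ?thesis by (simp only: powr_add[symmetric])
  qed
  have "pi powr (- s / 2) * (Gamma (s / 2 + 1) * R s) =
      pi powr ((1 - s) / 2) * (Gamma (s / 2 + 1) * R s / sqrt pi)"
    unfolding p1 by (simp only: times_divide_eq_left times_divide_eq_right)
  also have "\<dots> = pi powr (- (1 - s) / 2) * (Gamma ((1 - s) / 2 + 1) * R (1 - s))"
    unfolding eq p2 by (simp only: mult.assoc)
  finally have *: "pi powr (- s / 2) * (Gamma (s / 2 + 1) * R s) =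
      pi powr (- (1 - s) / 2) * (Gamma ((1 - s) / 2 + 1) * R (1 - s))" .
  have "X s = pi powr (- s / 2) * (Gamma (s / 2 + 1) * R s)"
    by (simp add: X_def)
  also note *
  also have "pi powr (- (1 - s) / 2) * (Gamma ((1 - s) / 2 + 1) * R (1 - s)) = X (1 - s)"
    by (simp add: X_def)
  finally have "X s = X (1 - s)" .
  then show ?thesis using xi[of s] xi[of "1 - s"] s by simp
qed

lemma holomorphic_xi_right: "xi_right holomorphic_on {s. Re s > 0}"
proof -
  have "s / 2 + 1 \<notin> \<int>\<^sub>\<le>\<^sub>0" if "Re s > 0" for s :: complex
    using that by (auto elim!: nonpos_Ints_cases' simp: complex_eq_iff)
  then show ?thesis
    unfolding xi_right_def by (intro holomorphic_intros holomorphic_zeta_reg) auto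
qed

lemma holomorphic_xi_right_reflect: "(\<lambda>s. xi_right (1 - s)) holomorphic_on {s. Re s < 1}"
proof -
  have "(\<lambda>s. 1 - s) holomorphic_on {s. Re s < 1}" by (intro holomorphic_intros)
  moreover have "(\<lambda>s. 1 - s) ` {s. Re s < 1} \<subseteq> {s. Re s > 0}" by auto
  ultimately show ?thesis
    using holomorphic_on_compose_gen[OF _ holomorphic_xi_right] by (simp add: o_def)
qed

text \<open>Both sides are holomorphic on the strip and agree on the real interval, which
  accumulates at \<open>1 / 2\<close>.\<close>

lemma xi_right_symmetric:
  assumes "0 < Re s" "Re s < 1"
  shows "xi_right s = xi_right (1 - s)"
proof -
  let ?S = "{s. 0 < Re s} \<inter> {s. Re s < 1}"
  define f where "f s = xi_right s - xi_right (1 - s)" for s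
  have "f s = 0"
  proof (rule analytic_continuation[where f = f and S = ?S and U = "of_real ` {0<..<1}" and \<xi> = "1 / 2"])
    show "f holomorphic_on ?S"
      unfolding f_def
      by (intro holomorphic_on_diff holomorphic_on_subset[OF holomorphic_xi_right]
            holomorphic_on_subset[OF holomorphic_xi_right_reflect]) auto
    show "open ?S" by (intro open_Int open_halfspace_Re_gt open_halfspace_Re_lt)
    show "connected ?S"
      by (intro convex_connected convex_Int convex_halfspace_Re_gt convex_halfspace_Re_lt)
    show "1 / 2 islimpt complex_of_real ` {0<..<1}"
      unfolding islimpt_approachable
    proof safe
      fix e :: real assume "e > 0"
      define d where "d = min (e / 2) (1 / 4)"
      have d: "d > 0" "d < e" "d < 1 / 2" using \<open>e > 0\<close> by (auto simp: d_def)
      have "complex_of_real (1 / 2 + d) \<in> of_real ` {0<..<1}" using d by (intro imageI) auto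
      moreover have "complex_of_real (1 / 2 + d) \<noteq> 1 / 2" "dist (complex_of_real (1 / 2 + d)) (1 / 2) < e"
        using d by (auto simp: dist_norm)
      ultimately show "\<exists>x'\<in>complex_of_real ` {0<..<1}. x' \<noteq> 1 / 2 \<and> dist x' (1 / 2) < e" by blast
    qed
    show "f z = 0" if "z \<in> complex_of_real ` {0<..<1}" for z
      using that xi_right_symmetric_real by (auto simp: f_def)
  qed (use assms in auto)
  then show ?thesis by (simp add: f_def)
qed

lemma xi_eq_reflect: "Re s < 1 \<Longrightarrow> xi s = xi_right (1 - s)"
  using xi_right_symmetric[of s] by (auto simp: xi_def)

lemma xi_reflect: "xi (1 - s) = xi s"
  using xi_right_symmetric[of s] by (auto simp: xi_def)

lemma holomorphic_xi: "xi holomorphic_on UNIV"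
proof -
  have "xi holomorphic_on {s. Re s > 0}"
    by (rule holomorphic_transform[OF holomorphic_xi_right]) (simp add: xi_def)
  moreover have "xi holomorphic_on {s. Re s < 1}"
    by (rule holomorphic_transform[OF holomorphic_xi_right_reflect]) (simp add: xi_eq_reflect)
  ultimately have "xi holomorphic_on ({s. Re s > 0} \<union> {s. Re s < 1})"
    by (intro holomorphic_on_Un open_halfspace_Re_gt open_halfspace_Re_lt)
  moreover have "{s. Re s > 0} \<union> {s. Re s < 1} = UNIV" by auto
  ultimately show ?thesis by simp
qed

text \<open>The quotient of zeta by \<open>xi\<close>. With \<open>rGamma\<close> the poles of Gamma
  appear as zeros, exactly the trivial zeros of zeta; the denominator carries the pole at
  \<open>1\<close>.\<close>

definition zeta_cofactor :: "complex \<Rightarrow> complex" where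
  "zeta_cofactor s = of_real pi powr (s / 2) * rGamma (s / 2 + 1) / (s - 1)"

lemma xi_cofactor:
  assumes "Re s > 0"
  shows "xi s * zeta_cofactor s = zeta_reg s / (s - 1)"
proof -
  have "s / 2 + 1 \<notin> \<int>\<^sub>\<le>\<^sub>0"
    using assms by (auto elim!: nonpos_Ints_cases' simp: complex_eq_iff)
  then have 1: "Gamma (s / 2 + 1) * rGamma (s / 2 + 1) = 1"
    by (simp add: Gamma_def rGamma_eq_zero_iff)
  have 2: "of_real pi powr (- s / 2) * of_real pi powr (s / 2) = (1::complex)"
    by (simp add: powr_minus)
  have "xi s * zeta_cofactor s = zeta_reg s * (of_real pi powr (- s / 2) * of_real pi powr (s / 2)) *
      (Gamma (s / 2 + 1) * rGamma (s / 2 + 1)) / (s - 1)"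
    using assms by (simp add: xi_def xi_right_def zeta_cofactor_def)
  then show ?thesis by (simp only: 1 2 mult_1_right)
qed

lemma holomorphic_zeta_cofactor: "zeta_cofactor holomorphic_on (- {1})"
  unfolding zeta_cofactor_def by (intro holomorphic_intros) auto

text \<open>The product meets the three defining conditions, and any other solution agrees with it
  for \<open>Re s > 1\<close>, hence on the connected punctured plane. Here the description operator
  in \<open>zeta\<close> is resolved.\<close>

lemma zeta_eq: "zeta = (\<lambda>s. if s = 1 then 0 else xi s * zeta_cofactor s)"
proof -
  let ?P = "\<lambda>f. f holomorphic_on (- {1}) \<and>
      (\<forall>s. Re s > 1 \<longrightarrow> (\<lambda>n. 1 / of_nat (Suc n) powr s) sums f s) \<and> f 1 = (0::complex)"
  let ?f = "\<lambda>s. if s = 1 then 0 else xi s * zeta_cofactor s"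
  have "?f holomorphic_on (- {1})"
  proof (rule holomorphic_transform)
    show "(\<lambda>s. xi s * zeta_cofactor s) holomorphic_on - {1}"
      by (intro holomorphic_on_mult holomorphic_zeta_cofactor holomorphic_on_subset[OF holomorphic_xi]) auto
  qed auto
  moreover have "(\<lambda>n. 1 / of_nat (Suc n) powr s) sums ?f s" if "Re s > 1" for s
    using zeta_reg_dirichlet[OF that] xi_cofactor[of s] that by auto
  ultimately have f: "?P ?f" by auto
  have "g = ?f" if g: "?P g" for g
  proof
    fix s
    show "g s = ?f s"
    proof (cases "s = 1")
      case False
      show ?thesis
      proof (rule analytic_continuation_open[where s = "{s. Re s > 1}" and s' = "- {1}" and f = g and g = ?f])
        show "open {s. Re s > 1}" by (rule open_halfspace_Re_gt)
        show "connected (- {1 :: complex})" by (rule connected_punctured_universe) simp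
        show "open (- {1 :: complex})" by (intro open_Compl closed_singleton)
        show "{s. Re s > 1} \<noteq> {}" by (auto intro: exI[of _ 2])
        show "g z = ?f z" if "z \<in> {s. Re s > 1}" for z
          using that g f sums_unique2 by blast
      qed (use False g f in auto)
    qed (use g in simp)
  qed
  then show ?thesis unfolding zeta_def using f by (intro the_equality) blast+
qed

lemma zeta_reg_nonzero_real:
  assumes "x > 1"
  shows "zeta_reg (of_real x) \<noteq> 0"
proof
  assume "zeta_reg (of_real x) = 0"
  then have "(\<lambda>n. 1 / of_nat (Suc n) powr complex_of_real x) sums 0"
    using zeta_reg_dirichlet[of "of_real x"] assms by simp
  moreover have "1 / of_nat (Suc n) powr complex_of_real x = of_real (1 / real (Suc n) powr x)" for n
    using powr_of_real[of "real (Suc n)" x] by (simp del: of_nat_Suc)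
  ultimately have "(\<lambda>n. complex_of_real (1 / real (Suc n) powr x)) sums of_real 0" by simp
  then have "(\<lambda>n. 1 / real (Suc n) powr x) sums 0" by (simp only: sums_of_real_iff)
  then show False
    using suminf_pos[of "\<lambda>n. 1 / real (Suc n) powr x"] by (auto simp: sums_iff)
qed

lemma zeta_reg_1: "zeta_reg 1 = 1"
proof -
  have "zeta_term n 1 = 0" for n by (simp add: zeta_term_def del: of_nat_Suc)
  then show ?thesis by (simp add: zeta_reg_def)
qed

lemma xi_right_eq_0_iff: "Re s > 0 \<Longrightarrow> xi_right s = 0 \<longleftrightarrow> zeta_reg s = 0"
proof -
  assume "Re s > 0"
  then have "s / 2 + 1 \<notin> \<int>\<^sub>\<le>\<^sub>0" by (auto elim!: nonpos_Ints_cases' simp: complex_eq_iff)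
  then show ?thesis by (simp add: xi_right_def Gamma_eq_zero_iff)
qed

lemma zeta_cofactor_nonzero:
  assumes "s \<noteq> 1" "\<not> (\<exists>k::nat. k \<ge> 1 \<and> s = - 2 * of_nat k)"
  shows "zeta_cofactor s \<noteq> 0"
proof -
  have "s / 2 + 1 \<notin> \<int>\<^sub>\<le>\<^sub>0"
  proof
    assume "s / 2 + 1 \<in> \<int>\<^sub>\<le>\<^sub>0"
    then obtain n where n: "s / 2 + 1 = - of_nat n" by (rule nonpos_Ints_cases')
    have "s / 2 = (s / 2 + 1) - 1" by simp
    then have h: "s / 2 = - of_nat n - 1" unfolding n .
    have "s = 2 * (s / 2)" by simp
    also have "\<dots> = - 2 * of_nat (Suc n)" unfolding h by (simp add: algebra_simps)
    finally have "s = - 2 * of_nat (Suc n)" .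
    then show False using assms(2) by (metis le_add1 plus_1_eq_Suc)
  qed
  then show ?thesis using assms(1) by (simp add: zeta_cofactor_def rGamma_eq_zero_iff)
qed

text \<open>Off the zeros of the cofactor, zeta and \<open>xi\<close> vanish together. Conversely
  \<open>xi\<close> must not vanish at the excluded points: at \<open>1\<close> because
  \<open>zeta_reg 1 = 1\<close>, and at \<open>- 2 * k\<close> because reflection leads to
  \<open>1 + 2 * k\<close>, where the Dirichlet series has positive terms.\<close>

lemma nontrivial_zeros_eq: "nontrivial_zeros = {s. xi s = 0}"
proof (intro equalityI subsetI)
  fix s assume "s \<in> nontrivial_zeros"
  then show "s \<in> {s. xi s = 0}"
    using zeta_cofactor_nonzero[of s] by (auto simp: nontrivial_zeros_def zeta_eq)
next
  fix s assume "s \<in> {s. xi s = 0}"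
  then have s: "xi s = 0" by simp
  have "s \<noteq> 1" using s by (auto simp: xi_def xi_right_eq_0_iff zeta_reg_1)
  moreover have "s \<noteq> - 2 * of_nat k" if "k \<ge> 1" for k :: nat
  proof
    assume "s = - 2 * of_nat k"
    then have "zeta_reg (of_real (1 + 2 * real k)) = 0"
      using s that by (simp add: xi_def xi_right_eq_0_iff)
    then show False using zeta_reg_nonzero_real[of "1 + 2 * real k"] that by simp
  qed
  ultimately show "s \<in> nontrivial_zeros"
    using s by (auto simp: nontrivial_zeros_def zeta_eq)
qed

lemma zeta_reg_one_half_nonzero: "zeta_reg (1 / 2) \<noteq> 0"
  using nn_integral_zeta_reg(2)[of "1 / 2"] by auto

lemma xi_one_half_nonzero: "xi (1 / 2) \<noteq> 0"
  using zeta_reg_one_half_nonzero by (simp add: xi_def xi_right_eq_0_iff)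

lemma eventually_xi_nonzero: "eventually (\<lambda>w. xi w \<noteq> 0) (at s)"
  using non_zero_neighbour_alt[OF holomorphic_xi open_UNIV connected_UNIV, of s "1 / 2"] xi_one_half_nonzero
  by simp

text \<open>The cofactor is analytic and non-zero at such a point, hence of order \<open>0\<close>;
  multiplicities may be counted on \<open>xi\<close>.\<close>

lemma zorder_zeta_eq:
  assumes "s \<in> nontrivial_zeros"
  shows "zorder zeta s = zorder xi s"
proof -
  have s: "s \<noteq> 1" "zeta_cofactor s \<noteq> 0"
    using assms zeta_cofactor_nonzero by (auto simp: nontrivial_zeros_def)
  have xi: "xi analytic_on {s}"
    using holomorphic_xi by (simp add: analytic_on_open holomorphic_on_imp_analytic_at)
  have co: "zeta_cofactor analytic_on {s}"
    using holomorphic_zeta_cofactor s by (auto intro!: holomorphic_on_imp_analytic_at[of _ "- {1}"])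
  have "eventually (\<lambda>w. w \<in> - {1}) (nhds s)"
    using s by (intro eventually_nhds_in_open) auto
  then have ev: "eventually (\<lambda>w. zeta w = xi w * zeta_cofactor w) (at s)"
    unfolding eventually_at_filter by eventually_elim (auto simp: zeta_eq)
  have nz: "eventually (\<lambda>w. zeta_cofactor w \<noteq> 0) (at s)"
    using analytic_at_imp_isCont[OF co] s(2) by (intro tendsto_imp_eventually_ne) (auto simp: isCont_def)
  have "zorder zeta s = zorder (\<lambda>w. xi w * zeta_cofactor w) s"
    by (rule zorder_cong[OF ev]) simp
  also have "\<dots> = zorder xi s + zorder zeta_cofactor s"
    by (rule zorder_times_analytic[OF xi co])
       (use eventually_conj[OF eventually_xi_nonzero nz] in \<open>simp add: mult_eq_0_iff\<close>)
  also have "zorder zeta_cofactor s = 0" by (rule zorder_eq_0I[OF co s(2)])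
  finally show ?thesis by simp
qed

section \<open>Growth of xi\<close>

lemma norm_Gamma_le:
  assumes "Re s > 0"
  shows "norm (Gamma s) \<le> Gamma (Re s)"
proof -
  have f: "((\<lambda>t. of_real t powr (s - 1) / of_real (exp t)) has_integral Gamma s) {0..}"
    by (rule Gamma_integral_complex[OF assms])
  have g: "((\<lambda>t. t powr (Re s - 1) / exp t) has_integral Gamma (Re s)) {0..}"
    by (rule Gamma_integral_real[OF assms])
  have "norm (integral {0..} (\<lambda>t. of_real t powr (s - 1) / complex_of_real (exp t))) \<le>
      integral {0..} (\<lambda>t. t powr (Re s - 1) / exp t)"
  proof (rule integral_norm_bound_integral)
    fix t :: real assume "t \<in> {0..}"
    then show "norm (of_real t powr (s - 1) / complex_of_real (exp t)) \<le> t powr (Re s - 1) / exp t"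
      by (simp add: norm_divide norm_powr_real_powr)
  qed (use f g in auto)
  then show ?thesis using f g by (simp add: integral_unique)
qed

text \<open>Compactness gives a bound on \<open>[1, 2]\<close>, and
  \<open>Gamma x = (x - 1) * Gamma (x - 1)\<close> climbs one unit interval at a time. This crude
  form of Stirling's bound suffices for the order of growth.\<close>

lemma Gamma_real_upper_bound:
  obtains M :: real where "M > 0" "\<And>x. x \<ge> 1 \<Longrightarrow> Gamma x \<le> M * x powr x"
proof -
  have "continuous_on {1..2} (Gamma :: real \<Rightarrow> real)"
    by (intro continuous_on_Gamma continuous_on_id) (auto elim!: nonpos_Ints_cases')
  then have "bounded (Gamma ` {1..2::real})"
    using compact_continuous_image compact_imp_bounded by blast
  then obtain M where M: "M > 0" "\<And>x. x \<in> {1..2::real} \<Longrightarrow> \<bar>Gamma x\<bar> \<le> M"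
    unfolding bounded_pos by auto
  have "Gamma x \<le> M * x powr x" if "x \<ge> 1" "x \<le> 2 + real n" for x n
    using that
  proof (induction n arbitrary: x)
    case 0
    have "1 \<le> x powr x" using 0 by (intro ge_one_powr_ge_zero) auto
    moreover have "Gamma x \<le> M" using M(2)[of x] 0 by auto
    ultimately have "Gamma x * 1 \<le> M * x powr x" using M(1) by (intro mult_mono) auto
    then show ?case by simp
  next
    case (Suc n)
    show ?case
    proof (cases "x \<le> 2")
      case True
      then show ?thesis using Suc.IH[of x] Suc.prems by auto
    next
      case False
      define y where "y = x - 1"
      have y: "y \<ge> 1" "y \<le> 2 + real n" using False Suc.prems by (auto simp: y_def)
      have "Gamma x = y * Gamma y"
      proof -
        have "y \<notin> \<int>\<^sub>\<le>\<^sub>0" using y by (auto elim!: nonpos_Ints_cases')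
        from Gamma_plus1[OF this] show ?thesis by (simp add: y_def)
      qed
      also have "\<dots> \<le> y * (M * y powr y)" using Suc.IH[OF y] y by (intro mult_left_mono) auto
      also have "\<dots> = M * y powr x" using y by (simp add: y_def powr_diff)
      also have "\<dots> \<le> M * x powr x" using y M(1) by (intro mult_left_mono powr_mono2) (auto simp: y_def)
      finally show ?thesis .
    qed
  qed
  then have "Gamma x \<le> M * x powr x" if "x \<ge> 1" for x
    using that real_arch_simple[of "x - 2"] by (metis add.commute diff_le_eq)
  then show ?thesis using that M(1) by blast
qed

text \<open>The estimate \<open>ln x \<le> 2 * sqrt x\<close> trades the logarithm for half a power;
  the resulting exponent \<open>3 / 2\<close> stays below the critical value
  \<open>2\<close>.\<close>

lemma powr_self_le_exp:
  fixes x :: real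
  assumes "x \<ge> 1"
  shows "x powr x \<le> exp (2 * x powr (3 / 2))"
proof -
  have "ln x = 2 * ln (sqrt x)" using assms by (simp add: ln_sqrt)
  also have "\<dots> \<le> 2 * sqrt x" using assms ln_le_minus_one[of "sqrt x"] by simp
  finally have "x * ln x \<le> x * (2 * sqrt x)" using assms by (intro mult_left_mono) auto
  also have "x * (2 * sqrt x) = 2 * (x powr 1 * x powr (1 / 2))" using assms by (simp add: powr_half_sqrt)
  also have "\<dots> = 2 * x powr (3 / 2)" by (subst powr_add[symmetric]) simp
  finally show ?thesis using assms by (simp add: powr_def)
qed

text \<open>What matters is an exponent below \<open>2\<close>. The symmetry of \<open>xi\<close>
  reduces the claim to \<open>Re z \<ge> 0\<close>, where the explicit formula applies.\<close>

lemma xi_growth: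
  obtains C where "C > 0" "\<And>z. norm (xi (1 / 2 + z)) \<le> exp (C * (1 + norm z) powr (3 / 2))"
proof -
  define K where "K = (\<Sum>n. real (Suc n) powr (- (1 / 2) - 1))"
  have K: "K \<ge> 0" unfolding K_def
    using summable_Suc_powr[of "3 / 2"] by (intro suminf_nonneg) auto
  obtain M :: real where M: "M > 0" "\<And>x. x \<ge> 1 \<Longrightarrow> Gamma x \<le> M * x powr x"
    using Gamma_real_upper_bound by blast
  \<comment> \<open>The summands of \<open>C\<close> answer for the constant
    \<open>(1 + K) * M\<close>, for the factor \<open>y * y\<close>, and for Gamma at an argument of
    real part at most \<open>2 * y\<close>.\<close>
  define C where "C = (1 + K) * M + 2 + 2 * 2 powr (3 / 2)"
  have "C > 0" using K M by (auto simp: C_def intro!: add_nonneg_pos add_nonneg_pos)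
  have half: "norm (xi_right (1 / 2 + z)) \<le> exp (C * (1 + norm z) powr (3 / 2))" if z: "Re z \<ge> 0" for z
  proof -
    define s where "s = 1 / 2 + z"
    define y where "y = 1 + norm z"
    have y: "y \<ge> 1" by (simp add: y_def)
    have y32: "y \<le> y powr (3 / 2)" using powr_mono[of 1 "3 / 2" y] y by simp
    have "norm s \<le> y" using norm_triangle_ineq[of "1 / 2" z] by (simp add: s_def y_def)
    moreover have "norm (s - 1) \<le> y" using norm_triangle_ineq[of "- (1 / 2)" z] by (simp add: s_def y_def)
    moreover have "norm (zeta_reg s) \<le> 1 + norm (s - 1) * norm s * K"
      unfolding K_def by (rule norm_zeta_reg_le) (use z in \<open>auto simp: s_def\<close>)
    ultimately have "norm (zeta_reg s) \<le> 1 + y * y * K"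
      using K y by (smt (verit) mult_mono mult_right_mono norm_ge_zero)
    also have "\<dots> \<le> y * y + y * y * K" using y mult_mono[of 1 y 1 y] by simp
    finally have 1: "norm (zeta_reg s) \<le> (1 + K) * (y * y)" by (simp add: algebra_simps)
    have "norm (of_real pi powr (- s / 2)) = pi powr (- Re s / 2)"
      by (subst norm_powr_real_powr) auto
    also have "\<dots> \<le> pi powr 0" using z pi_ge_two by (intro powr_mono) (auto simp: s_def)
    finally have 2: "norm (of_real pi powr (- s / 2)) \<le> 1" by simp
    define x where "x = Re s / 2 + 1"
    have x: "x \<ge> 1" "x \<le> 2 * y"
      using z abs_Re_le_cmod[of z] by (auto simp: x_def s_def y_def)
    have "norm (Gamma (s / 2 + 1)) \<le> Gamma x"
      using norm_Gamma_le[of "s / 2 + 1"] x by (simp add: x_def)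
    also have "\<dots> \<le> M * x powr x" by (rule M(2)[OF x(1)])
    also have "\<dots> \<le> M * exp (2 * x powr (3 / 2))"
      using M(1) powr_self_le_exp[OF x(1)] by (intro mult_left_mono) auto
    also have "\<dots> \<le> M * exp (2 * (2 * y) powr (3 / 2))"
      using M(1) x by (intro mult_left_mono) (auto intro!: powr_mono2)
    finally have 3: "norm (Gamma (s / 2 + 1)) \<le> M * exp (2 * (2 * y) powr (3 / 2))" .
    have "norm (xi_right s) = norm (zeta_reg s) * norm (of_real pi powr (- s / 2)) * norm (Gamma (s / 2 + 1))"
      by (simp add: xi_right_def norm_mult)
    also have "\<dots> \<le> ((1 + K) * (y * y)) * 1 * (M * exp (2 * (2 * y) powr (3 / 2)))"
      using 1 2 3 K y by (intro mult_mono) auto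
    also have "\<dots> = ((1 + K) * M) * (y * y) * exp (2 * (2 * y) powr (3 / 2))" by (simp add: mult_ac)
    also have "\<dots> \<le> exp ((1 + K) * M * y powr (3 / 2)) * (exp (y powr (3 / 2)) * exp (y powr (3 / 2))) *
        exp (2 * (2 * y) powr (3 / 2))"
    proof (intro mult_mono order_refl)
      have "(1 + K) * M * 1 \<le> (1 + K) * M * y powr (3 / 2)"
        using K M y y32 by (intro mult_left_mono) auto
      also have "\<dots> \<le> exp ((1 + K) * M * y powr (3 / 2))"
        using exp_ge_add_one_self[of "(1 + K) * M * y powr (3 / 2)"] by linarith
      finally show "(1 + K) * M \<le> exp ((1 + K) * M * y powr (3 / 2))" by simp
      show "y \<le> exp (y powr (3 / 2))"
        using exp_ge_add_one_self[of "y powr (3 / 2)"] y32 by linarith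
      then show "y \<le> exp (y powr (3 / 2))" .
    qed (use K M y in auto)
    also have "\<dots> = exp (C * y powr (3 / 2))"
      by (simp add: C_def exp_add[symmetric] powr_mult algebra_simps)
    finally show ?thesis by (simp add: s_def y_def)
  qed
  show ?thesis
  proof (rule that[OF \<open>C > 0\<close>])
    fix z
    show "norm (xi (1 / 2 + z)) \<le> exp (C * (1 + norm z) powr (3 / 2))"
    proof (cases "Re z \<ge> 0")
      case True
      then show ?thesis using half[of z] by (simp add: xi_def)
    next
      case False
      have "xi (1 / 2 + z) = xi_right (1 - (1 / 2 + z))" using False by (intro xi_eq_reflect) auto
      also have "1 - (1 / 2 + z) = 1 / 2 + (- z)" by simp
      finally show ?thesis using half[of "- z"] False by (simp del: minus_add_distrib)
    qed
  qed
qed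

section \<open>Logarithmic derivatives of even entire functions\<close>

text \<open>Away from \<open>a\<close> the quotient is holomorphic, near \<open>a\<close> it
  coincides with \<open>zor_poly\<close>; the two open pieces cover the plane.\<close>

lemma factor_out_zero:
  fixes f :: "complex \<Rightarrow> complex"
  assumes f: "f holomorphic_on UNIV" and nz: "f \<beta> \<noteq> 0"
  obtains g where "g holomorphic_on UNIV" "g a \<noteq> 0"
    "\<And>z. f z = g z * (z - a) ^ nat (zorder f a)"
proof -
  define n where "n = nat (zorder f a)"
  define h where "h = zor_poly f a"
  have "\<exists>r>0. cball a r \<subseteq> UNIV \<and> h holomorphic_on cball a r \<and>
      (\<forall>w\<in>cball a r. f w = h w * (w - a) ^ n \<and> h w \<noteq> 0)"
    using zorder_exist_zero[OF f open_UNIV connected_UNIV UNIV_I, of a] nz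
    unfolding h_def n_def by blast
  then obtain r where r: "r > 0" and h: "h holomorphic_on cball a r"
    "\<And>w. w \<in> cball a r \<Longrightarrow> f w = h w * (w - a) ^ n \<and> h w \<noteq> 0" by blast
  define g where "g z = (if z = a then h a else f z / (z - a) ^ n)" for z
  have gh: "g w = h w" if "w \<in> cball a r" for w
    using h(2)[OF that] by (auto simp: g_def)
  have "g holomorphic_on (UNIV - {a})"
  proof (rule holomorphic_transform)
    show "(\<lambda>z. f z / (z - a) ^ n) holomorphic_on UNIV - {a}"
      by (intro holomorphic_intros holomorphic_on_subset[OF f]) auto
  qed (auto simp: g_def)
  moreover have "g holomorphic_on ball a r"
    by (rule holomorphic_transform[OF holomorphic_on_subset[OF h(1)]]) (auto simp: gh)
  ultimately have "g holomorphic_on ((UNIV - {a}) \<union> ball a r)"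
    by (intro holomorphic_on_Un) auto
  moreover have "(UNIV - {a}) \<union> ball a r = UNIV" using r by auto
  ultimately have "g holomorphic_on UNIV" by simp
  moreover have "g a \<noteq> 0" using h(2)[of a] r by (simp add: g_def)
  moreover have "f z = g z * (z - a) ^ n" for z
    using h(2)[of a] r by (cases "z = a") (auto simp: g_def)
  ultimately show ?thesis using that by (simp add: n_def)
qed

lemma eventually_nonzero_entire:
  fixes f :: "complex \<Rightarrow> complex"
  assumes "f holomorphic_on UNIV" "f \<beta> \<noteq> 0"
  shows "eventually (\<lambda>w. f w \<noteq> 0) (at z)"
  using non_zero_neighbour_alt[OF assms(1) open_UNIV connected_UNIV UNIV_I UNIV_I assms(2), of z] by simp

text \<open>The points are removed one at a time. At the next point \<open>b\<close> the product
  over the earlier ones does not vanish, so \<open>b\<close> has the same order for \<open>f\<close>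
  and for the current quotient.\<close>

lemma factor_out_zeros:
  fixes f :: "complex \<Rightarrow> complex"
  assumes f: "f holomorphic_on UNIV" and nz: "f \<beta> \<noteq> 0" and "finite A"
  obtains g where "g holomorphic_on UNIV" "\<And>a. a \<in> A \<Longrightarrow> g a \<noteq> 0"
    "\<And>z. f z = g z * (\<Prod>a\<in>A. (z - a) ^ nat (zorder f a))"
proof -
  have "\<exists>g. g holomorphic_on UNIV \<and> (\<forall>a\<in>A. g a \<noteq> 0) \<and>
     (\<forall>z. f z = g z * (\<Prod>a\<in>A. (z - a) ^ nat (zorder f a)))"
    using \<open>finite A\<close>
  proof (induction A)
    case empty
    then show ?case using f by auto
  next
    case (insert b A)
    then obtain g where g: "g holomorphic_on UNIV" "\<And>a. a \<in> A \<Longrightarrow> g a \<noteq> 0"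
      "\<And>z. f z = g z * (\<Prod>a\<in>A. (z - a) ^ nat (zorder f a))" by blast
    define P where "P z = (\<Prod>a\<in>A. (z - a) ^ nat (zorder f a))" for z
    have g\<beta>: "g \<beta> \<noteq> 0" using nz g(3)[of \<beta>] by auto
    have P: "P holomorphic_on UNIV" unfolding P_def by (intro holomorphic_intros)
    have Pb: "P b \<noteq> 0" using insert.hyps unfolding P_def by auto
    have eq: "f = (\<lambda>z. g z * P z)" using g(3) by (auto simp: P_def)
    have "zorder f b = zorder g b + zorder P b"
      unfolding eq
    proof (rule zorder_times_analytic)
      show "eventually (\<lambda>z. g z * P z \<noteq> 0) (at b)"
        using eventually_nonzero_entire[OF f nz, of b] unfolding eq .
    qed (use g(1) P in \<open>auto intro: holomorphic_on_imp_analytic_at\<close>)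
    also have "zorder P b = 0"
      by (rule zorder_eq_0I) (use P Pb in \<open>auto intro: holomorphic_on_imp_analytic_at\<close>)
    finally have zo: "zorder f b = zorder g b" by simp
    obtain h where h: "h holomorphic_on UNIV" "h b \<noteq> 0" "\<And>z. g z = h z * (z - b) ^ nat (zorder g b)"
      using factor_out_zero[OF g(1) g\<beta>] by blast
    have "h a \<noteq> 0" if "a \<in> A" for a using g(2)[OF that] h(3)[of a] by auto
    moreover have "f z = h z * (\<Prod>a\<in>insert b A. (z - a) ^ nat (zorder f a))" for z
      using insert.hyps by (subst g(3)) (simp add: h(3)[of z] zo)
    ultimately show ?case using h by blast
  qed
  then show ?thesis using that by blast
qed

text \<open>The map \<open>w \<mapsto> w / (2 * M - w)\<close> sends the half plane \<open>Re w < M\<close> into the unit disc.\<close>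

lemma Borel_Caratheodory:
  fixes f :: "complex \<Rightarrow> complex"
  assumes f: "f holomorphic_on ball 0 R" and "R > 0" and f0: "f 0 = 0"
    and M: "\<And>z. norm z < R \<Longrightarrow> Re (f z) < M" and z: "norm z < R"
  shows "norm (f z) \<le> 2 * M * norm z / (R - norm z)"
proof -
  have M0: "M > 0" using M[of 0] f0 \<open>R > 0\<close> by simp
  have nz: "2 * of_real M - f w \<noteq> 0" if "norm w < R" for w
    using M[OF that] M0 by (auto simp: complex_eq_iff)
  have lt: "norm (f w) < norm (2 * of_real M - f w)" if "norm w < R" for w
  proof -
    have "(2 * M - Re (f w))\<^sup>2 + (Im (f w))\<^sup>2 = (Re (f w))\<^sup>2 + (Im (f w))\<^sup>2 + 4 * M * (M - Re (f w))"
      by (simp add: power2_eq_square algebra_simps)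
    also have "\<dots> > (Re (f w))\<^sup>2 + (Im (f w))\<^sup>2" using M[OF that] M0 by simp
    finally show ?thesis by (simp add: cmod_def)
  qed
  define \<phi> where "\<phi> w = f (of_real R * w) / (2 * of_real M - f (of_real R * w))" for w
  have R: "norm (of_real R * w) < R" if "norm w < 1" for w :: complex
    using that \<open>R > 0\<close> by (simp add: norm_mult)
  define w where "w = z / of_real R"
  have w: "norm w < 1" "of_real R * w = z" using z \<open>R > 0\<close> by (auto simp: w_def norm_divide)
  have "norm (\<phi> w) \<le> norm w"
  proof (rule Schwarz_Lemma(1))
    have "(\<lambda>w. of_real R * w) holomorphic_on ball 0 1" by (intro holomorphic_intros)
    then have "(\<lambda>w. f (of_real R * w)) holomorphic_on ball 0 1"
      using holomorphic_on_compose_gen[OF _ f, of "\<lambda>w. of_real R * w" "ball 0 1"] R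
      by (simp only: o_def image_subset_iff mem_ball dist_0_norm Ball_def) blast
    then show "\<phi> holomorphic_on ball 0 1"
      unfolding \<phi>_def by (intro holomorphic_intros) (use nz R in auto)
    show "norm (\<phi> z) < 1" if "norm z < 1" for z
      using lt[OF R[OF that]] nz[OF R[OF that]] by (simp add: \<phi>_def norm_divide)
  qed (use w f0 in \<open>auto simp: \<phi>_def\<close>)
  then have "norm (f z) / norm (2 * of_real M - f z) \<le> norm w"
    unfolding \<phi>_def w(2) norm_divide .
  then have "norm (f z) \<le> norm w * norm (2 * of_real M - f z)"
    using nz[OF z] by (subst (asm) pos_divide_le_eq) auto
  also have "norm (2 * of_real M - f z) \<le> 2 * M + norm (f z)"
    using norm_triangle_ineq4[of "2 * of_real M" "f z"] M0 by simp
  finally have "norm (f z) \<le> norm w * (2 * M + norm (f z))" by (simp add: mult_left_mono)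
  then have "norm (f z) * (1 - norm w) \<le> 2 * M * norm w" by (simp add: algebra_simps)
  moreover have "1 - norm w = (R - norm z) / R" "norm w = norm z / R"
    using \<open>R > 0\<close> by (auto simp: w_def norm_divide field_simps)
  ultimately have "norm (f z) * ((R - norm z) / R) * R \<le> 2 * M * (norm z / R) * R"
    using \<open>R > 0\<close> by (intro mult_right_mono) auto
  then have "norm (f z) * (R - norm z) \<le> 2 * M * norm z"
    using \<open>R > 0\<close> by simp
  then show ?thesis using z by (simp add: field_simps)
qed

text \<open>Borel-Caratheodory bounds \<open>f\<close> for \<open>norm z < R / 2\<close>, Cauchy's
  inequality with radius \<open>R / 4\<close> bounds the derivative by \<open>8 * M / R\<close>, and
  Schwarz's lemma applied to the derivative, which vanishes at \<open>0\<close>, supplies the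
  further factor \<open>norm z / R\<close>.\<close>

lemma norm_deriv_le_of_Re_bound:
  fixes f :: "complex \<Rightarrow> complex"
  assumes f: "f holomorphic_on ball 0 R" and "R > 0" and f0: "f 0 = 0" "deriv f 0 = 0"
    and M: "\<And>z. norm z < R \<Longrightarrow> Re (f z) < M" and z: "norm z < R / 4"
  shows "norm (deriv f z) \<le> 64 * M * norm z / R\<^sup>2"
proof -
  have M0: "M > 0" using M[of 0] f0 \<open>R > 0\<close> by simp
  have df: "deriv f holomorphic_on ball 0 R" by (rule holomorphic_deriv[OF f]) simp
  have B: "norm (deriv f w) \<le> 8 * M / R" if w: "norm w < R / 4" for w
  proof -
    have sub: "norm v < R / 2" if "v \<in> cball w (R / 4)" for v
      using that w norm_triangle_ineq4[of w "w - v"] by (simp add: dist_norm)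
    have "norm ((deriv ^^ 1) f w) \<le> fact 1 * (2 * M) / (R / 4) ^ 1"
    proof (rule Cauchy_inequality)
      show "f holomorphic_on ball w (R / 4)"
        by (intro holomorphic_on_subset[OF f] subsetI) (use sub \<open>R > 0\<close> ball_subset_cball in fastforce)
      show "continuous_on (cball w (R / 4)) f"
        by (intro holomorphic_on_imp_continuous_on holomorphic_on_subset[OF f] subsetI) (use sub \<open>R > 0\<close> in fastforce)
      fix v assume v: "norm (w - v) = R / 4"
      have v2: "norm v < R / 2" using v by (intro sub) (simp add: dist_norm)
      have "norm (f v) \<le> 2 * M * norm v / (R - norm v)"
        using v2 \<open>R > 0\<close> by (intro Borel_Caratheodory[OF f _ f0(1) M]) auto
      also have "\<dots> \<le> 2 * M * (R / 2) / (R / 2)"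
        using v2 \<open>R > 0\<close> M0 by (intro frac_le mult_left_mono) auto
      finally show "norm (f v) \<le> 2 * M" using \<open>R > 0\<close> by simp
    qed (use \<open>R > 0\<close> in auto)
    then show ?thesis by (simp add: field_simps)
  qed
  \<comment> \<open>Twice the Cauchy bound, because Schwarz's lemma asks for values strictly inside
    the unit disc.\<close>
  define c where "c = 16 * M / R"
  have c: "c > 0" using M0 \<open>R > 0\<close> by (simp add: c_def)
  define \<phi> where "\<phi> w = deriv f (of_real (R / 4) * w) / of_real c" for w
  have R4: "norm (of_real (R / 4) * w) < R / 4" if "norm w < 1" for w :: complex
    using that \<open>R > 0\<close> by (simp add: norm_mult)
  define w where "w = z / of_real (R / 4)"
  have w: "norm w < 1" "of_real (R / 4) * w = z" "norm w = 4 * norm z / R"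
    using z \<open>R > 0\<close> by (auto simp: w_def norm_divide)
  have "norm (\<phi> w) \<le> norm w"
  proof (rule Schwarz_Lemma(1))
    have "(\<lambda>w. of_real (R / 4) * w) holomorphic_on ball 0 1" by (intro holomorphic_intros)
    moreover have "norm (of_real (R / 4) * w) < R" if "norm w < 1" for w :: complex
      using R4[OF that] \<open>R > 0\<close> by linarith
    ultimately have "(\<lambda>w. deriv f (of_real (R / 4) * w)) holomorphic_on ball 0 1"
      using holomorphic_on_compose_gen[OF _ df, of "\<lambda>w. of_real (R / 4) * w" "ball 0 1"] 
      by (simp only: o_def image_subset_iff mem_ball dist_0_norm Ball_def) blast
    then show "\<phi> holomorphic_on ball 0 1"
      unfolding \<phi>_def by (intro holomorphic_intros) (use c in auto)
    show "norm (\<phi> z) < 1" if "norm z < 1" for z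
    proof -
      have "norm (deriv f (of_real (R / 4) * z)) \<le> 8 * M / R" by (rule B[OF R4[OF that]])
      also have "\<dots> < c" using M0 \<open>R > 0\<close> by (simp add: c_def divide_strict_right_mono)
      finally show ?thesis using c by (simp add: \<phi>_def norm_divide)
    qed
  qed (use w f0 in \<open>auto simp: \<phi>_def\<close>)
  then have "norm (deriv f z) \<le> c * norm w"
    unfolding \<phi>_def w(2) norm_divide using c by (simp add: field_simps)
  also have "\<dots> = 64 * M * norm z / R\<^sup>2" by (simp add: c_def w(3) power2_eq_square)
  finally show ?thesis .
qed

lemma zorder_even:
  fixes f :: "complex \<Rightarrow> complex"
  assumes "f holomorphic_on UNIV" "\<And>z. f (- z) = f z"
  shows "zorder f (- a) = zorder f a"
proof -
  have "f meromorphic_on {- a}"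
    using assms(1) by (intro analytic_on_imp_meromorphic_on) (auto intro: holomorphic_on_imp_analytic_at)
  from zorder_uminus[OF this] show ?thesis using assms(2) by simp
qed

text \<open>Dividing \<open>f\<close> by the zeros of modulus at most \<open>R\<close> leaves a function \<open>g\<close> without zeros there, which the
  maximum principle bounds from the circle of radius \<open>2 * R\<close>. Evenness makes the derivative of
  \<open>ln g\<close> vanish at \<open>0\<close>, which gains the factor needed for growth of order below \<open>2\<close>.\<close>

lemma even_entire_log_deriv_estimate:
  fixes f :: "complex \<Rightarrow> complex"
  assumes f: "f holomorphic_on UNIV" and even: "\<And>z. f (- z) = f z" and f0: "f 0 \<noteq> 0"
    and B: "\<And>z. norm z = 2 * R \<Longrightarrow> norm (f z) \<le> exp B"
    and R: "R > 0" and z: "norm z < R / 4" "f z \<noteq> 0"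
  defines "A \<equiv> {a. f a = 0 \<and> norm a \<le> R}"
  shows "norm (deriv f z / f z - (\<Sum>a\<in>A. of_int (zorder f a) / (z - a)))
     \<le> 64 * (\<bar>B - ln (norm (f 0))\<bar> + 1) * norm z / R\<^sup>2"
proof -
  define m where "m a = nat (zorder f a)" for a
  have m: "of_int (zorder f a) = (of_nat (m a) :: complex)" for a
  proof -
    have "zorder f a \<ge> 0"
      by (rule zorder_ge_0)
         (use f eventually_nonzero_entire[OF f f0, of a] in
           \<open>auto intro: holomorphic_on_imp_analytic_at eventually_frequently\<close>)
    then have "int (m a) = zorder f a" by (simp add: m_def)
    then show ?thesis by (metis of_int_of_nat_eq)
  qed
  have m_even: "m (- a) = m a" for a unfolding m_def by (subst zorder_even[OF f even]) (rule refl)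
  have finA: "finite A"
  proof -
    have eq: "A = {a \<in> cball 0 R. f a = 0}" by (auto simp: A_def)
    show ?thesis
    proof (cases "f constant_on UNIV")
      case True
      then have "A = {}" using f0 by (auto simp: constant_on_def A_def)
      then show ?thesis by simp
    next
      case False
      then show ?thesis
        unfolding eq by (intro holomorphic_compact_finite_zeros[OF f]) auto
    qed
  qed
  obtain g where g: "g holomorphic_on UNIV" "\<And>a. a \<in> A \<Longrightarrow> g a \<noteq> 0"
    "\<And>z. f z = g z * (\<Prod>a\<in>A. (z - a) ^ m a)"
    using factor_out_zeros[OF f f0 finA] unfolding m_def by blast
  define P where "P z = (\<Prod>a\<in>A. (z - a) ^ m a)" for z
  have gP: "f z = g z * P z" for z using g(3) by (simp add: P_def)
  have g_nz: "g w \<noteq> 0" if "norm w \<le> R" for w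
    using that g(2)[of w] gP[of w] by (auto simp: A_def)
  have A0: "a \<noteq> 0" if "a \<in> A" for a using that f0 by (auto simp: A_def)
  have P0: "P 0 \<noteq> 0" using A0 finA by (auto simp: P_def)
  define N where "N = (\<Sum>a\<in>A. m a)"
  \<comment> \<open>On the outer circle every factor \<open>w - a\<close> has modulus at least
    \<open>R\<close>, at the centre at most \<open>R\<close>. The two powers \<open>R ^ N\<close>
    cancel in the bound for \<open>g w / g 0\<close>, so the number of zeros drops out.\<close>
  have P_lower: "norm (P w) \<ge> R ^ N" if "norm w = 2 * R" for w
  proof -
    have "R ^ N = (\<Prod>a\<in>A. R ^ m a)" by (simp add: N_def power_sum)
    also have "\<dots> \<le> (\<Prod>a\<in>A. norm ((w - a) ^ m a))"
    proof (intro prod_mono conjI)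
      fix a assume "a \<in> A"
      then have "R \<le> norm (w - a)" using norm_triangle_ineq2[of w a] that by (simp add: A_def)
      then show "R ^ m a \<le> norm ((w - a) ^ m a)" using R by (simp add: norm_power power_mono)
    qed (use R in auto)
    finally show ?thesis by (simp add: P_def prod_norm)
  qed
  have P_upper: "norm (P 0) \<le> R ^ N"
  proof -
    have "norm (P 0) = (\<Prod>a\<in>A. norm ((0 - a) ^ m a))" by (simp add: P_def prod_norm)
    also have "\<dots> \<le> (\<Prod>a\<in>A. R ^ m a)"
      by (intro prod_mono) (auto simp: norm_power A_def intro!: power_mono)
    also have "\<dots> = R ^ N" by (simp add: N_def power_sum)
    finally show ?thesis .
  qed
  have g0: "norm (g 0) \<ge> norm (f 0) / R ^ N"
  proof -
    have "norm (f 0) = norm (g 0) * norm (P 0)" by (simp add: gP norm_mult)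
    also have "\<dots> \<le> norm (g 0) * R ^ N" by (intro mult_left_mono P_upper) auto
    finally show ?thesis using R by (simp add: field_simps)
  qed
  have g_bound: "norm (g w) \<le> exp B / R ^ N" if "norm w \<le> 2 * R" for w
  proof (rule maximum_modulus_frontier[where S = "cball 0 (2 * R)" and f = g])
    show "norm (g v) \<le> exp B / R ^ N" if "v \<in> frontier (cball 0 (2 * R))" for v
    proof -
      have v: "norm v = 2 * R" using that R by (simp add: sphere_def)
      have "norm (g v) * R ^ N \<le> norm (g v) * norm (P v)" by (intro mult_left_mono P_lower v) auto
      also have "\<dots> = norm (f v)" by (simp add: gP norm_mult)
      also have "\<dots> \<le> exp B" by (rule B[OF v])
      finally show ?thesis using R by (simp add: field_simps)
    qed
  qed (use that g(1) in \<open>auto intro: holomorphic_on_subset holomorphic_on_imp_continuous_on\<close>)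
  obtain L0 where L0: "L0 holomorphic_on ball 0 R" "\<And>w. w \<in> ball 0 R \<Longrightarrow> exp (L0 w) = g w"
    by (rule holomorphic_logarithm_exists[of "ball 0 R" g 0])
       (use R g_nz in \<open>auto intro: holomorphic_on_subset[OF g(1)]\<close>)
  define L where "L w = L0 w - L0 0" for w
  have L: "L holomorphic_on ball 0 R" unfolding L_def by (intro holomorphic_intros L0)
  have expL: "exp (L w) = g w / g 0" if "norm w < R" for w
    using L0(2)[of w] L0(2)[of 0] that R by (simp add: L_def exp_diff)
  \<comment> \<open>The added \<open>1\<close> makes the bound on \<open>Re (L w)\<close> strict, as
    Borel-Caratheodory demands.\<close>
  define M where "M = \<bar>B - ln (norm (f 0))\<bar> + 1"
  have ReL: "Re (L w) < M" if w: "norm w < R" for w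
  proof -
    have "exp (Re (L w)) = norm (g w) / norm (g 0)"
      using expL[OF w] by (metis norm_divide norm_exp_eq_Re)
    also have "\<dots> \<le> (exp B / R ^ N) / (norm (f 0) / R ^ N)"
      using w R g_bound[of w] g0 f0 by (intro frac_le) auto
    also have "\<dots> = exp (B - ln (norm (f 0)))" using R f0 by (simp add: exp_diff)
    finally have "Re (L w) \<le> B - ln (norm (f 0))" by simp
    then show ?thesis unfolding M_def by linarith
  qed
  have deriv_L: "deriv L w = deriv f w / f w - (\<Sum>a\<in>A. of_int (zorder f a) / (w - a))"
    if w: "norm w < R" and fw: "f w \<noteq> 0" for w
  proof -
    have wA: "w - a \<noteq> 0" if "a \<in> A" for a using fw that by (auto simp: A_def)
    have Pw: "P w \<noteq> 0" using fw gP[of w] by auto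
    have "(L has_field_derivative deriv L w) (at w)"
      by (rule holomorphic_derivI[OF L]) (use w in auto)
    then have 1: "((\<lambda>w. exp (L w)) has_field_derivative exp (L w) * deriv L w) (at w)"
      by (auto intro!: derivative_eq_intros)
    have "(P has_field_derivative P w * (\<Sum>a\<in>A. (of_nat (m a) * (w - a) ^ (m a - 1)) / (w - a) ^ m a)) (at w)"
      unfolding P_def by (rule has_field_derivative_prod') (use wA in \<open>auto intro!: derivative_eq_intros\<close>)
    also have "(\<Sum>a\<in>A. (of_nat (m a) * (w - a) ^ (m a - 1)) / (w - a) ^ m a) =
        (\<Sum>a\<in>A. of_int (zorder f a) / (w - a))"
    proof (intro sum.cong refl)
      fix a assume "a \<in> A"
      then show "(of_nat (m a) * (w - a) ^ (m a - 1)) / (w - a) ^ m a = of_int (zorder f a) / (w - a)"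
        unfolding m using wA by (cases "m a") auto
    qed
    finally have 2: "(P has_field_derivative P w * (\<Sum>a\<in>A. of_int (zorder f a) / (w - a))) (at w)" .
    have 3: "((\<lambda>w. g 0 * exp (L w) * P w) has_field_derivative
        g 0 * (exp (L w) * deriv L w) * P w + P w * (\<Sum>a\<in>A. of_int (zorder f a) / (w - a)) * (g 0 * exp (L w))) (at w)"
      by (intro DERIV_mult DERIV_cmult 1 2)
    have "(f has_field_derivative
        g 0 * (exp (L w) * deriv L w) * P w + P w * (\<Sum>a\<in>A. of_int (zorder f a) / (w - a)) * (g 0 * exp (L w))) (at w)"
    proof (rule has_field_derivative_transform_within_open[OF 3, of "ball 0 R"])
      show "g 0 * exp (L v) * P v = f v" if "v \<in> ball 0 R" for v
        using that expL[of v] g_nz[of 0] R by (simp add: gP)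
    qed (use w in auto)
    then have "deriv f w = g w * P w * (deriv L w + (\<Sum>a\<in>A. of_int (zorder f a) / (w - a)))"
      using expL[OF w] g_nz[of 0] R by (auto dest!: DERIV_imp_deriv simp: algebra_simps)
    then show ?thesis using fw by (simp add: gP[symmetric])
  qed
  have "deriv L 0 = 0"
  proof -
    have "deriv f 0 = 0"
    proof -
      have d: "(f has_field_derivative deriv f 0) (at 0)"
        by (rule holomorphic_derivI[OF f]) auto
      have d': "(f has_field_derivative deriv f 0) (at (- 0))" using d by simp
      have "((\<lambda>z. f (- z)) has_field_derivative deriv f 0 * (- 1)) (at 0)"
        by (rule DERIV_chain2[where f = f and g = uminus, OF d']) (auto intro!: derivative_eq_intros)
      then have "deriv f 0 = deriv f 0 * (- 1)"
        unfolding even using DERIV_unique[OF d] by blast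
      then show ?thesis by simp
    qed
    \<comment> \<open>\<open>A\<close> is symmetric and the orders at \<open>a\<close> and
      \<open>- a\<close> agree, so the terms cancel in pairs.\<close>
    moreover have "(\<Sum>a\<in>A. of_int (zorder f a) / (0 - a)) = 0"
    proof -
      have "(\<Sum>a\<in>A. of_int (zorder f a) / (0 - a)) = (\<Sum>a\<in>A. of_int (zorder f a) / (0 - (- a)))"
        by (rule sum.reindex_bij_witness[of _ uminus uminus])
           (auto simp: A_def even zorder_even[OF f even])
      also have "\<dots> = - (\<Sum>a\<in>A. of_int (zorder f a) / (0 - a))"
        by (simp add: sum_negf[symmetric])
      finally show ?thesis by simp
    qed
    ultimately show ?thesis using deriv_L[of 0] R f0 by simp
  qed
  then have "norm (deriv L z) \<le> 64 * M * norm z / R\<^sup>2"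
    by (intro norm_deriv_le_of_Re_bound[OF L R]) (use ReL z in \<open>auto simp: L_def\<close>)
  then show ?thesis using deriv_L[of z] z R by (simp add: M_def)
qed

text \<open>With growth exponent \<open>3 / 2\<close> the error is of size
  \<open>R powr (3 / 2) / R\<^sup>2\<close>. This is the partial fraction expansion behind
  Hadamard's factorisation, summed over growing discs and free of an additive constant owing to
  evenness.\<close>

lemma even_entire_log_deriv:
  fixes f :: "complex \<Rightarrow> complex"
  assumes f: "f holomorphic_on UNIV" and even: "\<And>z. f (- z) = f z" and f0: "f 0 \<noteq> 0"
    and growth: "\<And>z. norm (f z) \<le> exp (C * (1 + norm z) powr (3 / 2))" and "C > 0"
    and z: "f z \<noteq> 0"
  shows "((\<lambda>R. \<Sum>a | f a = 0 \<and> norm a \<le> R. of_int (zorder f a) / (z - a)) \<longlongrightarrow> deriv f z / f z) at_top"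
proof -
  define K where "K = C * 3 powr (3 / 2) + \<bar>ln (norm (f 0))\<bar> + 1"
  have K: "K \<ge> 1" using \<open>C > 0\<close> by (simp add: K_def)
  have "((\<lambda>R. deriv f z / f z - (\<Sum>a | f a = 0 \<and> norm a \<le> R. of_int (zorder f a) / (z - a))) \<longlongrightarrow> 0) at_top"
  proof (rule Lim_null_comparison)
    show "eventually (\<lambda>R. norm (deriv f z / f z - (\<Sum>a | f a = 0 \<and> norm a \<le> R. of_int (zorder f a) / (z - a)))
        \<le> 64 * K * norm z * R powr (- (1 / 2))) at_top"
      using eventually_gt_at_top[of "max 1 (4 * norm z)"]
    proof eventually_elim
      case (elim R)
      then have R: "R > 1" "norm z < R / 4" by auto
      \<comment> \<open>On the circle of radius \<open>2 * R\<close> one has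
        \<open>1 + norm w \<le> 3 * R\<close>, as \<open>R > 1\<close>.\<close>
      define B where "B = C * (3 * R) powr (3 / 2)"
      have "norm (deriv f z / f z - (\<Sum>a | f a = 0 \<and> norm a \<le> R. of_int (zorder f a) / (z - a)))
          \<le> 64 * (\<bar>B - ln (norm (f 0))\<bar> + 1) * norm z / R\<^sup>2"
      proof (rule even_entire_log_deriv_estimate[OF f even f0 _ _ R(2) z])
        fix w :: complex assume "norm w = 2 * R"
        then have "norm (f w) \<le> exp (C * (1 + 2 * R) powr (3 / 2))" using growth[of w] by simp
        also have "\<dots> \<le> exp B"
          unfolding B_def using R \<open>C > 0\<close> by (auto intro!: mult_left_mono powr_mono2)
        finally show "norm (f w) \<le> exp B" .
      qed (use R in auto)
      also have "\<dots> \<le> 64 * (K * R powr (3 / 2)) * norm z / R\<^sup>2"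
      proof -
        have R1: "1 \<le> R powr (3 / 2)" using R by (intro ge_one_powr_ge_zero) auto
        have "B \<ge> 0" using \<open>C > 0\<close> by (simp add: B_def)
        then have "\<bar>B - ln (norm (f 0))\<bar> + 1 \<le> B + (\<bar>ln (norm (f 0))\<bar> + 1) * 1"
          using abs_triangle_ineq4[of B "ln (norm (f 0))"] by simp
        also have "\<dots> \<le> B + (\<bar>ln (norm (f 0))\<bar> + 1) * R powr (3 / 2)"
          using R1 by (intro add_left_mono mult_left_mono) auto
        also have "\<dots> = K * R powr (3 / 2)"
          using R by (simp add: B_def K_def powr_mult algebra_simps)
        finally show ?thesis using R by (intro divide_right_mono mult_right_mono mult_left_mono) auto
      qed
      also have "\<dots> = 64 * K * norm z * R powr (- (1 / 2))"
      proof -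
        have "R powr (3 / 2) = R powr (- (1 / 2)) * R\<^sup>2"
          using R powr_add[of R "- (1 / 2)" 2] by simp
        then show ?thesis using R by simp
      qed
      finally show ?case .
    qed
    show "((\<lambda>R. 64 * K * norm z * R powr (- (1 / 2))) \<longlongrightarrow> 0) at_top"
      by (intro tendsto_mult_right_zero tendsto_neg_powr filterlim_ident) auto
  qed
  from tendsto_diff[OF tendsto_const[of "deriv f z / f z"] this] show ?thesis by simp
qed

section \<open>Ordinates of the zeros\<close>

text \<open>Only zeros on the critical line are recorded. Under the Riemann hypothesis these are all
  of them, and sums over zeros become sums over a set of reals symmetric about
  \<open>0\<close>.\<close>

definition ordinates :: "real set" where
  "ordinates = {g. xi (1 / 2 + \<i> * of_real g) = 0}"

definition zero_mult :: "real \<Rightarrow> real" where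
  "zero_mult g = of_int (zorder xi (1 / 2 + \<i> * of_real g))"

lemma xi_shift_even: "xi (1 / 2 + - z) = xi (1 / 2 + z)"
  using xi_reflect[of "1 / 2 + z"] by (simp add: algebra_simps)

lemma holomorphic_xi_shift: "(\<lambda>z. xi (1 / 2 + z)) holomorphic_on UNIV"
proof -
  have "(\<lambda>z. 1 / 2 + z) holomorphic_on UNIV" by (intro holomorphic_intros)
  from holomorphic_on_compose_gen[OF this holomorphic_xi] show ?thesis by (simp add: o_def)
qed

text \<open>Isolation of zeros is available for a non-constant function; a constant one would keep
  its non-zero value at \<open>1 / 2\<close> and have no zeros at all.\<close>

lemma finite_ordinates: "finite {g \<in> ordinates. \<bar>g\<bar> \<le> T}"
proof -
  have "\<not> (\<lambda>z. xi (1 / 2 + z)) constant_on UNIV \<or> nontrivial_zeros = {}"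
  proof -
    have "xi s \<noteq> 0" if const: "(\<lambda>z. xi (1 / 2 + z)) constant_on UNIV" for s
    proof -
      obtain c where c: "\<And>z. xi (1 / 2 + z) = c" using const unfolding constant_on_def by blast
      from c[of "s - 1 / 2"] c[of 0] xi_one_half_nonzero show ?thesis by simp
    qed
    then show ?thesis by (auto simp: nontrivial_zeros_eq)
  qed
  then have "finite {z \<in> cball 0 T. xi (1 / 2 + z) = 0}"
  proof
    assume "\<not> (\<lambda>z. xi (1 / 2 + z)) constant_on UNIV"
    then show ?thesis by (intro holomorphic_compact_finite_zeros[OF holomorphic_xi_shift]) auto
  qed (auto simp: nontrivial_zeros_eq)
  then have "finite ((\<lambda>g. \<i> * complex_of_real g) ` {g \<in> ordinates. \<bar>g\<bar> \<le> T})"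
    by (rule rev_finite_subset) (auto simp: ordinates_def norm_mult)
  then show ?thesis by (rule finite_imageD) (auto simp: inj_on_def)
qed

lemma zero_mult_nonneg: "zero_mult g \<ge> 0"
proof -
  have "zorder xi s \<ge> 0" for s
    by (rule zorder_ge_0)
       (use holomorphic_xi eventually_xi_nonzero in
         \<open>auto intro: holomorphic_on_imp_analytic_at eventually_frequently\<close>)
  then show ?thesis by (simp add: zero_mult_def)
qed

lemma zero_mult_minus: "zero_mult (- g) = zero_mult g"
proof -
  have shift: "zorder xi (1 / 2 + z) = zorder (\<lambda>z. xi (1 / 2 + z)) z" for z
    by (subst (1 2) zorder_shift) (simp add: add_ac)
  have "zorder (\<lambda>z. xi (1 / 2 + z)) (- (\<i> * of_real g)) = zorder (\<lambda>z. xi (1 / 2 + z)) (\<i> * of_real g)"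
    by (rule zorder_even[OF holomorphic_xi_shift xi_shift_even])
  then show ?thesis using shift[of "\<i> * of_real g"] shift[of "- (\<i> * of_real g)"]
    by (simp add: zero_mult_def)
qed

lemma ordinates_minus: "- g \<in> ordinates \<longleftrightarrow> g \<in> ordinates"
  using xi_shift_even[of "\<i> * of_real g"] by (simp add: ordinates_def)

lemma RH_zero:
  assumes riemann_hypothesis "xi (1 / 2 + z) = 0"
  shows "z = \<i> * of_real (Im z)" "Im z \<in> ordinates"
proof -
  have "1 / 2 + z \<in> nontrivial_zeros" using assms(2) by (simp add: nontrivial_zeros_eq)
  then have "Re (1 / 2 + z) = 1 / 2" using assms(1) by (auto simp: riemann_hypothesis_def)
  then show z: "z = \<i> * of_real (Im z)" by (simp add: complex_eq_iff)
  show "Im z \<in> ordinates" using assms(2) z by (simp add: ordinates_def)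
qed

lemma zero_sum_upto_eq:
  assumes riemann_hypothesis
  shows "zero_sum_upto f T = (\<Sum>g | g \<in> ordinates \<and> \<bar>g\<bar> \<le> T. of_real (zero_mult g) * f (1 / 2 + \<i> * of_real g))"
  unfolding zero_sum_upto_def
proof (rule sum.reindex_bij_witness[of _ "\<lambda>g. 1 / 2 + \<i> * of_real g" Im])
  fix \<rho> assume r: "\<rho> \<in> {\<rho> \<in> nontrivial_zeros. \<bar>Im \<rho>\<bar> \<le> T}"
  then have "xi (1 / 2 + (\<rho> - 1 / 2)) = 0" by (simp add: nontrivial_zeros_eq)
  from RH_zero[OF assms this] have *: "\<rho> = 1 / 2 + \<i> * of_real (Im \<rho>)" "Im \<rho> \<in> ordinates"
    by (auto simp: algebra_simps)
  then show "1 / 2 + \<i> * complex_of_real (Im \<rho>) = \<rho>" by simp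
  show "Im \<rho> \<in> {g \<in> ordinates. \<bar>g\<bar> \<le> T}" using * r by simp
  have "complex_of_real (zero_mult (Im \<rho>)) = of_int (zorder xi \<rho>)"
    by (subst *(1)) (simp add: zero_mult_def)
  then show "of_real (zero_mult (Im \<rho>)) * f (1 / 2 + \<i> * of_real (Im \<rho>)) = of_int (zorder zeta \<rho>) * f \<rho>"
    using r *(1) by (subst zorder_zeta_eq) auto
qed (auto simp: nontrivial_zeros_eq ordinates_def)

text \<open>Real parts in the expansion of the logarithmic derivative. The Riemann hypothesis keeps
  \<open>xi\<close> from vanishing at the point of evaluation, puts the poles on the imaginary axis
  so that each term is a Poisson kernel, and identifies the cut-off by modulus with the cut-off by
  height.\<close>

lemma RH_poisson_sum:
  assumes RH: riemann_hypothesis and x: "x > 0"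
  shows "((\<lambda>T. \<Sum>g | g \<in> ordinates \<and> \<bar>g\<bar> \<le> T. zero_mult g * (x / (x\<^sup>2 + (t - g)\<^sup>2))) \<longlongrightarrow>
     Re (deriv xi (1 / 2 + Complex x t) / xi (1 / 2 + Complex x t))) at_top"
proof -
  let ?f = "\<lambda>z. xi (1 / 2 + z)"
  define z where "z = Complex x t"
  obtain C where C: "C > 0" "\<And>z. norm (xi (1 / 2 + z)) \<le> exp (C * (1 + norm z) powr (3 / 2))"
    using xi_growth by blast
  have "?f z \<noteq> 0" using RH_zero(1)[OF RH, of z] x by (auto simp: z_def complex_eq_iff)
  from even_entire_log_deriv[OF holomorphic_xi_shift xi_shift_even _ C(2,1) this]
  have lim: "((\<lambda>T. \<Sum>a | ?f a = 0 \<and> norm a \<le> T. of_int (zorder ?f a) / (z - a)) \<longlongrightarrow> deriv ?f z / ?f z) at_top"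
    using xi_one_half_nonzero by simp
  have "(\<Sum>a | ?f a = 0 \<and> norm a \<le> T. of_int (zorder ?f a) / (z - a)) =
      (\<Sum>g | g \<in> ordinates \<and> \<bar>g\<bar> \<le> T. of_real (zero_mult g) / (z - \<i> * of_real g))" for T
  proof (rule sum.reindex_bij_witness[of _ "\<lambda>g. \<i> * of_real g" Im])
    fix a assume a: "a \<in> {a. ?f a = 0 \<and> norm a \<le> T}"
    then have *: "\<i> * of_real (Im a) = a" "Im a \<in> ordinates" using RH_zero[OF RH, of a] by auto
    then show "\<i> * of_real (Im a) = a" by simp
    have "\<bar>Im a\<bar> = norm a" using *(1) by (metis norm_mult norm_ii norm_of_real mult_1)
    then show "Im a \<in> {g \<in> ordinates. \<bar>g\<bar> \<le> T}" using a * by simp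
    have "zorder ?f a = zorder xi (1 / 2 + a)"
      by (subst (1 2) zorder_shift) (simp add: add_ac)
    then have "complex_of_real (zero_mult (Im a)) = of_int (zorder ?f a)" by (simp add: zero_mult_def *(1))
    then show "of_real (zero_mult (Im a)) / (z - \<i> * of_real (Im a)) = of_int (zorder ?f a) / (z - a)"
      using *(1) by simp
  qed (auto simp: ordinates_def norm_mult)
  from tendsto_Re[OF lim[unfolded this]]
  have "((\<lambda>T. \<Sum>g | g \<in> ordinates \<and> \<bar>g\<bar> \<le> T. Re (of_real (zero_mult g) / (z - \<i> * of_real g))) \<longlongrightarrow>
      Re (deriv ?f z / ?f z)) at_top" by (simp only: Re_sum)
  moreover have "Re (of_real (zero_mult g) / (z - \<i> * of_real g)) = zero_mult g * (x / (x\<^sup>2 + (t - g)\<^sup>2))" for g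
    by (simp add: z_def Re_divide)
  moreover have "deriv ?f z = deriv xi (1 / 2 + z)"
  proof -
    have "(xi has_field_derivative deriv xi (1 / 2 + z)) (at (1 / 2 + z))"
      by (rule holomorphic_derivI[OF holomorphic_xi]) auto
    moreover have "((\<lambda>z. 1 / 2 + z) has_field_derivative 1) (at z)"
      by (auto intro!: derivative_eq_intros)
    ultimately have "(?f has_field_derivative deriv xi (1 / 2 + z) * 1) (at z)"
      by (rule DERIV_chain2)
    then have "(?f has_field_derivative deriv xi (1 / 2 + z)) (at z)" by simp
    then show ?thesis by (rule DERIV_imp_deriv)
  qed
  ultimately show ?thesis by (simp add: z_def)
qed

section \<open>The logarithmic derivative of xi to the right of the critical line\<close>

text \<open>Mean value inequality for \<open>Ln z - z / w\<close> on the segment from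
  \<open>w\<close> to \<open>w + 1\<close>, along which \<open>Re w > 0\<close> gives
  \<open>norm z \<ge> norm w\<close>.\<close>

lemma Ln_step:
  fixes w :: complex
  assumes w: "Re w > 0"
  shows "norm (Ln (w + 1) - Ln w - 1 / w) \<le> 1 / (norm w)\<^sup>2"
proof -
  let ?S = "closed_segment w (w + 1)"
  have w0: "w \<noteq> 0" using w by auto
  define \<Phi> where "\<Phi> z = Ln z - z / w" for z
  have "norm (\<Phi> (w + 1) - \<Phi> w) \<le> 1 / (norm w)\<^sup>2 * norm ((w + 1) - w)"
  proof (rule field_differentiable_bound[where S = ?S])
    fix z assume "z \<in> ?S"
    then obtain r where r: "0 \<le> r" "r \<le> 1" "z = w + of_real r"
      by (auto simp: closed_segment_def scaleR_conv_of_real algebra_simps)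
    have z: "Re z > 0" using w r by simp
    then have "z \<notin> \<real>\<^sub>\<le>\<^sub>0" "z \<noteq> 0" by (auto simp: complex_nonpos_Reals_iff)
    then show "(\<Phi> has_field_derivative (1 / z - 1 / w)) (at z within ?S)"
      unfolding \<Phi>_def
      by (intro DERIV_diff has_field_derivative_Ln[THEN has_field_derivative_at_within, THEN DERIV_cong] DERIV_cdivide DERIV_ident)
         (auto simp: inverse_eq_divide)
    have "(norm w)\<^sup>2 \<le> (norm z)\<^sup>2"
      using r w by (simp add: cmod_power2 power_mono)
    then have wz: "norm w \<le> norm z" by (rule power2_le_imp_le) simp
    have "1 / z - 1 / w = (w - z) / (z * w)" using w0 \<open>z \<noteq> 0\<close> by (simp add: field_simps)
    then have "norm (1 / z - 1 / w) = \<bar>r\<bar> / (norm z * norm w)" by (simp add: norm_divide norm_mult r)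
    also have "\<dots> \<le> 1 / (norm w * norm w)"
      using r w0 wz by (intro frac_le mult_right_mono mult_pos_pos) auto
    finally show "norm (1 / z - 1 / w) \<le> 1 / (norm w)\<^sup>2" by (simp add: power2_eq_square)
  qed auto
  moreover have "\<Phi> (w + 1) - \<Phi> w = Ln (w + 1) - Ln w - 1 / w"
    using w0 by (simp add: \<Phi>_def field_simps)
  ultimately show ?thesis by simp
qed

text \<open>The deviation is a telescoping sum with errors at most
  \<open>1 / (norm (w + k))\<^sup>2\<close>. Splitting the exponent \<open>2\<close> as
  \<open>3 / 2 + 1 / 2\<close> between \<open>k + 1\<close> and \<open>\<bar>Im w\<bar>\<close>
  makes it summable in \<open>k\<close> and decaying in \<open>Im w\<close>, while the singularity
  at \<open>Im w = 0\<close> stays integrable.\<close>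

lemma Re_Digamma_estimate:
  fixes w :: complex
  assumes w: "Re w \<ge> 1" "Im w \<noteq> 0"
  shows "\<bar>Re (Digamma w) - ln (norm w)\<bar> \<le> (\<Sum>k. real (Suc k) powr (- (3 / 2))) * \<bar>Im w\<bar> powr (- (1 / 2))"
proof -
  define S where "S = (\<Sum>k. real (Suc k) powr (- (3 / 2)))"
  have summ: "summable (\<lambda>k. real (Suc k) powr (- (3 / 2)))" by (rule summable_Suc_powr) simp
  have step: "\<bar>ln (norm (w + of_nat (Suc k))) - ln (norm (w + of_nat k)) - Re (inverse (w + of_nat k))\<bar>
     \<le> real (Suc k) powr (- (3 / 2)) * \<bar>Im w\<bar> powr (- (1 / 2))" for k
  proof -
    define v where "v = w + of_nat k"
    have v: "Re v \<ge> real (Suc k)" "Im v = Im w" using w by (auto simp: v_def)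
    have v0: "v \<noteq> 0" "v + 1 \<noteq> 0" using v by (auto simp: complex_eq_iff)
    have "\<bar>Re (Ln (v + 1) - Ln v - 1 / v)\<bar> \<le> norm (Ln (v + 1) - Ln v - 1 / v)" by (rule abs_Re_le_cmod)
    also have "\<dots> \<le> 1 / (norm v)\<^sup>2" using v by (intro Ln_step) auto
    also have "\<dots> \<le> 1 / (real (Suc k) powr (3 / 2) * \<bar>Im w\<bar> powr (1 / 2))"
    proof (intro divide_left_mono mult_pos_pos)
      define M where "M = max (real (Suc k)) \<bar>Im w\<bar>"
      have "real (Suc k) powr (3 / 2) * \<bar>Im w\<bar> powr (1 / 2) \<le> M powr (3 / 2) * M powr (1 / 2)"
        by (intro mult_mono powr_mono2) (auto simp: M_def)
      also have "\<dots> = M\<^sup>2" unfolding powr_add[symmetric] by (simp add: M_def)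
      also have "\<dots> \<le> (real (Suc k))\<^sup>2 + \<bar>Im w\<bar>\<^sup>2"
      proof (cases "real (Suc k) \<le> \<bar>Im w\<bar>")
        case True
        then have "M = \<bar>Im w\<bar>" by (simp add: M_def)
        then show ?thesis by simp
      next
        case False
        then have "M = real (Suc k)" by (simp add: M_def)
        then show ?thesis by simp
      qed
      also have "(real (Suc k))\<^sup>2 + \<bar>Im w\<bar>\<^sup>2 \<le> (norm v)\<^sup>2"
        using v by (auto simp: cmod_power2 intro!: power_mono)
      finally show "real (Suc k) powr (3 / 2) * \<bar>Im w\<bar> powr (1 / 2) \<le> (norm v)\<^sup>2" .
    qed (use v0 w in auto)
    also have "\<dots> = real (Suc k) powr (- (3 / 2)) * \<bar>Im w\<bar> powr (- (1 / 2))"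
      by (simp only: powr_minus_divide) simp
    also have "Re (Ln (v + 1) - Ln v - 1 / v) = ln (norm (v + 1)) - ln (norm v) - Re (inverse v)"
      using v0 by (simp add: inverse_eq_divide)
    also have "v + 1 = w + of_nat (Suc k)" by (simp add: v_def)
    finally show ?thesis by (simp only: v_def)
  qed
  define D where "D m = ln (norm (w + of_nat m)) - ln (norm w) - (\<Sum>k<m. Re (inverse (w + of_nat k)))" for m
  have D: "\<bar>D m\<bar> \<le> S * \<bar>Im w\<bar> powr (- (1 / 2))" for m
  proof -
    have "D m = (\<Sum>k<m. ln (norm (w + of_nat (Suc k))) - ln (norm (w + of_nat k)) - Re (inverse (w + of_nat k)))"
      unfolding D_def by (induction m) auto
    also have "\<bar>\<dots>\<bar> \<le> (\<Sum>k<m. \<bar>ln (norm (w + of_nat (Suc k))) - ln (norm (w + of_nat k)) - Re (inverse (w + of_nat k))\<bar>)"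
      by (rule sum_abs)
    also have "\<dots> \<le> (\<Sum>k<m. real (Suc k) powr (- (3 / 2)) * \<bar>Im w\<bar> powr (- (1 / 2)))"
      by (intro sum_mono step)
    also have "\<dots> = (\<Sum>k<m. real (Suc k) powr (- (3 / 2))) * \<bar>Im w\<bar> powr (- (1 / 2))"
      by (simp add: sum_distrib_right)
    also have "\<dots> \<le> S * \<bar>Im w\<bar> powr (- (1 / 2))"
      unfolding S_def by (intro mult_right_mono sum_le_suminf summ) auto
    finally show ?thesis .
  qed
  have "w \<noteq> 0" using w by auto
  from tendsto_Re[OF Digamma_LIMSEQ[OF this]]
  have A: "(\<lambda>m. ln (real m) - (\<Sum>k<m. Re (inverse (w + of_nat k)))) \<longlonglongrightarrow> Re (Digamma w)"
    by simp
  have B: "(\<lambda>m. ln (norm (w + of_nat m)) - ln (real m)) \<longlonglongrightarrow> 0"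
  proof -
    have "(\<lambda>m. norm (w / of_nat m + 1)) \<longlonglongrightarrow> norm (0 + 1 :: complex)"
      by (intro tendsto_intros tendsto_divide_0[OF tendsto_const] tendsto_of_nat)
    then have "(\<lambda>m. ln (norm (w / of_nat m + 1))) \<longlonglongrightarrow> ln 1"
      by (intro tendsto_ln) auto
    moreover have "eventually (\<lambda>m. ln (norm (w / of_nat m + 1)) = ln (norm (w + of_nat m)) - ln (real m)) sequentially"
      using eventually_gt_at_top[of 0]
    proof eventually_elim
      case (elim m)
      have "w + of_nat m \<noteq> 0" using w by (auto simp: complex_eq_iff)
      moreover have "w / of_nat m + 1 = (w + of_nat m) / of_nat m" using elim by (simp add: field_simps)
      ultimately show ?case using elim by (simp add: norm_divide ln_div)
    qed
    ultimately show ?thesis by (simp add: tendsto_cong)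
  qed
  have "(\<lambda>m. (ln (real m) - (\<Sum>k<m. Re (inverse (w + of_nat k)))) + (ln (norm (w + of_nat m)) - ln (real m)) - ln (norm w))
     \<longlonglongrightarrow> Re (Digamma w) + 0 - ln (norm w)"
    by (intro tendsto_diff tendsto_add A B tendsto_const)
  then have "D \<longlonglongrightarrow> Re (Digamma w) - ln (norm w)"
    by (simp add: D_def[abs_def] algebra_simps)
  then have "(\<lambda>m. \<bar>D m\<bar>) \<longlonglongrightarrow> \<bar>Re (Digamma w) - ln (norm w)\<bar>" by (rule tendsto_rabs)
  then show ?thesis unfolding S_def[symmetric] by (rule LIMSEQ_le_const2) (use D in auto)
qed

text \<open>Lowering the exponent to \<open>2\<close> extracts the factor
  \<open>2 powr (2 - Re s)\<close>, and \<open>1 / N\<^sup>2\<close> is dominated by the telescoping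
  \<open>1 / (N - 1) - 1 / N\<close>.\<close>

lemma dirichlet_minus_1_le:
  assumes s: "Re s \<ge> 2"
  shows "norm (zeta_reg s / (s - 1) - 1) \<le> 2 powr (2 - Re s)"
proof -
  have "(\<lambda>n. 1 / of_nat (Suc n) powr s) sums (zeta_reg s / (s - 1))"
    by (rule zeta_reg_dirichlet) (use s in auto)
  then have S: "(\<lambda>n. 1 / of_nat (Suc (Suc n)) powr s) sums (zeta_reg s / (s - 1) - 1)"
    using sums_Suc_iff[of "\<lambda>n. 1 / of_nat (Suc n) powr s" "zeta_reg s / (s - 1) - 1"] by simp
  have tel: "(\<lambda>n. 1 / real (Suc n) - 1 / real (Suc (Suc n))) sums (1 / real (Suc 0) - 0)"
    by (rule telescope_sums') (rule LIMSEQ_inverse_real_of_nat[unfolded inverse_eq_divide])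
  then have tel: "(\<lambda>n. 2 powr (2 - Re s) * (1 / real (Suc n) - 1 / real (Suc (Suc n)))) sums (2 powr (2 - Re s) * 1)"
    by (intro sums_mult) simp
  have le: "norm (1 / of_nat (Suc (Suc n)) powr s) \<le> 2 powr (2 - Re s) * (1 / real (Suc n) - 1 / real (Suc (Suc n)))" for n
  proof -
    define N where "N = real (Suc (Suc n))"
    have N: "N \<ge> 2" by (simp add: N_def)
    have "norm (1 / of_nat (Suc (Suc n)) powr s) = N powr (- Re s)"
      using norm_powr_real_powr[of "of_real N" s] N by (simp add: norm_divide powr_minus_divide N_def)
    also have "N powr (- Re s) = N powr (2 - Re s) * N powr (- 2)" by (simp flip: powr_add)
    also have "\<dots> \<le> 2 powr (2 - Re s) * N powr (- 2)"
      using N s by (intro mult_right_mono powr_mono2') auto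
    also have "N powr (- 2) \<le> 1 / real (Suc n) - 1 / N"
    proof -
      have "N powr (- 2) = 1 / (N * N)" using N by (simp add: powr_minus_divide power2_eq_square)
      also have "\<dots> \<le> 1 / (real (Suc n) * N)"
        by (intro divide_left_mono mult_right_mono mult_pos_pos) (auto simp: N_def)
      also have "\<dots> = 1 / real (Suc n) - 1 / N" by (simp add: N_def field_simps)
      finally show ?thesis .
    qed
    finally show ?thesis unfolding N_def by (simp add: mult_left_mono)
  qed
  have "norm (\<Sum>n. 1 / of_nat (Suc (Suc n)) powr s) \<le> (\<Sum>n. 2 powr (2 - Re s) * (1 / real (Suc n) - 1 / real (Suc (Suc n))))"
    by (rule norm_suminf_le[OF le sums_summable[OF tel]])
  then show ?thesis using sums_unique[OF S] sums_unique[OF tel] by simp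
qed

text \<open>The difference is the logarithmic derivative of zeta itself. As zeta is within
  \<open>1 / 2\<close> of \<open>1\<close>, the denominator is at least \<open>1 / 2\<close>;
  Cauchy's inequality on the unit circle about \<open>s\<close> bounds the numerator by
  \<open>2 powr (3 - Re s)\<close>.\<close>

lemma deriv_zeta_reg_div:
  assumes s: "Re s \<ge> 3"
  shows "norm (deriv zeta_reg s / zeta_reg s - 1 / (s - 1)) \<le> 2 powr (4 - Re s)" "zeta_reg s \<noteq> 0"
proof -
  define D where "D s = zeta_reg s / (s - 1)" for s
  have D_hol: "D holomorphic_on {s. Re s > 1}"
    unfolding D_def by (intro holomorphic_intros holomorphic_on_subset[OF holomorphic_zeta_reg]) auto
  have opn: "open {s. Re s > 1}" by (rule open_halfspace_Re_gt)
  have s1: "s \<noteq> 1" "Re s > 1" using s by auto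
  have "norm (D s - 1) \<le> 2 powr (2 - Re s)" unfolding D_def by (rule dirichlet_minus_1_le) (use s in auto)
  also have "\<dots> \<le> 2 powr (- 1)" using s by (intro powr_mono) auto
  finally have "norm (D s - 1) \<le> 1 / 2" by simp
  then have Ds: "norm (D s) \<ge> 1 / 2" using norm_triangle_ineq2[of 1 "1 - D s"] by (simp add: norm_minus_commute)
  then have D0: "D s \<noteq> 0" by auto
  then show z0: "zeta_reg s \<noteq> 0" by (auto simp: D_def)
  have dD: "(D has_field_derivative deriv D s) (at s)"
    by (rule holomorphic_derivI[OF D_hol opn]) (use s1 in auto)
  have sub: "Re w \<ge> Re s - 1" if "w \<in> cball s 1" for w
    using that abs_Re_le_cmod[of "s - w"] by (simp add: dist_norm)
  have sub2: "cball s 1 \<subseteq> {s. Re s > 1}" "ball s 1 \<subseteq> {s. Re s > 1}"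
  proof -
    show "cball s 1 \<subseteq> {s. Re s > 1}"
    proof
      fix w assume "w \<in> cball s 1"
      from sub[OF this] s show "w \<in> {s. Re s > 1}" by simp
    qed
    then show "ball s 1 \<subseteq> {s. Re s > 1}" using ball_subset_cball by blast
  qed
  have "norm ((deriv ^^ 1) (\<lambda>w. D w - 1) s) \<le> fact 1 * 2 powr (3 - Re s) / 1 ^ 1"
  proof (rule Cauchy_inequality)
    show "(\<lambda>w. D w - 1) holomorphic_on ball s 1"
      by (intro holomorphic_intros holomorphic_on_subset[OF D_hol] sub2)
    show "continuous_on (cball s 1) (\<lambda>w. D w - 1)"
      by (intro holomorphic_on_imp_continuous_on holomorphic_intros holomorphic_on_subset[OF D_hol] sub2)
    fix w assume "norm (s - w) = 1"
    then have w: "Re w \<ge> Re s - 1" by (intro sub) (simp add: dist_norm)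
    have "norm (D w - 1) \<le> 2 powr (2 - Re w)" unfolding D_def using w s by (intro dirichlet_minus_1_le) auto
    also have "\<dots> \<le> 2 powr (3 - Re s)" using w by (intro powr_mono) auto
    finally show "norm (D w - 1) \<le> 2 powr (3 - Re s)" .
  qed auto
  moreover have "deriv (\<lambda>w. D w - 1) s = deriv D s"
    using dD by (intro DERIV_imp_deriv) (auto intro!: derivative_eq_intros)
  ultimately have D': "norm (deriv D s) \<le> 2 powr (3 - Re s)" by simp
  have "(zeta_reg has_field_derivative (D s + (s - 1) * deriv D s)) (at s)"
  proof (rule has_field_derivative_transform_within_open[OF _ opn])
    show "((\<lambda>w. (w - 1) * D w) has_field_derivative (D s + (s - 1) * deriv D s)) (at s)"
      using dD by (auto intro!: derivative_eq_intros)
  qed (use s1 in \<open>auto simp: D_def\<close>)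
  then have dz: "deriv zeta_reg s = D s + (s - 1) * deriv D s" by (rule DERIV_imp_deriv)
  have z: "zeta_reg s = (s - 1) * D s" using s1 by (simp add: D_def)
  have "(d + c * e) / (c * d) - 1 / c = e / d" if "c \<noteq> 0" "d \<noteq> 0" for c d e :: complex
    using that by (simp add: divide_simps)
  from this[of "s - 1" "D s"] have "deriv zeta_reg s / zeta_reg s - 1 / (s - 1) = deriv D s / D s"
    unfolding dz z using s1 D0 by simp
  also have "norm \<dots> \<le> 2 powr (3 - Re s) / (1 / 2)"
    unfolding norm_divide by (intro frac_le D' Ds) auto
  also have "\<dots> = 2 powr (4 - Re s)" using powr_add[of 2 1 "3 - Re s"] by simp
  finally show "norm (deriv zeta_reg s / zeta_reg s - 1 / (s - 1)) \<le> 2 powr (4 - Re s)" .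
qed

lemma deriv_xi_div:
  assumes s: "Re s \<ge> 3"
  shows "deriv xi s / xi s = deriv zeta_reg s / zeta_reg s - of_real (ln pi) / 2 + Digamma (s / 2 + 1) / 2"
proof -
  have np: "s / 2 + 1 \<notin> \<int>\<^sub>\<le>\<^sub>0" using s by (auto elim!: nonpos_Ints_cases' simp: complex_eq_iff)
  have "(zeta_reg has_field_derivative deriv zeta_reg s) (at s)"
    by (rule holomorphic_derivI[OF holomorphic_zeta_reg open_halfspace_Re_gt]) (use s in auto)
  moreover have "((\<lambda>s. complex_of_real pi powr (- s / 2)) has_field_derivative
      of_real pi powr (- s / 2) * (- of_real (ln pi) / 2)) (at s)"
  proof -
    have "((\<lambda>s. - s / 2) has_field_derivative (- 1 / 2 :: complex)) (at s)" by (auto intro!: derivative_eq_intros)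
    from has_field_derivative_powr_right[where w = "complex_of_real pi" and z = "- s / 2"] have
      "((\<lambda>z. complex_of_real pi powr z) has_field_derivative of_real (ln pi) * of_real pi powr (- s / 2)) (at (- s / 2))"
      by (simp add: Ln_of_real)
    from DERIV_chain2[where g = "\<lambda>s. - s / 2", OF this \<open>((\<lambda>s. - s / 2) has_field_derivative (- 1 / 2 :: complex)) (at s)\<close>]
    show ?thesis by (rule DERIV_cong) simp
  qed
  moreover have "((\<lambda>s. Gamma (s / 2 + 1)) has_field_derivative Gamma (s / 2 + 1) * Digamma (s / 2 + 1) * (1 / 2)) (at s)"
  proof -
    have "((\<lambda>s. s / 2 + 1) has_field_derivative (1 / 2 :: complex)) (at s)" by (auto intro!: derivative_eq_intros)
    from DERIV_chain2[OF has_field_derivative_Gamma[OF np] this] show ?thesis .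
  qed
  ultimately have "((\<lambda>s. zeta_reg s * of_real pi powr (- s / 2) * Gamma (s / 2 + 1)) has_field_derivative
      ((deriv zeta_reg s * of_real pi powr (- s / 2) + of_real pi powr (- s / 2) * (- of_real (ln pi) / 2) * zeta_reg s) * Gamma (s / 2 + 1) +
       Gamma (s / 2 + 1) * Digamma (s / 2 + 1) * (1 / 2) * (zeta_reg s * of_real pi powr (- s / 2)))) (at s)"
    by (intro DERIV_mult)
  then have "(xi has_field_derivative
      ((deriv zeta_reg s * of_real pi powr (- s / 2) + of_real pi powr (- s / 2) * (- of_real (ln pi) / 2) * zeta_reg s) * Gamma (s / 2 + 1) +
       Gamma (s / 2 + 1) * Digamma (s / 2 + 1) * (1 / 2) * (zeta_reg s * of_real pi powr (- s / 2)))) (at s)" (is "(_ has_field_derivative ?D) _")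
    by (rule has_field_derivative_transform_within_open[OF _ open_halfspace_Re_gt[of 0]])
       (use s in \<open>auto simp: xi_def xi_right_def\<close>)
  then have "deriv xi s = ?D" by (rule DERIV_imp_deriv)
  moreover have "xi s = zeta_reg s * of_real pi powr (- s / 2) * Gamma (s / 2 + 1)"
    using s by (simp add: xi_def xi_right_def)
  moreover have "zeta_reg s \<noteq> 0" "of_real pi powr (- s / 2) \<noteq> (0::complex)" "Gamma (s / 2 + 1) \<noteq> 0"
    using deriv_zeta_reg_div(2)[OF s] np by (auto simp: Gamma_eq_zero_iff)
  ultimately show ?thesis by (simp add: field_simps)
qed

text \<open>From \<open>norm w \<le> \<bar>Im w\<bar> * (1 + y)\<close> and
  \<open>1 + y \<le> (1 + sqrt y)\<^sup>2\<close>. The square root yields the same rate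
  \<open>\<bar>t\<bar> powr (- (1 / 2))\<close> as the Digamma error, in one bound for small and
  large \<open>Im w\<close>.\<close>

lemma ln_norm_estimate:
  fixes w :: complex
  assumes "Re w > 0" "Im w \<noteq> 0"
  shows "\<bar>ln (norm w) - ln \<bar>Im w\<bar>\<bar> \<le> 2 * sqrt (Re w / \<bar>Im w\<bar>)"
proof -
  define y where "y = Re w / \<bar>Im w\<bar>"
  have y: "y > 0" using assms by (simp add: y_def)
  have "\<bar>Im w\<bar> \<le> norm w" by (rule abs_Im_le_cmod)
  then have "ln \<bar>Im w\<bar> \<le> ln (norm w)" using assms by (intro ln_mono) auto
  moreover have "\<bar>Im w\<bar> * (1 + y) = Re w + \<bar>Im w\<bar>"
    using assms by (simp add: y_def distrib_left)
  then have "norm w \<le> \<bar>Im w\<bar> * (1 + y)"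
    using cmod_le[of w] assms by simp
  then have "ln (norm w) \<le> ln (\<bar>Im w\<bar> * (1 + y))" using assms y by (subst ln_le_cancel_iff) auto
  then have "ln (norm w) \<le> ln \<bar>Im w\<bar> + ln (1 + y)" using assms y by (simp add: ln_mult)
  moreover have "1 + y \<le> (1 + sqrt y)\<^sup>2" using y by (simp add: power2_sum)
  then have "ln (1 + y) \<le> ln ((1 + sqrt y)\<^sup>2)"
    using y by (intro ln_mono) auto
  moreover have "ln ((1 + sqrt y)\<^sup>2) = 2 * ln (1 + sqrt y)" using y by (simp add: ln_realpow)
  moreover have "ln (1 + sqrt y) \<le> sqrt y" using y by (intro ln_add_one_self_le_self) auto
  ultimately show ?thesis unfolding y_def by linarith
qed

text \<open>\<open>x \<ge> 5 / 2\<close> means \<open>Re s \<ge> 3\<close>. Only the zeta'/zeta part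
  fails to decay in \<open>t\<close>, and it accounts for \<open>2 powr (4 - x)\<close>. The main
  term joins \<open>ln (\<bar>t\<bar> / 2) / 2\<close>, from Digamma at \<open>s / 2 + 1\<close>,
  with \<open>- ln pi / 2\<close>.\<close>

lemma Re_log_deriv_xi_estimate:
  assumes x: "x \<ge> 5 / 2"
  obtains C where "C > 0" "\<And>t. t \<noteq> 0 \<Longrightarrow>
     \<bar>Re (deriv xi (1 / 2 + Complex x t) / xi (1 / 2 + Complex x t)) - ln (\<bar>t\<bar> / (2 * pi)) / 2\<bar>
       \<le> 2 powr (4 - x) + C * \<bar>t\<bar> powr (- (1 / 2))"
proof -
  define S where "S = (\<Sum>k. real (Suc k) powr (- (3 / 2)))"
  have S: "S \<ge> 0" unfolding S_def by (intro suminf_nonneg summable_Suc_powr) auto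
  \<comment> \<open>The summands cover \<open>1 / (s - 1)\<close>, the Digamma remainder, and the
    passage from \<open>ln (norm w)\<close> to \<open>ln (\<bar>t\<bar> / 2)\<close>.\<close>
  define C where "C = 1 + S * 2 + 2 * sqrt (x + 5 / 2)"
  have "C > 0" using S x by (auto simp: C_def intro!: add_pos_nonneg)
  moreover have "\<bar>Re (deriv xi (1 / 2 + Complex x t) / xi (1 / 2 + Complex x t)) - ln (\<bar>t\<bar> / (2 * pi)) / 2\<bar>
       \<le> 2 powr (4 - x) + C * \<bar>t\<bar> powr (- (1 / 2))" if t: "t \<noteq> 0" for t
  proof -
    define s where "s = 1 / 2 + Complex x t"
    define w where "w = s / 2 + 1"
    define p where "p = \<bar>t\<bar> powr (- (1 / 2))"
    have s: "Re s = 1 / 2 + x" "Im s = t" by (auto simp: s_def)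
    have w: "Re w = (x + 5 / 2) / 2" "Im w = t / 2" by (auto simp: w_def s field_simps)
    have p: "p = 1 / sqrt \<bar>t\<bar>" by (simp add: p_def powr_minus_divide powr_half_sqrt)
    have 1: "\<bar>Re (deriv zeta_reg s / zeta_reg s - 1 / (s - 1))\<bar> \<le> 2 powr (4 - x)"
    proof -
      have "\<bar>Re (deriv zeta_reg s / zeta_reg s - 1 / (s - 1))\<bar> \<le> 2 powr (4 - Re s)"
        using deriv_zeta_reg_div(1)[of s] x s abs_Re_le_cmod order_trans by (smt (verit) field_sum_of_halves)
      also have "\<dots> \<le> 2 powr (4 - x)" by (intro powr_mono) (auto simp: s)
      finally show ?thesis .
    qed
    have 2: "\<bar>Re (1 / (s - 1))\<bar> \<le> p"
    proof -
      define M where "M = norm (s - 1)"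
      have "M \<ge> 1" "M \<ge> \<bar>t\<bar>"
        using abs_Re_le_cmod[of "s - 1"] abs_Im_le_cmod[of "s - 1"] x by (auto simp: s M_def)
      then have "sqrt \<bar>t\<bar> \<le> sqrt M" "sqrt M \<le> M" by (auto intro!: real_sqrt_le_mono real_le_lsqrt simp: power2_eq_square)
      then have "sqrt \<bar>t\<bar> \<le> M" by linarith
      have "\<bar>Re (1 / (s - 1))\<bar> \<le> 1 / M"
        using abs_Re_le_cmod[of "1 / (s - 1)"] by (simp add: M_def norm_divide)
      also have "\<dots> \<le> p" unfolding p using \<open>sqrt \<bar>t\<bar> \<le> M\<close> t by (intro divide_left_mono mult_pos_pos) (use \<open>M \<ge> 1\<close> in auto)
      finally show ?thesis .
    qed
    have 3: "\<bar>Re (Digamma w) - ln (norm w)\<bar> \<le> S * (2 * p)"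
    proof -
      have "\<bar>Re (Digamma w) - ln (norm w)\<bar> \<le> S * \<bar>Im w\<bar> powr (- (1 / 2))"
        unfolding S_def by (rule Re_Digamma_estimate) (use w x t in auto)
      also have "\<bar>Im w\<bar> powr (- (1 / 2)) \<le> 2 * p"
      proof -
        have "\<bar>Im w\<bar> powr (- (1 / 2)) = sqrt 2 * p"
          by (simp add: w p powr_minus_divide powr_half_sqrt real_sqrt_divide abs_divide)
        also have "\<dots> \<le> 2 * p" by (intro mult_right_mono) (auto simp: p_def real_le_lsqrt)
        finally show ?thesis .
      qed
      finally show ?thesis using S by (simp add: mult_left_mono)
    qed
    have 4: "\<bar>ln (norm w) - ln (\<bar>t\<bar> / 2)\<bar> \<le> 2 * sqrt (x + 5 / 2) * p"
    proof -
      have "\<bar>ln (norm w) - ln \<bar>Im w\<bar>\<bar> \<le> 2 * sqrt (Re w / \<bar>Im w\<bar>)"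
        by (rule ln_norm_estimate) (use w x t in auto)
      moreover have "Re w / \<bar>Im w\<bar> = (x + 5 / 2) / \<bar>t\<bar>"
        using t by (simp add: w field_simps)
      then have "2 * sqrt (Re w / \<bar>Im w\<bar>) = 2 * sqrt (x + 5 / 2) * p"
        by (simp only: p real_sqrt_divide times_divide_eq_right mult_1_right)
      moreover have "\<bar>Im w\<bar> = \<bar>t\<bar> / 2" by (simp add: w)
      ultimately show ?thesis by (simp only:)
    qed
    have "Re (deriv xi s / xi s) = Re (deriv zeta_reg s / zeta_reg s - 1 / (s - 1)) + Re (1 / (s - 1)) - ln pi / 2 + Re (Digamma w) / 2"
      by (subst deriv_xi_div) (use x s in \<open>auto simp: w_def\<close>)
    moreover have "ln (\<bar>t\<bar> / (2 * pi)) = ln (\<bar>t\<bar> / 2) - ln pi" using t by (simp add: ln_div ln_mult)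
    moreover have "C * p = p + S * (2 * p) + 2 * sqrt (x + 5 / 2) * p" by (simp add: C_def algebra_simps)
    moreover have "p \<ge> 0" "S * (2 * p) \<ge> 0" using S by (auto simp: p_def)
    ultimately show ?thesis using 1 2 3 4 unfolding s_def[symmetric] p_def[symmetric] by linarith
  qed
  ultimately show ?thesis using that by blast
qed

section \<open>Poisson representation of the summand\<close>

text \<open>With \<open>z = \<rho> - 1 / 2\<close> and \<open>a = b + 1 / 2\<close> this is
  \<open>(\<rho> - b - 1) / (\<rho> + b)\<close>. For \<open>a > 0\<close> it maps the right half
  plane into the unit disc and the imaginary axis into the unit circle.\<close>

definition cayley :: "real \<Rightarrow> complex \<Rightarrow> complex" where
  "cayley a z = (z - of_real a) / (z + of_real a)"

definition cayley_re :: "real \<Rightarrow> nat \<Rightarrow> complex \<Rightarrow> real" where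
  "cayley_re a n z = 1 - Re (cayley a z ^ n)"

context
  fixes a :: real
  assumes a: "a > 0"
begin

abbreviation cayley_axis :: "nat \<Rightarrow> real \<Rightarrow> real" where
  "cayley_axis n t \<equiv> cayley_re a n (\<i> * of_real t)"

lemma cayley_denom_nonzero: "Re z \<ge> 0 \<Longrightarrow> z + of_real a \<noteq> 0"
  using a by (auto simp: complex_eq_iff)

lemma norm_cayley_le_1:
  assumes "Re z \<ge> 0"
  shows "norm (cayley a z) \<le> 1"
proof -
  have "(Re z - a)\<^sup>2 \<le> (Re z + a)\<^sup>2" using a assms by (simp add: power2_eq_square algebra_simps)
  then have "norm (z - of_real a) \<le> norm (z + of_real a)" by (simp add: cmod_def)
  then show ?thesis using cayley_denom_nonzero[OF assms] by (simp add: cayley_def norm_divide)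
qed

lemma norm_cayley_axis: "norm (cayley a (\<i> * of_real t)) = 1"
proof -
  have "norm (\<i> * of_real t - of_real a :: complex) = norm (\<i> * of_real t + of_real a :: complex)"
    by (simp add: cmod_def)
  then show ?thesis using cayley_denom_nonzero[of "\<i> * of_real t"] by (simp add: cayley_def norm_divide)
qed

lemma cayley_diff:
  assumes "Re z \<ge> 0" "Re w \<ge> 0"
  shows "cayley a z - cayley a w = 2 * of_real a * (z - w) / ((z + of_real a) * (w + of_real a))"
  using cayley_denom_nonzero[OF assms(1)] cayley_denom_nonzero[OF assms(2)]
  unfolding cayley_def by (subst diff_frac_eq) (simp_all add: algebra_simps)

lemma norm_le_norm_add_of_real:
  fixes z :: complex and r :: real
  assumes "Re z \<ge> 0" "r \<ge> 0"
  shows "norm z \<le> norm (z + of_real r)"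
proof (rule power2_le_imp_le)
  have "(Re z)\<^sup>2 \<le> (Re z + r)\<^sup>2" using assms by (intro power_mono) auto
  then show "(norm z)\<^sup>2 \<le> (norm (z + of_real r))\<^sup>2" by (simp add: cmod_power2)
qed simp

lemma norm_ge_axis: "Re z \<ge> 0 \<Longrightarrow> a\<^sup>2 + (Im z)\<^sup>2 \<le> (norm (z + of_real a))\<^sup>2"
  using a by (simp add: cmod_power2 power_mono)

lemma cayley_re_nonneg: "Re z \<ge> 0 \<Longrightarrow> cayley_re a n z \<ge> 0"
  and cayley_re_le_2: "Re z \<ge> 0 \<Longrightarrow> cayley_re a n z \<le> 2"
proof -
  assume z: "Re z \<ge> 0"
  have "\<bar>Re (cayley a z ^ n)\<bar> \<le> norm (cayley a z ^ n)" by (rule abs_Re_le_cmod)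
  also have "\<dots> \<le> 1" using norm_cayley_le_1[OF z] by (simp add: norm_power power_le_one)
  finally show "cayley_re a n z \<ge> 0" "cayley_re a n z \<le> 2" unfolding cayley_re_def by linarith+
qed

text \<open>On the unit circle \<open>1 - Re w\<close> is half the square of
  \<open>norm (1 - w)\<close>. This turns the bound \<open>n * norm (1 - q)\<close> into quadratic
  decay in \<open>t\<close>, which makes the sum over the zeros converge.\<close>

lemma cayley_re_axis_le: "cayley_axis n t \<le> 2 * a\<^sup>2 * (real n)\<^sup>2 / (a\<^sup>2 + t\<^sup>2)"
proof -
  define q where "q = cayley a (\<i> * of_real t)"
  have q: "norm q = 1" unfolding q_def by (rule norm_cayley_axis)
  have "(norm (1 - q ^ n))\<^sup>2 = (norm (q ^ n))\<^sup>2 + 1 - 2 * Re (q ^ n)"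
  proof -
    have "(norm (1 - z))\<^sup>2 = (norm z)\<^sup>2 + 1 - 2 * Re z" for z :: complex
      unfolding cmod_power2 by (simp add: power2_eq_square algebra_simps)
    then show ?thesis .
  qed
  then have 1: "cayley_axis n t = (norm (1 - q ^ n))\<^sup>2 / 2"
    using q by (simp add: cayley_re_def q_def[symmetric] norm_power)
  have "norm (1 - q ^ n) \<le> real n * norm (1 - q)"
    using norm_power_diff[of 1 q n] q by simp
  then have "(norm (1 - q ^ n))\<^sup>2 \<le> (real n)\<^sup>2 * (norm (1 - q))\<^sup>2"
    by (metis norm_ge_zero power_mono power_mult_distrib)
  also have "(norm (1 - q))\<^sup>2 = 4 * a\<^sup>2 / (a\<^sup>2 + t\<^sup>2)"
  proof -
    have "1 - q = 2 * of_real a / (\<i> * of_real t + of_real a)"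
      using cayley_denom_nonzero[of "\<i> * of_real t"] by (simp add: q_def cayley_def field_simps)
    moreover have "(norm (\<i> * of_real t + of_real a :: complex))\<^sup>2 = a\<^sup>2 + t\<^sup>2"
      by (simp add: cmod_power2)
    ultimately show ?thesis by (simp add: norm_divide power_divide power_mult_distrib norm_mult)
  qed
  finally show ?thesis unfolding 1 by (simp add: mult_ac)
qed

text \<open>In the unit disc, \<open>n\<close>-th powers differ by at most \<open>n\<close> times
  the difference of the bases. Linear growth in \<open>n\<close> against a weight summable over the
  zeros keeps the cost of the shift at \<open>o(n)\<close>.\<close>

lemma cayley_re_diff_le:
  assumes "x \<ge> 0"
  shows "\<bar>cayley_re a n (Complex x t) - cayley_axis n t\<bar> \<le> 2 * a * x * real n / (a\<^sup>2 + t\<^sup>2)"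
proof -
  define q r where "q = cayley a (Complex x t)" and "r = cayley a (\<i> * of_real t)"
  have qr: "norm q \<le> 1" "norm r \<le> 1" unfolding q_def r_def using assms by (auto intro!: norm_cayley_le_1)
  have D: "a\<^sup>2 + t\<^sup>2 > 0" using a by (simp add: add_pos_nonneg)
  have "\<bar>cayley_re a n (Complex x t) - cayley_axis n t\<bar> = \<bar>Re (q ^ n - r ^ n)\<bar>"
    by (simp add: cayley_re_def q_def r_def)
  also have "\<dots> \<le> norm (q ^ n - r ^ n)" by (rule abs_Re_le_cmod)
  also have "\<dots> \<le> real n * norm (q - r)" using norm_power_diff[OF qr] by simp
  also have "\<dots> \<le> real n * (2 * a * x / (a\<^sup>2 + t\<^sup>2))"
  proof (rule mult_left_mono)
    define u v where "u = norm (Complex x t + of_real a)" and "v = norm (\<i> * of_real t + of_real a :: complex)"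
    have "sqrt (a\<^sup>2 + t\<^sup>2) \<le> u" "sqrt (a\<^sup>2 + t\<^sup>2) \<le> v"
      using norm_ge_axis[of "Complex x t"] norm_ge_axis[of "\<i> * of_real t"] assms
      by (auto simp: u_def v_def intro!: real_le_lsqrt)
    then have "sqrt (a\<^sup>2 + t\<^sup>2) * sqrt (a\<^sup>2 + t\<^sup>2) \<le> u * v" by (intro mult_mono) (auto simp: u_def)
    then have uv: "a\<^sup>2 + t\<^sup>2 \<le> u * v" using D by simp
    have "Complex x t - \<i> * of_real t = of_real x" by (simp add: complex_eq_iff)
    then have "q - r = 2 * of_real a * of_real x / ((Complex x t + of_real a) * (\<i> * of_real t + of_real a))"
      unfolding q_def r_def using assms by (subst cayley_diff) auto
    then have "norm (q - r) = 2 * a * x / (u * v)"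
      using a assms by (simp add: norm_divide norm_mult u_def v_def)
    also have "\<dots> \<le> 2 * a * x / (a\<^sup>2 + t\<^sup>2)"
      using uv D a assms mult_pos_pos[OF D less_le_trans[OF D uv]]
      by (intro divide_left_mono) (auto simp: mult_ac)
    finally show "norm (q - r) \<le> 2 * a * x / (a\<^sup>2 + t\<^sup>2)" .
  qed simp
  finally show ?thesis by (simp add: mult_ac)
qed

text \<open>The divided difference of \<open>z \<mapsto> cayley a z ^ n\<close> at \<open>z0\<close> is given by a finite sum, so the
  Poisson integrand has a holomorphic primitive up to an arctangent and no residue is needed.\<close>

lemma nn_integral_poisson_cayley:
  fixes x g :: real and n :: nat
  assumes x: "x > 0"
  shows "(\<integral>\<^sup>+t. ennreal (cayley_axis n t * (x / (x\<^sup>2 + (t - g)\<^sup>2))) \<partial>lborel) =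
     ennreal (pi * cayley_re a n (Complex x g))"
proof -
  define z0 where "z0 = Complex x g"
  define v where "v = cayley a z0"
  define H0 where "H0 = cayley_re a n z0"
  define p where "p t = x / (x\<^sup>2 + (t - g)\<^sup>2)" for t
  \<comment> \<open>The poles \<open>- a\<close> and \<open>- cnj z0\<close> have real parts
    \<open>- a\<close> and \<open>- x\<close>; the half plane stays clear of both and contains the
    axis in its interior.\<close>
  define \<delta> where "\<delta> = min a x / 2"
  have \<delta>: "\<delta> > 0" "\<delta> < a" "\<delta> < x" using a x by (auto simp: \<delta>_def)
  \<comment> \<open>On the axis the Poisson kernel is
    \<open>- x / ((z - z0) * (z + cnj z0))\<close>. Its factor \<open>z - z0\<close> cancels against
    \<open>v ^ n - cayley a z ^ n\<close>, and \<open>G\<close> is the quotient written without that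
    singularity.\<close>
  define G where "G z = 2 * of_real a / ((z + of_real a) * (z0 + of_real a)) *
      (\<Sum>k<n. v ^ (n - Suc k) * cayley a z ^ k) * (of_real x / (z + cnj z0))" for z
  let ?S = "{z. Re z > - \<delta>}"
  have S: "open ?S" "convex ?S" by (rule open_halfspace_Re_gt, rule convex_halfspace_Re_gt)
  have nzS: "z + of_real a \<noteq> 0" "z + cnj z0 \<noteq> 0" if "z \<in> ?S" for z
    using that \<delta> by (auto simp: complex_eq_iff z0_def)
  have z0: "Re z0 > 0" "z0 + of_real a \<noteq> 0" using cayley_denom_nonzero[of z0] x by (auto simp: z0_def)
  have hol: "G holomorphic_on ?S"
    unfolding G_def cayley_def using nzS z0 by (intro holomorphic_intros) auto
  obtain \<Phi> where "\<And>z. z \<in> ?S \<Longrightarrow> (\<Phi> has_field_derivative G z) (at z within ?S)"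
    using holomorphic_convex_primitive'[OF S(2,1) hol] by blast
  then have \<Phi>: "(\<Phi> has_field_derivative G z) (at z)" if "z \<in> ?S" for z
    using that at_within_open[OF that S(1)] by metis
  define C where "C = 2 * a / norm (z0 + of_real a) * real n * (x * 2)"
  have G_bound: "norm (G z) \<le> C / (norm z)\<^sup>2" if z: "Re z \<ge> 0" "norm z \<ge> 2 * \<bar>g\<bar>" "norm z > 0" for z
  proof -
    have n1: "norm z \<le> norm (z + of_real a)"
      using z a by (intro norm_le_norm_add_of_real) auto
    have "norm z / 2 \<le> norm (z - \<i> * of_real g)"
      using norm_triangle_ineq2[of z "\<i> * of_real g"] z by (simp add: norm_mult)
    also have "\<dots> \<le> norm (z - \<i> * of_real g + of_real x)"
      using z x by (intro norm_le_norm_add_of_real) auto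
    also have "z - \<i> * of_real g + of_real x = z + cnj z0" by (simp add: z0_def complex_eq_iff)
    finally have n2: "norm z / 2 \<le> norm (z + cnj z0)" .
    have "norm (\<Sum>k<n. v ^ (n - Suc k) * cayley a z ^ k) \<le> (\<Sum>k<n. 1)"
    proof (rule sum_norm_le)
      fix k
      have "norm (cayley a z) \<le> 1" "norm v \<le> 1" using that z0 by (auto simp: v_def intro!: norm_cayley_le_1)
      then show "norm (v ^ (n - Suc k) * cayley a z ^ k) \<le> 1"
        by (simp add: norm_mult norm_power mult_le_one power_le_one)
    qed
    then have n3: "norm (\<Sum>k<n. v ^ (n - Suc k) * cayley a z ^ k) \<le> real n" by simp
    have "norm (G z) = 2 * a / (norm (z + of_real a) * norm (z0 + of_real a)) *
        norm (\<Sum>k<n. v ^ (n - Suc k) * cayley a z ^ k) * (x / norm (z + cnj z0))"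
      using a x by (simp add: G_def norm_mult norm_divide)
    also have "\<dots> \<le> 2 * a / (norm z * norm (z0 + of_real a)) * real n * (x / (norm z / 2))"
      using n1 n2 n3 a x z z0 by (intro mult_mono divide_left_mono mult_right_mono mult_pos_pos) auto
    also have "\<dots> = C / (norm z)\<^sup>2" by (simp add: C_def power2_eq_square)
    finally show ?thesis .
  qed
  have p_eq: "cayley_axis n t * p t = Re (G (\<i> * of_real t)) + H0 * p t" for t
  proof -
    define z where "z = \<i> * complex_of_real t"
    define u where "u = cayley a z"
    have zz: "(z - z0) * (z + cnj z0) = - of_real (x\<^sup>2 + (t - g)\<^sup>2)"
      by (simp add: z_def z0_def complex_eq_iff power2_eq_square algebra_simps)
    have pos: "x\<^sup>2 + (t - g)\<^sup>2 > 0" using x by (simp add: add_pos_nonneg)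
    then have "- complex_of_real (x\<^sup>2 + (t - g)\<^sup>2) \<noteq> 0"
      unfolding neg_equal_0_iff_equal of_real_eq_0_iff by linarith
    then have nz: "z - z0 \<noteq> 0" "z + cnj z0 \<noteq> 0" unfolding zz[symmetric] by auto
    have pt: "of_real (p t) = - of_real x / ((z - z0) * (z + cnj z0))" unfolding zz by (simp only: p_def of_real_divide minus_divide_divide)
    have "u ^ n - v ^ n = (u - v) * (\<Sum>k<n. v ^ (n - Suc k) * u ^ k)" by (rule power_diff_sumr2)
    also have "u - v = 2 * of_real a * (z - z0) / ((z + of_real a) * (z0 + of_real a))"
      unfolding u_def v_def by (rule cayley_diff) (use z0 in \<open>auto simp: z_def\<close>)
    finally have uv: "u ^ n - v ^ n = 2 * of_real a * (z - z0) / ((z + of_real a) * (z0 + of_real a)) *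
        (\<Sum>k<n. v ^ (n - Suc k) * u ^ k)" .
    have "- (u ^ n - v ^ n) * of_real (p t) = G z"
      unfolding uv pt G_def u_def[symmetric] using nz
      by (simp add: divide_simps)
    then have "Re (- (u ^ n - v ^ n) * of_real (p t)) = Re (G z)" by simp
    moreover have "Re (- (u ^ n - v ^ n) * of_real (p t)) = (cayley_re a n z - H0) * p t"
      by (simp add: cayley_re_def H0_def u_def v_def)
    ultimately show ?thesis by (simp add: z_def algebra_simps)
  qed
  \<comment> \<open>Along the axis \<open>\<Phi>\<close> has derivative \<open>\<i> * G\<close>,
    whose imaginary part is \<open>Re G\<close>; the arctangent is a primitive of the Poisson
    kernel.\<close>
  define A where "A t = Im (\<Phi> (\<i> * of_real t)) + H0 * arctan ((t - g) / x)" for t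
  have dA: "(A has_real_derivative (cayley_axis n t * p t)) (at t)" for t
  proof -
    have "((\<lambda>t. \<Phi> (\<i> * of_real t)) has_vector_derivative (\<i> * G (\<i> * of_real t))) (at t)"
    proof -
      have "((\<lambda>t. \<i> * of_real t) has_vector_derivative \<i>) (at t)"
        by (auto intro!: derivative_eq_intros)
      moreover have "(\<Phi> has_field_derivative G (\<i> * of_real t)) (at (\<i> * of_real t))"
        by (rule \<Phi>) (use \<delta> in auto)
      ultimately show ?thesis
        using field_vector_diff_chain_at[of "\<lambda>t. \<i> * of_real t" \<i> t \<Phi>] by (simp add: o_def)
    qed
    from bounded_linear.has_vector_derivative[OF bounded_linear_Im this]
    have 1: "((\<lambda>t. Im (\<Phi> (\<i> * of_real t))) has_real_derivative Re (G (\<i> * of_real t))) (at t)"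
      by (simp add: has_real_derivative_iff_has_vector_derivative)
    have "((\<lambda>t. (t - g) / x) has_real_derivative 1 / x) (at t)"
      using x by (auto intro!: derivative_eq_intros)
    from DERIV_chain2[OF DERIV_arctan this]
    have "((\<lambda>t. arctan ((t - g) / x)) has_real_derivative (inverse (1 + ((t - g) / x)\<^sup>2) * (1 / x))) (at t)" .
    moreover have "inverse (1 + ((t - g) / x)\<^sup>2) * (1 / x) = p t"
    proof -
      have "1 + ((t - g) / x)\<^sup>2 = (x\<^sup>2 + (t - g)\<^sup>2) / x\<^sup>2"
        using x by (simp add: power_divide add_divide_distrib)
      then show ?thesis using x by (simp add: p_def power2_eq_square)
    qed
    ultimately have 2: "((\<lambda>t. H0 * arctan ((t - g) / x)) has_real_derivative H0 * p t) (at t)"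
      by (simp add: DERIV_cmult)
    show ?thesis unfolding A_def p_eq by (rule DERIV_add[OF 1 2])
  qed
  have nn: "cayley_axis n t * p t \<ge> 0" for t
    using cayley_re_nonneg[of "\<i> * of_real t" n] x by (auto simp: p_def intro!: mult_nonneg_nonneg)
  have cont: "continuous_on UNIV (\<lambda>t. cayley_axis n t * p t)"
  proof -
    have "x\<^sup>2 + (t - g)\<^sup>2 \<noteq> 0" for t using x by (simp add: add_pos_nonneg less_imp_neq[symmetric])
    moreover have "\<i> * of_real t + of_real a \<noteq> 0" for t using cayley_denom_nonzero[of "\<i> * of_real t"] by simp
    ultimately show ?thesis
      unfolding cayley_re_def cayley_def p_def by (intro continuous_intros) auto
  qed
  then have meas: "(\<lambda>t. cayley_axis n t * p t) \<in> borel_measurable borel"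
    by (rule borel_measurable_continuous_onI)
  have FTC: "(\<integral>\<^sup>+t. ennreal (cayley_axis n t * p t) * indicator {- real N..real N} t \<partial>lborel) =
      ennreal (A (real N) - A (- real N))" for N
    by (rule nn_integral_FTC_Icc[OF meas dA nn]) auto
  have lim1: "(\<lambda>N. A (real N) - A (- real N)) \<longlonglongrightarrow> pi * H0"
  proof -
    \<comment> \<open>The values of \<open>\<Phi>\<close> at both ends of the diameter are compared
      along the right semicircle, of length \<open>pi * R\<close>, where the integrand is at most
      \<open>C / R\<^sup>2\<close>. Hence only the jump of the arctangent survives in the
      limit.\<close>
    have arc: "norm (\<Phi> (\<i> * of_real R) - \<Phi> (- \<i> * of_real R)) \<le> pi * C / R"
      if R: "R > 0" "R \<ge> 2 * \<bar>g\<bar>" for R :: real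
    proof -
      let ?f = "\<lambda>\<theta>. \<Phi> (of_real R * cis \<theta>)"
      have "norm (?f (pi / 2) - ?f (- (pi / 2))) \<le> C / R * (pi / 2) - C / R * (- (pi / 2))"
      proof (rule differentiable_bound_general[where f' = "\<lambda>\<theta>. of_real R * (\<i> * cis \<theta>) * G (of_real R * cis \<theta>)" and \<phi>' = "\<lambda>_. C / R"])
        have der: "(?f has_vector_derivative (of_real R * (\<i> * cis \<theta>) * G (of_real R * cis \<theta>))) (at \<theta>)"
          if "- (pi / 2) \<le> \<theta>" "\<theta> \<le> pi / 2" for \<theta>
        proof -
          have "((\<lambda>\<theta>. of_real R * cis \<theta>) has_vector_derivative (of_real R * (\<i> * cis \<theta>))) (at \<theta>)"
          proof -
            have "((\<lambda>z. of_real R * exp (\<i> * z)) has_field_derivative of_real R * (\<i> * exp (\<i> * of_real \<theta>))) (at (of_real \<theta>))"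
              by (auto intro!: derivative_eq_intros)
            from has_vector_derivative_real_field[OF this] show ?thesis by (simp add: cis_conv_exp)
          qed
          moreover have "(\<Phi> has_field_derivative G (of_real R * cis \<theta>)) (at (of_real R * cis \<theta>))"
          proof (rule \<Phi>)
            have "cos \<theta> \<ge> 0" using that by (intro cos_ge_zero) auto
            then have "Re (of_real R * cis \<theta>) \<ge> 0" using R by simp
            then show "of_real R * cis \<theta> \<in> ?S" using \<delta> by simp
          qed
          ultimately show ?thesis
            using field_vector_diff_chain_at[of "\<lambda>\<theta>. of_real R * cis \<theta>" "of_real R * (\<i> * cis \<theta>)" \<theta> \<Phi>] by (simp add: o_def)
        qed
        show "continuous_on {- (pi / 2)..pi / 2} ?f"
        proof (rule continuous_at_imp_continuous_on, intro ballI)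
          fix \<theta> assume "\<theta> \<in> {- (pi / 2)..pi / 2}"
          then show "isCont ?f \<theta>" using has_vector_derivative_continuous[OF der] by simp
        qed
        show "(?f has_vector_derivative (of_real R * (\<i> * cis \<theta>) * G (of_real R * cis \<theta>))) (at \<theta>)"
          if "- (pi / 2) < \<theta>" "\<theta> < pi / 2" for \<theta> using der that by simp
        show "norm (of_real R * (\<i> * cis \<theta>) * G (of_real R * cis \<theta>)) \<le> C / R"
          if "- (pi / 2) < \<theta>" "\<theta> < pi / 2" for \<theta>
        proof -
          have "cos \<theta> \<ge> 0" using that by (intro cos_ge_zero) auto
          then have "norm (G (of_real R * cis \<theta>)) \<le> C / (norm (of_real R * cis \<theta>))\<^sup>2"
            using R by (intro G_bound) (auto simp: norm_mult)
          then have "R * norm (G (of_real R * cis \<theta>)) \<le> R * (C / R\<^sup>2)"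
            using R by (intro mult_left_mono) (auto simp: norm_mult)
          then show ?thesis using R by (simp add: norm_mult power2_eq_square)
        qed
        show "((\<lambda>\<theta>. C / R * \<theta>) has_vector_derivative C / R) (at \<theta>)" for \<theta>
          by (auto intro!: derivative_eq_intros)
      qed (use R in \<open>auto intro!: continuous_intros\<close>)
      moreover have "of_real R * cis (pi / 2) = \<i> * of_real R" "of_real R * cis (- (pi / 2)) = - \<i> * of_real R"
        by (auto simp: complex_eq_iff)
      ultimately show ?thesis by (simp add: field_simps)
    qed
    have "(\<lambda>N. Im (\<Phi> (\<i> * of_real (real N))) - Im (\<Phi> (\<i> * of_real (- real N)))) \<longlonglongrightarrow> 0"
    proof (rule Lim_null_comparison)
      obtain M :: nat where M: "real M \<ge> max 1 (2 * \<bar>g\<bar>)" using real_arch_simple by blast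
      show "eventually (\<lambda>N. norm (Im (\<Phi> (\<i> * of_real (real N))) - Im (\<Phi> (\<i> * of_real (- real N)))) \<le> pi * C * inverse (real N)) sequentially"
        using eventually_ge_at_top[of M]
      proof eventually_elim
        case (elim N)
        then have "real N \<ge> real M" by simp
        then have "norm (\<Phi> (\<i> * of_real (real N)) - \<Phi> (- \<i> * of_real (real N))) \<le> pi * C / real N"
          using M by (intro arc) auto
        then show ?case
          using abs_Im_le_cmod[of "\<Phi> (\<i> * of_real (real N)) - \<Phi> (- \<i> * of_real (real N))"]
          by (simp add: divide_inverse)
      qed
      show "(\<lambda>N. pi * C * inverse (real N)) \<longlonglongrightarrow> 0"
        by (intro tendsto_mult_right_zero lim_inverse_n)
    qed
    moreover have "(\<lambda>N. H0 * arctan ((real N - g) / x) - H0 * arctan ((- real N - g) / x)) \<longlonglongrightarrow> H0 * (pi / 2) - H0 * (- (pi / 2))"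
    proof (intro tendsto_intros filterlim_compose[OF tendsto_arctan_at_top] filterlim_compose[OF tendsto_arctan_at_bot])
      have "filterlim (\<lambda>N. (1 / x) * (- g + real N)) at_top sequentially"
        by (intro filterlim_tendsto_pos_mult_at_top[OF tendsto_const] filterlim_tendsto_add_at_top[OF tendsto_const]
             filterlim_real_sequentially) (use x in auto)
      then show "filterlim (\<lambda>N. (real N - g) / x) at_top sequentially" by (simp add: diff_divide_distrib add_divide_distrib)
      have "filterlim (\<lambda>N. - ((1 / x) * (g + real N))) at_bot sequentially"
        unfolding filterlim_uminus_at_bot minus_minus
        by (intro filterlim_tendsto_pos_mult_at_top[OF tendsto_const] filterlim_tendsto_add_at_top[OF tendsto_const]
             filterlim_real_sequentially) (use x in auto)
      moreover have "- ((1 / x) * (g + real N)) = (- real N - g) / x" for N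
        by (simp add: diff_divide_distrib add_divide_distrib)
      ultimately show "filterlim (\<lambda>N. (- real N - g) / x) at_bot sequentially" by (simp only:)
    qed
    ultimately have "(\<lambda>N. (Im (\<Phi> (\<i> * of_real (real N))) - Im (\<Phi> (\<i> * of_real (- real N)))) +
        (H0 * arctan ((real N - g) / x) - H0 * arctan ((- real N - g) / x))) \<longlonglongrightarrow> 0 + (H0 * (pi / 2) - H0 * (- (pi / 2)))"
      by (rule tendsto_add)
    then show ?thesis by (simp add: A_def algebra_simps)
  qed
  have "(\<lambda>N. \<integral>\<^sup>+t. ennreal (cayley_axis n t * p t) * indicator {- real N..real N} t \<partial>lborel) \<longlonglongrightarrow>
      (\<integral>\<^sup>+t. ennreal (cayley_axis n t * p t) \<partial>lborel)"
  proof (rule nn_integral_LIMSEQ)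
    show "incseq (\<lambda>N t. ennreal (cayley_axis n t * p t) * indicator {- real N..real N} t)"
      by (intro incseq_SucI le_funI mult_left_mono) (auto split: split_indicator)
    show "(\<lambda>t. ennreal (cayley_axis n t * p t) * indicator {- real N..real N} t) \<in> borel_measurable lborel" for N
      using meas by measurable
    show "(\<lambda>N. ennreal (cayley_axis n t * p t) * indicator {- real N..real N} t) \<longlonglongrightarrow>
        ennreal (cayley_axis n t * p t)" for t
    proof (rule tendsto_eventually)
      obtain M :: nat where M: "real M \<ge> \<bar>t\<bar>" using real_arch_simple by blast
      show "eventually (\<lambda>N. ennreal (cayley_axis n t * p t) * indicator {- real N..real N} t =
          ennreal (cayley_axis n t * p t)) sequentially"
        using eventually_ge_at_top[of M]
      proof eventually_elim
        case (elim N)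
        then have "real N \<ge> real M" by simp
        then have "t \<in> {- real N..real N}" using M by auto
        then show ?case by simp
      qed
    qed
  qed
  moreover have "(\<lambda>N. ennreal (A (real N) - A (- real N))) \<longlonglongrightarrow> ennreal (pi * H0)"
    by (intro tendsto_ennrealI lim1)
  ultimately show ?thesis
    unfolding FTC using LIMSEQ_unique by (force simp: p_def H0_def z0_def)
qed

section \<open>Total mass and scaling limit of the test function\<close>

lemma continuous_on_cayley_re: "continuous_on UNIV (\<lambda>t. cayley_axis n t)"
proof -
  have "\<i> * of_real t + of_real a \<noteq> 0" for t using cayley_denom_nonzero[of "\<i> * of_real t"] by simp
  then show ?thesis unfolding cayley_re_def cayley_def by (intro continuous_intros) auto
qed

lemma measurable_cayley_re [measurable]: "(\<lambda>t. cayley_axis n t) \<in> borel_measurable borel"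
  by (rule borel_measurable_continuous_onI[OF continuous_on_cayley_re])

text \<open>The Poisson formula at a real point \<open>X\<close>, multiplied by \<open>X\<close>,
  has the kernel \<open>X\<^sup>2 / (X\<^sup>2 + t\<^sup>2)\<close> increasing to \<open>1\<close>.
  The limit of the right side is the first-order term of \<open>cayley a X ^ n\<close> at
  infinity.\<close>

lemma nn_integral_cayley_re:
  "(\<integral>\<^sup>+t. ennreal (cayley_axis n t) \<partial>lborel) = ennreal (2 * pi * a * real n)"
proof -
  let ?h = "\<lambda>t. cayley_axis n t"
  have h: "?h t \<ge> 0" for t by (rule cayley_re_nonneg) simp
  define X where "X m = real (Suc m)" for m
  have X: "X m > 0" for m by (simp add: X_def)
  have Xlim: "filterlim X at_top sequentially"
    unfolding X_def by (rule filterlim_compose[OF filterlim_real_sequentially filterlim_Suc])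
  have "(\<lambda>m. \<integral>\<^sup>+t. ennreal (?h t * ((X m)\<^sup>2 / ((X m)\<^sup>2 + t\<^sup>2))) \<partial>lborel) \<longlonglongrightarrow> (\<integral>\<^sup>+t. ennreal (?h t) \<partial>lborel)"
  proof (rule nn_integral_LIMSEQ)
    show "incseq (\<lambda>m t. ennreal (?h t * ((X m)\<^sup>2 / ((X m)\<^sup>2 + t\<^sup>2))))"
    proof (intro incseq_SucI le_funI ennreal_leI mult_left_mono h)
      fix m and t :: real
      have frac: "y / (y + t\<^sup>2) = 1 - t\<^sup>2 / (y + t\<^sup>2)" if "y > 0" for y :: real
        using that add_pos_nonneg[of y "t\<^sup>2"] by (simp add: field_simps)
      have le: "(X m)\<^sup>2 \<le> (X (Suc m))\<^sup>2" by (intro power_mono) (auto simp: X_def)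
      have "t\<^sup>2 / ((X (Suc m))\<^sup>2 + t\<^sup>2) \<le> t\<^sup>2 / ((X m)\<^sup>2 + t\<^sup>2)"
        using le X[of m] X[of "Suc m"] by (intro divide_left_mono mult_pos_pos add_pos_nonneg) auto
      then show "(X m)\<^sup>2 / ((X m)\<^sup>2 + t\<^sup>2) \<le> (X (Suc m))\<^sup>2 / ((X (Suc m))\<^sup>2 + t\<^sup>2)"
        using X[of m] X[of "Suc m"] by (subst (1 2) frac) auto
    qed
    fix t :: real
    have "(\<lambda>m. 1 / (1 + t\<^sup>2 * inverse (X m) ^ 2)) \<longlonglongrightarrow> 1 / (1 + t\<^sup>2 * 0 ^ 2)"
      by (intro tendsto_intros tendsto_inverse_0_at_top Xlim) auto
    moreover have "1 / (1 + t\<^sup>2 * inverse (X m) ^ 2) = (X m)\<^sup>2 / ((X m)\<^sup>2 + t\<^sup>2)" for m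
    proof -
      have "1 + t\<^sup>2 * inverse (X m) ^ 2 = ((X m)\<^sup>2 + t\<^sup>2) / (X m)\<^sup>2"
        using X[of m] by (simp add: power_inverse divide_inverse distrib_right)
      then show ?thesis by simp
    qed
    ultimately have "(\<lambda>m. ?h t * ((X m)\<^sup>2 / ((X m)\<^sup>2 + t\<^sup>2))) \<longlonglongrightarrow> ?h t * 1"
      by (intro tendsto_mult tendsto_const) simp
    then show "(\<lambda>m. ennreal (?h t * ((X m)\<^sup>2 / ((X m)\<^sup>2 + t\<^sup>2)))) \<longlonglongrightarrow> ennreal (?h t)"
      by (intro tendsto_ennrealI) simp
  qed auto
  moreover have "(\<integral>\<^sup>+t. ennreal (?h t * ((X m)\<^sup>2 / ((X m)\<^sup>2 + t\<^sup>2))) \<partial>lborel) =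
      ennreal (pi * (X m * cayley_re a n (of_real (X m))))" for m
  proof -
    have "(\<integral>\<^sup>+t. ennreal (?h t * ((X m)\<^sup>2 / ((X m)\<^sup>2 + t\<^sup>2))) \<partial>lborel) =
        (\<integral>\<^sup>+t. ennreal (X m) * ennreal (?h t * (X m / ((X m)\<^sup>2 + (t - 0)\<^sup>2))) \<partial>lborel)"
      using X[of m] h by (intro nn_integral_cong) (simp add: ennreal_mult'[symmetric] power2_eq_square mult_ac)
    also have "\<dots> = ennreal (X m) * ennreal (pi * cayley_re a n (Complex (X m) 0))"
      by (subst nn_integral_cmult) (simp_all only: nn_integral_poisson_cayley[OF X], measurable)
    also have "Complex (X m) 0 = of_real (X m)" by (simp add: complex_eq_iff)
    finally show ?thesis using X[of m] by (simp add: ennreal_mult'[symmetric] mult_ac)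
  qed
  moreover have "(\<lambda>m. X m * cayley_re a n (of_real (X m))) \<longlonglongrightarrow> 2 * a * real n"
  proof -
    \<comment> \<open>In the variable \<open>e = 1 / X\<close> the limit becomes the derivative of
      \<open>\<psi>\<close> at \<open>0\<close>.\<close>
    define \<psi> where "\<psi> e = ((1 - a * e) / (1 + a * e)) ^ n" for e :: real
    have "(\<psi> has_real_derivative - (2 * a * real n)) (at 0)"
      unfolding \<psi>_def by (auto intro!: derivative_eq_intros)
    then have "((\<lambda>e. (\<psi> e - 1) / e) \<longlongrightarrow> - (2 * a * real n)) (at 0)"
      by (simp add: has_field_derivative_iff \<psi>_def)
    moreover have "filterlim (\<lambda>m. inverse (X m)) (at 0) sequentially"
      unfolding filterlim_at using X
      by (auto intro!: tendsto_inverse_0_at_top[OF Xlim] always_eventually simp: less_imp_neq[symmetric])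
    ultimately have "(\<lambda>m. (\<psi> (inverse (X m)) - 1) / inverse (X m)) \<longlonglongrightarrow> - (2 * a * real n)"
      by (rule filterlim_compose)
    from tendsto_minus[OF this] have "(\<lambda>m. - ((\<psi> (inverse (X m)) - 1) / inverse (X m))) \<longlonglongrightarrow> 2 * a * real n" by simp
    moreover have "- ((\<psi> (inverse (X m)) - 1) / inverse (X m)) = X m * cayley_re a n (of_real (X m))" for m
    proof -
      have "(1 - a * inverse (X m)) / (1 + a * inverse (X m)) = (X m - a) / (X m + a)"
      proof -
        have "1 - a * inverse (X m) = (X m - a) / X m" "1 + a * inverse (X m) = (X m + a) / X m"
          using X[of m] by (auto simp: field_simps)
        then show ?thesis using X[of m] by simp
      qed
      moreover have "cayley a (of_real (X m)) = of_real ((X m - a) / (X m + a))" by (simp add: cayley_def)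
      then have "Re (cayley a (of_real (X m)) ^ n) = ((X m - a) / (X m + a)) ^ n"
        by (metis Re_complex_of_real of_real_power)
      moreover have "- ((R - 1) / inverse (X m)) = X m * (1 - R)" for R
        by (simp add: divide_inverse algebra_simps)
      ultimately show ?thesis by (simp only: \<psi>_def cayley_re_def)
    qed
    ultimately show ?thesis by simp
  qed
  then have "(\<lambda>m. ennreal (pi * (X m * cayley_re a n (of_real (X m))))) \<longlonglongrightarrow> ennreal (pi * (2 * a * real n))"
    by (rule tendsto_ennrealI[OF tendsto_mult_left])
  ultimately show ?thesis using LIMSEQ_unique by (force simp: mult_ac)
qed

text \<open>With \<open>e = a / (n * y)\<close> the base is
  \<open>(1 + \<i> * e) / (1 - \<i> * e)\<close>, which agrees with
  \<open>exp (2 * \<i> * e)\<close> to first order. Both have modulus \<open>1\<close>, so their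
  \<open>n\<close>-th powers differ by at most \<open>n * norm (f e)\<close>, a fixed multiple of
  \<open>norm (f e / e)\<close>.\<close>

lemma cayley_re_scaled_tendsto:
  assumes y: "y \<noteq> 0"
  shows "(\<lambda>n. cayley_re a n (\<i> * of_real (real n * y))) \<longlonglongrightarrow> 1 - cos (2 * a / y)"
proof -
  define f where "f e = (1 + \<i> * e) / (1 - \<i> * e) - exp (2 * \<i> * e)" for e :: complex
  have "(f has_field_derivative 0) (at 0)"
    unfolding f_def by (auto intro!: derivative_eq_intros)
  then have f: "((\<lambda>e. f e / e) \<longlongrightarrow> 0) (at 0)"
    by (simp add: has_field_derivative_iff f_def)
  define e where "e n = complex_of_real (a / (real n * y))" for n
  have e_lim: "filterlim e (at 0) sequentially"
  proof -
    have "(\<lambda>n. of_real (a / y * inverse (real n))) \<longlonglongrightarrow> complex_of_real 0"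
      by (intro tendsto_of_real tendsto_mult_right_zero lim_inverse_n)
    then have "e \<longlonglongrightarrow> 0" by (simp add: e_def[abs_def] field_simps)
    moreover have "eventually (\<lambda>n. e n \<noteq> 0) sequentially"
      using eventually_gt_at_top[of 0] by eventually_elim (use a y in \<open>auto simp: e_def\<close>)
    ultimately show ?thesis by (simp add: filterlim_at)
  qed
  have "(\<lambda>n. norm (a / y) * norm (f (e n) / e n)) \<longlonglongrightarrow> norm (a / y) * norm (0 :: complex)"
    by (intro tendsto_intros filterlim_compose[OF f e_lim])
  then have lim0: "(\<lambda>n. norm (a / y) * norm (f (e n) / e n)) \<longlonglongrightarrow> 0" by simp
  have "(\<lambda>n. cayley a (\<i> * of_real (real n * y)) ^ n - exp (\<i> * of_real (2 * a / y))) \<longlonglongrightarrow> 0"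
  proof (rule Lim_null_comparison[OF _ lim0])
    show "eventually (\<lambda>n. norm (cayley a (\<i> * of_real (real n * y)) ^ n - exp (\<i> * of_real (2 * a / y))) \<le>
        norm (a / y) * norm (f (e n) / e n)) sequentially"
      using eventually_gt_at_top[of 0]
    proof eventually_elim
      case (elim n)
      define q where "q = cayley a (\<i> * of_real (real n * y))"
      define E where "E = exp (2 * \<i> * e n)"
      have E: "E = exp (\<i> * of_real (2 * (a / (real n * y))))" by (simp add: E_def e_def mult_ac)
      have nE: "norm E = 1" unfolding E by (simp add: norm_exp_i_times)
      have En: "E ^ n = exp (\<i> * of_real (2 * a / y))"
        unfolding E exp_of_nat_mult[symmetric] using elim y by (simp add: field_simps)
      have nq: "norm q = 1" unfolding q_def by (rule norm_cayley_axis)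
      have "q = (1 + \<i> * e n) / (1 - \<i> * e n)"
      proof -
        define w where "w = \<i> * complex_of_real (real n * y)"
        have w: "w \<noteq> 0" using elim y by (simp add: w_def)
        have ew: "\<i> * e n * w = - of_real a" using elim y by (simp add: e_def w_def field_simps)
        have "1 - \<i> * e n \<noteq> 0"
        proof
          assume "1 - \<i> * e n = 0"
          then have "(1 - \<i> * e n) * w = 0" by simp
          then have "w + of_real a = 0" by (simp add: left_diff_distrib ew)
          then show False using cayley_denom_nonzero[of w] by (simp add: w_def)
        qed
        then have "(1 + \<i> * e n) / (1 - \<i> * e n) = ((1 + \<i> * e n) * w) / ((1 - \<i> * e n) * w)"
          using w by simp
        also have "\<dots> = (w - of_real a) / (w + of_real a)"
          by (simp add: left_diff_distrib distrib_right ew)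
        finally show ?thesis by (simp add: q_def cayley_def w_def)
      qed
      then have "q - E = f (e n)" by (simp add: f_def E_def)
      moreover have "norm (q ^ n - E ^ n) \<le> real n * norm (q - E)"
        using norm_power_diff[of q E n] nq nE by simp
      moreover have "real n * norm (f (e n)) = norm (a / y) * norm (f (e n) / e n)"
      proof -
        have "norm (e n) = a / (real n * \<bar>y\<bar>)" using a by (simp add: e_def norm_divide norm_mult)
        then show ?thesis using elim a y by (simp add: norm_divide)
      qed
      ultimately show ?case by (simp add: q_def En)
    qed
  qed
  from tendsto_Re[OF tendsto_add[OF this tendsto_const[of "exp (\<i> * of_real (2 * a / y))"]]]
  have "(\<lambda>n. Re (cayley a (\<i> * of_real (real n * y)) ^ n)) \<longlonglongrightarrow> cos (2 * a / y)"
    by (simp add: Re_exp)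
  then show ?thesis unfolding cayley_re_def by (intro tendsto_intros)
qed

end

section \<open>Cosine integrals\<close>

text \<open>The map \<open>u \<mapsto> - 1 / u\<close> is increasing; composed with the reflection
  \<open>y \<mapsto> - y\<close> it gives inversion by an orientation-preserving substitution. The
  exhausting intervals \<open>J N\<close> are invariant under inversion.\<close>

lemma nn_integral_inverse_substitution:
  fixes \<phi> :: "real \<Rightarrow> real"
  assumes [measurable]: "\<phi> \<in> borel_measurable borel"
  shows "(\<integral>\<^sup>+y\<in>{0<..}. ennreal (\<phi> y) \<partial>lborel) = (\<integral>\<^sup>+u\<in>{0<..}. ennreal (\<phi> (1 / u) / u\<^sup>2) \<partial>lborel)"
proof -
  define I J where "I N = {- real (Suc N)..- (1 / real (Suc N))}" and "J N = {1 / real (Suc N)..real (Suc N)}" for N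
  have [measurable]: "I N \<in> sets borel" "J N \<in> sets borel" for N by (auto simp: I_def J_def)
  have mono: "1 / real (Suc (Suc N)) \<le> 1 / real (Suc N)" for N by (intro divide_left_mono) auto
  have ind: "eventually (\<lambda>N. y \<in> J N) sequentially" if "y > 0" for y :: real
  proof -
    obtain M :: nat where M: "real M \<ge> max y (1 / y)" using real_arch_simple by blast
    show ?thesis using eventually_ge_at_top[of M]
    proof eventually_elim
      case (elim N)
      then have "real (Suc N) \<ge> y" "real (Suc N) \<ge> 1 / y" using M by auto
      then show ?case using that unfolding J_def by (simp add: field_simps del: of_nat_Suc)
    qed
  qed
  have lim: "(\<lambda>N. ennreal (f y) * indicator (J N) y) \<longlonglongrightarrow> ennreal (f y) * indicator {0<..} y" for f and y :: real
  proof (rule tendsto_eventually, cases "y > 0")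
    case True
    show "eventually (\<lambda>N. ennreal (f y) * indicator (J N) y = ennreal (f y) * indicator {0<..} y) sequentially"
      using ind[OF True] by eventually_elim (use True in simp)
  next
    case False
    have "y \<notin> J N" for N
    proof
      assume "y \<in> J N"
      then have "1 / real (Suc N) \<le> y" by (simp add: J_def)
      moreover have "1 / real (Suc N) > 0" by simp
      ultimately show False using False by linarith
    qed
    then show "eventually (\<lambda>N. ennreal (f y) * indicator (J N) y = ennreal (f y) * indicator {0<..} y) sequentially"
      using False by simp
  qed
  have inc: "incseq (\<lambda>N y. ennreal (f y) * indicator (J N) y)" for f :: "real \<Rightarrow> real"
  proof (intro incseq_SucI le_funI mult_left_mono)
    fix N and y :: real
    show "indicator (J N) y \<le> (indicator (J (Suc N)) y :: ennreal)"
      using mono[of N] by (auto simp: J_def split: split_indicator)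
  qed simp
  have mconv: "(\<lambda>N. \<integral>\<^sup>+y\<in>J N. ennreal (f y) \<partial>lborel) \<longlonglongrightarrow> (\<integral>\<^sup>+y\<in>{0<..}. ennreal (f y) \<partial>lborel)"
    if [measurable]: "f \<in> borel_measurable borel" for f :: "real \<Rightarrow> real"
    by (rule nn_integral_LIMSEQ[OF inc _ lim]) auto
  have "(\<integral>\<^sup>+y\<in>J N. ennreal (\<phi> y) \<partial>lborel) = (\<integral>\<^sup>+u\<in>J N. ennreal (\<phi> (1 / u) / u\<^sup>2) \<partial>lborel)" for N
  proof -
    have "(\<integral>\<^sup>+y\<in>J N. ennreal (\<phi> y) \<partial>lborel) = (\<integral>\<^sup>+y. ennreal (\<phi> (- y)) * indicator (J N) (- y) \<partial>lborel)"
      by (subst nn_integral_real_affine[where c = "-1" and t = 0]) auto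
    also have "\<dots> = (\<integral>\<^sup>+y. ennreal (\<phi> (- y) * indicator {- 1 / (1 / real (Suc N))..- 1 / real (Suc N)} y) \<partial>lborel)"
      by (intro nn_integral_cong) (auto simp: J_def split: split_indicator)
    also have "\<dots> = (\<integral>\<^sup>+u. ennreal (\<phi> (- (- 1 / u)) * (1 / u\<^sup>2) * indicator {1 / real (Suc N)..real (Suc N)} u) \<partial>lborel)"
    proof (rule nn_integral_substitution)
      have pos: "x > 0" if "x \<in> {1 / real (Suc N)..real (Suc N)}" for x
      proof -
        have "1 / real (Suc N) > 0" by simp
        then show ?thesis using that by (meson atLeastAtMost_iff less_le_trans)
      qed
      show "((\<lambda>u. - 1 / u) has_real_derivative 1 / x\<^sup>2) (at x)" if "x \<in> {1 / real (Suc N)..real (Suc N)}" for x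
        using pos[OF that] by (auto intro!: derivative_eq_intros simp: power2_eq_square)
      show "continuous_on {1 / real (Suc N)..real (Suc N)} (\<lambda>x. 1 / x\<^sup>2)"
        using pos by (intro continuous_intros) force
      have "1 / real (Suc N) \<le> 1" "1 \<le> real (Suc N)" by simp_all
      then show "1 / real (Suc N) \<le> real (Suc N)" by linarith
    qed (auto simp: set_borel_measurable_def)
    also have "\<dots> = (\<integral>\<^sup>+u\<in>J N. ennreal (\<phi> (1 / u) / u\<^sup>2) \<partial>lborel)"
      by (intro nn_integral_cong) (auto simp: J_def split: split_indicator)
    finally show ?thesis .
  qed
  then show ?thesis
    using mconv[of \<phi>] mconv[of "\<lambda>u. \<phi> (1 / u) / u\<^sup>2"] LIMSEQ_unique by simp
qed

lemma nn_integral_exp_one_minus_cos: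
  fixes v :: real
  assumes v: "v > 0"
  shows "(\<integral>\<^sup>+u\<in>{0<..}. ennreal ((1 - cos u) * exp (- v * u)) \<partial>lborel) = ennreal (1 / (v * (v\<^sup>2 + 1)))"
proof -
  define F where "F u = - exp (- v * u) / v + exp (- v * u) * (v * cos u - sin u) / (v\<^sup>2 + 1)" for u
  have v1: "v\<^sup>2 + 1 > 0" by (simp add: add_nonneg_pos)
  have "(\<integral>\<^sup>+u\<in>{0..}. ennreal ((1 - cos u) * exp (- v * u)) \<partial>lborel) = ennreal (0 - F 0)"
  proof (rule nn_integral_FTC_atLeast)
    fix u :: real
    show "(F has_real_derivative (1 - cos u) * exp (- v * u)) (at u)"
    proof -
      have e: "((\<lambda>u. exp (- v * u)) has_real_derivative - v * exp (- v * u)) (at u)"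
        by (auto intro!: derivative_eq_intros)
      have t: "((\<lambda>u. v * cos u - sin u) has_real_derivative - v * sin u - cos u) (at u)"
        by (auto intro!: derivative_eq_intros)
      have "(F has_real_derivative (- (- v * exp (- v * u)) / v +
          (- v * exp (- v * u) * (v * cos u - sin u) + (- v * sin u - cos u) * exp (- v * u)) / (v\<^sup>2 + 1))) (at u)"
        unfolding F_def by (intro DERIV_add DERIV_cdivide DERIV_minus DERIV_mult e t)
      also have "- (- v * exp (- v * u)) / v +
          (- v * exp (- v * u) * (v * cos u - sin u) + (- v * sin u - cos u) * exp (- v * u)) / (v\<^sup>2 + 1) =
          exp (- v * u) + (exp (- v * u) * (- v) * (v * cos u - sin u) + exp (- v * u) * (- v * sin u - cos u)) / (v\<^sup>2 + 1)"
        using v by (simp add: mult_ac)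
      also have "exp (- v * u) + (exp (- v * u) * (- v) * (v * cos u - sin u) + exp (- v * u) * (- v * sin u - cos u)) / (v\<^sup>2 + 1)
          = (1 - cos u) * exp (- v * u)"
      proof -
        have "exp (- v * u) * (- v) * (v * cos u - sin u) + exp (- v * u) * (- v * sin u - cos u) =
            - (exp (- v * u) * cos u) * (v\<^sup>2 + 1)"
          by (simp add: power2_eq_square algebra_simps)
        then have "(exp (- v * u) * (- v) * (v * cos u - sin u) + exp (- v * u) * (- v * sin u - cos u)) / (v\<^sup>2 + 1) =
            - (exp (- v * u) * cos u)"
          using v1 by (simp only:) simp
        then show ?thesis by (simp only:) (simp add: algebra_simps)
      qed
      finally show ?thesis .
    qed
    show "(F \<longlongrightarrow> 0) at_top"
    proof (rule Lim_null_comparison)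
      show "eventually (\<lambda>u. norm (F u) \<le> (1 / v + (v + 1) / (v\<^sup>2 + 1)) * exp (- v * u)) at_top"
      proof (rule always_eventually, intro allI)
        fix u
        have "\<bar>v * cos u - sin u\<bar> \<le> \<bar>v * cos u\<bar> + \<bar>sin u\<bar>" by (rule abs_triangle_ineq4)
        also have "\<dots> \<le> v * 1 + 1" using v by (intro add_mono) (auto simp: abs_mult)
        finally have b: "\<bar>v * cos u - sin u\<bar> \<le> v + 1" by simp
        have "\<bar>F u\<bar> \<le> \<bar>- exp (- v * u) / v\<bar> + \<bar>exp (- v * u) * (v * cos u - sin u) / (v\<^sup>2 + 1)\<bar>"
          unfolding F_def by (rule abs_triangle_ineq)
        also have "\<dots> = exp (- v * u) / v + exp (- v * u) * \<bar>v * cos u - sin u\<bar> / (v\<^sup>2 + 1)"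
          using v v1 by (simp add: abs_mult)
        also have "\<dots> \<le> exp (- v * u) / v + exp (- v * u) * (v + 1) / (v\<^sup>2 + 1)"
          using b v1 by (intro add_left_mono divide_right_mono mult_left_mono) auto
        also have "\<dots> = (1 / v + (v + 1) / (v\<^sup>2 + 1)) * exp (- v * u)" by (simp add: algebra_simps)
        finally show "norm (F u) \<le> (1 / v + (v + 1) / (v\<^sup>2 + 1)) * exp (- v * u)" by simp
      qed
      have "filterlim (\<lambda>u. v * u) at_top at_top"
        by (intro filterlim_tendsto_pos_mult_at_top[OF tendsto_const v] filterlim_ident)
      then have "((\<lambda>u. exp (- v * u)) \<longlongrightarrow> 0) at_top"
        by (intro filterlim_compose[OF exp_at_bot]) (simp add: filterlim_uminus_at_bot)
      then show "((\<lambda>u. (1 / v + (v + 1) / (v\<^sup>2 + 1)) * exp (- v * u)) \<longlongrightarrow> 0) at_top"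
        by (rule tendsto_mult_right_zero)
    qed
  qed auto
  also have "0 - F 0 = 1 / (v * (v\<^sup>2 + 1))"
    using v v1 by (simp add: F_def field_simps power2_eq_square)
  also have "(\<integral>\<^sup>+u\<in>{0..}. ennreal ((1 - cos u) * exp (- v * u)) \<partial>lborel) =
      (\<integral>\<^sup>+u\<in>{0<..}. ennreal ((1 - cos u) * exp (- v * u)) \<partial>lborel)"
    by (intro nn_integral_cong) (auto split: split_indicator simp: less_le)
  finally show ?thesis .
qed

text \<open>\<open>Gamma (w / 2) * Gamma (1 - w / 2)\<close> is
  \<open>pi / sin (pi * w / 2)\<close>. In this form the value of the integral of
  \<open>(1 - cos u) * u powr (- 1 - w)\<close> is regular throughout \<open>0 < w < 2\<close>,
  including the point \<open>1\<close> of interest.\<close>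

definition cos_mellin :: "real \<Rightarrow> real" where
  "cos_mellin w = Gamma (w / 2) * Gamma (1 - w / 2) / (2 * Gamma (1 + w))"

text \<open>The power of \<open>u\<close> is written as a Gamma integral of
  \<open>exp (- u * v)\<close>; the Laplace transform of \<open>1 - cos\<close> then leaves the
  kernel \<open>2 * v / (v\<^sup>2 + 1)\<close>, whose Mellin transform is known from the functional
  equation.\<close>

lemma nn_integral_cos_mellin:
  fixes w :: real
  assumes w: "0 < w" "w < 2"
  shows "(\<integral>\<^sup>+u\<in>{0<..}. ennreal ((1 - cos u) * u powr (- 1 - w)) \<partial>lborel) = ennreal (cos_mellin w)"
proof -
  define \<Gamma> where "\<Gamma> = Gamma (1 + w)"
  have G: "\<Gamma> > 0" unfolding \<Gamma>_def using w by (intro Gamma_real_pos) auto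
  have "(\<integral>\<^sup>+u\<in>{0<..}. ennreal ((1 - cos u) * u powr (- 1 - w)) \<partial>lborel) =
     (\<integral>\<^sup>+u\<in>{0<..}. (\<integral>\<^sup>+v\<in>{0<..}. ennreal ((1 - cos u) / \<Gamma> * (v powr w * exp (- u * v))) \<partial>lborel) \<partial>lborel)"
  proof (intro nn_integral_cong)
    fix u :: real
    have "(\<integral>\<^sup>+v\<in>{0<..}. ennreal ((1 - cos u) / \<Gamma> * (v powr w * exp (- u * v))) \<partial>lborel) = ennreal ((1 - cos u) * u powr (- 1 - w))"
      if u: "u > 0"
    proof -
      have "(\<integral>\<^sup>+v\<in>{0<..}. ennreal ((1 - cos u) / \<Gamma> * (v powr w * exp (- u * v))) \<partial>lborel) =
          (\<integral>\<^sup>+v. ennreal ((1 - cos u) / \<Gamma>) * (ennreal (v powr ((1 + w) - 1) * exp (- u * v)) * indicator {0<..} v) \<partial>lborel)"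
        using G by (intro nn_integral_cong) (auto simp: ennreal_mult'[symmetric] split: split_indicator)
      also have "\<dots> = ennreal ((1 - cos u) / \<Gamma>) * ennreal (Gamma (1 + w) * u powr (- (1 + w)))"
        using nn_integral_Gamma[of "1 + w" u] u w by (subst nn_integral_cmult) auto
      also have "\<dots> = ennreal ((1 - cos u) * u powr (- 1 - w))"
        using G by (simp add: ennreal_mult'[symmetric] \<Gamma>_def[symmetric])
      finally show ?thesis .
    qed
    then show "ennreal ((1 - cos u) * u powr (- 1 - w)) * indicator {0<..} u =
       (\<integral>\<^sup>+v\<in>{0<..}. ennreal ((1 - cos u) / \<Gamma> * (v powr w * exp (- u * v))) \<partial>lborel) * indicator {0<..} u"
      by (auto split: split_indicator)
  qed
  also have "\<dots> = (\<integral>\<^sup>+v\<in>{0<..}. (\<integral>\<^sup>+u\<in>{0<..}. ennreal ((1 - cos u) / \<Gamma> * (v powr w * exp (- u * v))) \<partial>lborel) \<partial>lborel)"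
    by (rule nn_integral_set_swap) auto
  also have "\<dots> = (\<integral>\<^sup>+v. ennreal (1 / (2 * \<Gamma>)) * (ennreal (v powr ((w - 1) - 1) * (2 * v / (v\<^sup>2 + 1\<^sup>2))) * indicator {0<..} v) \<partial>lborel)"
  proof (intro nn_integral_cong)
    fix v :: real
    have "(\<integral>\<^sup>+u\<in>{0<..}. ennreal ((1 - cos u) / \<Gamma> * (v powr w * exp (- u * v))) \<partial>lborel) =
       ennreal (1 / (2 * \<Gamma>)) * ennreal (v powr ((w - 1) - 1) * (2 * v / (v\<^sup>2 + 1\<^sup>2)))" if v: "v > 0"
    proof -
      have "(\<integral>\<^sup>+u\<in>{0<..}. ennreal ((1 - cos u) / \<Gamma> * (v powr w * exp (- u * v))) \<partial>lborel) =
         (\<integral>\<^sup>+u. ennreal (v powr w / \<Gamma>) * (ennreal ((1 - cos u) * exp (- v * u)) * indicator {0<..} u) \<partial>lborel)"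
        using G by (intro nn_integral_cong) (auto simp: ennreal_mult'[symmetric] mult_ac split: split_indicator)
      also have "\<dots> = ennreal (v powr w / \<Gamma>) * ennreal (1 / (v * (v\<^sup>2 + 1)))"
        using nn_integral_exp_one_minus_cos[OF v] by (subst nn_integral_cmult) auto
      also have "\<dots> = ennreal (v powr w / \<Gamma> * (1 / (v * (v\<^sup>2 + 1))))"
        using G by (simp add: ennreal_mult'[symmetric])
      also have "v powr w / \<Gamma> * (1 / (v * (v\<^sup>2 + 1))) = 1 / (2 * \<Gamma>) * (v powr ((w - 1) - 1) * (2 * v / (v\<^sup>2 + 1\<^sup>2)))"
      proof -
        have "v powr ((w - 1) - 1) = v powr w / (v * v)"
          using v by (simp add: powr_diff power2_eq_square)
        then show ?thesis using v G by simp
      qed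
      finally show ?thesis using G by (simp only: ennreal_mult'[symmetric] zero_le_divide_1_iff)
    qed
    then show "(\<integral>\<^sup>+u\<in>{0<..}. ennreal ((1 - cos u) / \<Gamma> * (v powr w * exp (- u * v))) \<partial>lborel) * indicator {0<..} v =
       ennreal (1 / (2 * \<Gamma>)) * (ennreal (v powr ((w - 1) - 1) * (2 * v / (v\<^sup>2 + 1\<^sup>2))) * indicator {0<..} v)"
      by (auto split: split_indicator)
  qed
  also have "\<dots> = ennreal (1 / (2 * \<Gamma>)) * ennreal (Gamma ((1 + (w - 1)) / 2) * Gamma ((1 - (w - 1)) / 2) * 1 powr ((w - 1) - 1))"
    using nn_integral_Mellin_kernel[of "w - 1" 1] w by (subst nn_integral_cmult) auto
  also have "\<dots> = ennreal (cos_mellin w)"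
    using G by (simp add: ennreal_mult'[symmetric] cos_mellin_def \<Gamma>_def field_simps)
  finally show ?thesis .
qed

text \<open>Inversion \<open>u = 1 / y\<close>, then scaling by \<open>c\<close>. Exponents on both
  sides of \<open>0\<close> are covered, as differentiation at \<open>0\<close> requires.\<close>

lemma nn_integral_cos_powr:
  fixes c h :: real
  assumes c: "c > 0" and h: "-1 < h" "h < 1"
  shows "(\<integral>\<^sup>+y\<in>{0<..}. ennreal ((1 - cos (c / y)) * y powr h) \<partial>lborel) = ennreal (c powr (1 + h) * cos_mellin (1 + h))"
proof -
  have "(\<integral>\<^sup>+y\<in>{0<..}. ennreal ((1 - cos (c / y)) * y powr h) \<partial>lborel) =
      (\<integral>\<^sup>+u\<in>{0<..}. ennreal ((1 - cos (c / (1 / u))) * (1 / u) powr h / u\<^sup>2) \<partial>lborel)"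
    by (rule nn_integral_inverse_substitution) measurable
  also have "\<dots> = (\<integral>\<^sup>+u\<in>{0<..}. ennreal ((1 - cos (c * u)) * u powr (- 2 - h)) \<partial>lborel)"
  proof (intro nn_integral_cong)
    fix u :: real
    have eq: "(1 / u) powr h / u\<^sup>2 = u powr (- 2 - h)" if "u > 0"
    proof -
      have "(1 / u) powr h = 1 / u powr h" using that powr_divide[of 1 u h] by simp
      moreover have "u powr (- 2 - h) = u powr (- 2) / u powr h" by (simp add: powr_diff)
      moreover have "u powr (- 2) = 1 / u\<^sup>2" using that by (simp add: powr_minus_divide)
      ultimately show ?thesis by simp
    qed
    have "(1 - cos (c / (1 / u))) * (1 / u) powr h / u\<^sup>2 = (1 - cos (c * u)) * u powr (- 2 - h)" if "u > 0"
      unfolding eq[OF that, symmetric] by simp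
    then show "ennreal ((1 - cos (c / (1 / u))) * (1 / u) powr h / u\<^sup>2) * indicator {0<..} u =
       ennreal ((1 - cos (c * u)) * u powr (- 2 - h)) * indicator {0<..} u"
      by (cases "u > 0") simp_all
  qed
  also have "\<dots> = ennreal (1 / c) * (\<integral>\<^sup>+u. ennreal ((1 - cos (c * (u / c))) * (u / c) powr (- 2 - h)) * indicator {0<..} (u / c) \<partial>lborel)"
    using c by (subst nn_integral_real_affine[where c = "1 / c" and t = 0]) auto
  also have "\<dots> = ennreal (1 / c) * (\<integral>\<^sup>+u. ennreal (c powr (2 + h)) * (ennreal ((1 - cos u) * u powr (- 1 - (1 + h))) * indicator {0<..} u) \<partial>lborel)"
  proof (rule arg_cong2[where f = "(*)", OF refl], rule nn_integral_cong)
    fix u :: real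
    have "(u / c) powr (- 2 - h) = c powr (2 + h) * u powr (- 1 - (1 + h))" if "u > 0"
    proof -
      have "(u / c) powr (- 2 - h) = u powr (- 2 - h) / c powr (- 2 - h)" using that c by (simp add: powr_divide)
      also have "c powr (- 2 - h) = 1 / c powr (2 + h)" using powr_minus_divide[of c "2 + h"] by simp
      finally show ?thesis by simp
    qed
    then show "ennreal ((1 - cos (c * (u / c))) * (u / c) powr (- 2 - h)) * indicator {0<..} (u / c) =
       ennreal (c powr (2 + h)) * (ennreal ((1 - cos u) * u powr (- 1 - (1 + h))) * indicator {0<..} u)"
      using c by (auto split: split_indicator simp: zero_less_divide_iff ennreal_mult'[symmetric] mult_ac)
  qed
  also have "\<dots> = ennreal (1 / c) * (ennreal (c powr (2 + h)) * ennreal (cos_mellin (1 + h)))"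
    using nn_integral_cos_mellin[of "1 + h"] h by (subst nn_integral_cmult) auto
  also have "\<dots> = ennreal (1 / c * (c powr (2 + h) * cos_mellin (1 + h)))"
    using c by (simp add: ennreal_mult'[symmetric])
  also have "1 / c * (c powr (2 + h) * cos_mellin (1 + h)) = c powr (1 + h) * cos_mellin (1 + h)"
  proof -
    have "c powr (2 + h) = c * c powr (1 + h)" using c powr_add[of c 1 "1 + h"] by simp
    then show ?thesis using c by simp
  qed
  finally show ?thesis .
qed

lemma abs_ln_le_powr:
  fixes y :: real
  assumes "y > 0"
  shows "\<bar>ln y\<bar> \<le> 2 * (y powr (1 / 2) + y powr (- (1 / 2)))"
proof -
  have "ln (y powr (1 / 2)) \<le> y powr (1 / 2) - 1" "ln (y powr (- (1 / 2))) \<le> y powr (- (1 / 2)) - 1"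
    using assms by (intro ln_le_minus_one; simp)+
  then have "ln y \<le> 2 * (y powr (1 / 2) - 1)" "- ln y \<le> 2 * (y powr (- (1 / 2)) - 1)"
    using assms by (auto simp: ln_powr)
  moreover have "\<bar>l\<bar> \<le> 2 * (A + B)" if "l \<le> 2 * (A - 1)" "- l \<le> 2 * (B - 1)" "A \<ge> 0" "B \<ge> 0" for l A B :: real
    using that by (smt (verit))
  ultimately show ?thesis by simp
qed

lemma has_bochner_integral_cos_powr:
  fixes c h :: real
  assumes c: "c > 0" and h: "-1 < h" "h < 1"
  shows "has_bochner_integral lborel (\<lambda>y. indicator {0<..} y * ((1 - cos (c / y)) * y powr h))
    (c powr (1 + h) * cos_mellin (1 + h))"
proof (rule has_bochner_integral_nn_integral)
  have "(\<integral>\<^sup>+y. ennreal (indicator {0<..} y * ((1 - cos (c / y)) * y powr h)) \<partial>lborel) =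
      (\<integral>\<^sup>+y\<in>{0<..}. ennreal ((1 - cos (c / y)) * y powr h) \<partial>lborel)"
    by (intro nn_integral_cong) (auto split: split_indicator)
  then show "(\<integral>\<^sup>+y. ennreal (indicator {0<..} y * ((1 - cos (c / y)) * y powr h)) \<partial>lborel) =
      ennreal (c powr (1 + h) * cos_mellin (1 + h))"
    using nn_integral_cos_powr[OF assms] by simp
  show "0 \<le> c powr (1 + h) * cos_mellin (1 + h)"
    unfolding cos_mellin_def using h by (auto intro!: mult_nonneg_nonneg divide_nonneg_pos mult_pos_pos Gamma_real_pos less_imp_le[OF Gamma_real_pos])
qed (auto intro!: AE_I2 split: split_indicator)

lemma Gamma_2: "Gamma 2 = (1 :: real)"
  using Gamma_numeral[of "num.Bit0 num.One"] by simp

lemma cos_mellin_1: "cos_mellin 1 = pi / 2"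
  by (simp add: cos_mellin_def Gamma_one_half_real Gamma_2)

text \<open>Source of Euler's constant: the Digamma contributions of the two numerator factors
  cancel at \<open>1\<close>, and the denominator leaves
  \<open>- Digamma 2 = euler_mascheroni - 1\<close>.\<close>

lemma deriv_cos_mellin_1: "(cos_mellin has_real_derivative pi / 2 * (euler_mascheroni - 1)) (at 1)"
proof -
  have "(cos_mellin has_real_derivative
     ((Gamma (1/2) * Digamma (1/2) * (1/2) * Gamma (1/2) + Gamma (1/2) * Digamma (1/2) * (- (1/2)) * Gamma (1/2)) * (2 * Gamma 2)
       - Gamma (1/2) * Gamma (1/2) * (2 * (Gamma 2 * Digamma 2))) / (2 * Gamma 2 * (2 * Gamma 2))) (at 1)"
    unfolding cos_mellin_def
    by (auto intro!: derivative_eq_intros elim!: nonpos_Ints_cases' simp: Gamma_eq_zero_iff)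
  moreover have D2: "Digamma 2 = (1 - euler_mascheroni :: real)"
    using Digamma_plus1[of "1::real"] by simp
  ultimately show ?thesis
    by (elim DERIV_cong) (simp only: D2 Gamma_2 Gamma_one_half_real, simp add: field_simps)
qed

text \<open>Differentiation of the power integral under the integral sign at exponent \<open>0\<close>, by
  squeezing \<open>ln y\<close> between the difference quotients \<open>(y powr h - 1) / h\<close> for \<open>h\<close> of either sign.\<close>

lemma has_bochner_integral_cos_ln:
  fixes c :: real
  assumes c: "c > 0"
  shows "has_bochner_integral lborel (\<lambda>y. indicator {0<..} y * ((1 - cos (c / y)) * ln y))
    (pi * c / 2 * (ln c + euler_mascheroni - 1))"
proof -
  let ?k = "\<lambda>y. indicator {0<..} y * ((1 - cos (c / y)) * ln y)"
  define P where "P h y = indicator {0<..} y * ((1 - cos (c / y)) * y powr h)" for h y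
  define \<Psi> where "\<Psi> h = c powr (1 + h) * cos_mellin (1 + h)" for h
  have p: "integrable lborel (P h)" "integral\<^sup>L lborel (P h) = \<Psi> h" if "-1 < h" "h < 1" for h
    using has_bochner_integral_cos_powr[OF c that] by (auto simp: has_bochner_integral_iff \<Psi>_def P_def[abs_def])
  have int: "integrable lborel ?k"
  proof (rule Bochner_Integration.integrable_bound)
    show "integrable lborel (\<lambda>y. 2 * (P (1/2) y + P (- (1/2)) y))"
      by (intro integrable_mult_right Bochner_Integration.integrable_add p) auto
    show "AE y in lborel. norm (?k y) \<le> norm (2 * (P (1/2) y + P (- (1/2)) y))"
    proof (rule AE_I2)
      fix y :: real
      show "norm (?k y) \<le> norm (2 * (P (1/2) y + P (- (1/2)) y))"
      proof (cases "y > 0")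
        case True
        have "(1 - cos (c / y)) * \<bar>ln y\<bar> \<le> (1 - cos (c / y)) * (2 * (y powr (1 / 2) + y powr (- (1 / 2))))"
          by (intro mult_left_mono abs_ln_le_powr[OF True]) auto
        moreover have "norm (?k y) = (1 - cos (c / y)) * \<bar>ln y\<bar>" using True by (simp add: abs_mult)
        moreover have "2 * (P (1/2) y + P (- (1/2)) y) = (1 - cos (c / y)) * (2 * (y powr (1 / 2) + y powr (- (1 / 2))))"
          using True by (simp add: P_def algebra_simps)
        ultimately show ?thesis unfolding real_norm_def using abs_ge_self order_trans by metis
      qed (simp add: P_def)
    qed
  qed measurable
  define I where "I = integral\<^sup>L lborel ?k"
  have upper: "I \<le> (\<Psi> h - \<Psi> 0) / h" if h: "0 < h" "h < 1" for h
  proof -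
    have "I \<le> integral\<^sup>L lborel (\<lambda>y. (P h y - P 0 y) / h)"
      unfolding I_def
    proof (rule integral_mono[OF int])
      show "integrable lborel (\<lambda>y. (P h y - P 0 y) / h)"
        using h by (intro integrable_divide Bochner_Integration.integrable_diff p) auto
      fix y :: real
      show "?k y \<le> (P h y - P 0 y) / h"
      proof (cases "y > 0")
        case True
        have "ln (y powr h) \<le> y powr h - 1" using True by (intro ln_le_minus_one) auto
        then have "ln y \<le> (y powr h - 1) / h" using h True by (simp add: ln_powr field_simps)
        then have "(1 - cos (c / y)) * ln y \<le> (1 - cos (c / y)) * ((y powr h - 1) / h)" by (intro mult_left_mono) auto
        then show ?thesis using True by (simp add: P_def algebra_simps)
      qed (simp add: P_def)
    qed
    also have "\<dots> = (\<Psi> h - \<Psi> 0) / h"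
      using h by (simp add: p Bochner_Integration.integral_diff)
    finally show ?thesis .
  qed
  have lower: "(\<Psi> h - \<Psi> 0) / h \<le> I" if h: "-1 < h" "h < 0" for h
  proof -
    have "integral\<^sup>L lborel (\<lambda>y. (P h y - P 0 y) / h) \<le> I"
      unfolding I_def
    proof (rule integral_mono[OF _ int])
      show "integrable lborel (\<lambda>y. (P h y - P 0 y) / h)"
        using h by (intro integrable_divide Bochner_Integration.integrable_diff p) auto
      fix y :: real
      show "(P h y - P 0 y) / h \<le> ?k y"
      proof (cases "y > 0")
        case True
        have "ln (y powr h) \<le> y powr h - 1" using True by (intro ln_le_minus_one) auto
        then have "(y powr h - 1) / h \<le> ln y" using h True by (simp add: ln_powr field_simps)
        then have "(1 - cos (c / y)) * ((y powr h - 1) / h) \<le> (1 - cos (c / y)) * ln y" by (intro mult_left_mono) auto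
        then show ?thesis using True by (simp add: P_def algebra_simps)
      qed (simp add: P_def)
    qed
    moreover have "integral\<^sup>L lborel (\<lambda>y. (P h y - P 0 y) / h) = (\<Psi> h - \<Psi> 0) / h"
      using h by (simp add: p Bochner_Integration.integral_diff)
    ultimately show ?thesis by (simp only:)
  qed
  have d\<Psi>: "(\<Psi> has_real_derivative pi * c / 2 * (ln c + euler_mascheroni - 1)) (at 0)"
  proof -
    have d1: "((\<lambda>h. 1 + h) has_real_derivative 1) (at (0::real))" by (auto intro!: derivative_eq_intros)
    have d2: "(cos_mellin has_real_derivative pi / 2 * (euler_mascheroni - 1)) (at (1 + 0))"
      using deriv_cos_mellin_1 by simp
    have "((\<lambda>h. cos_mellin (1 + h)) has_real_derivative pi / 2 * (euler_mascheroni - 1) * 1) (at 0)"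
      by (rule DERIV_chain2[where f = cos_mellin and g = "\<lambda>h. 1 + h", OF d2 d1])
    moreover have "((\<lambda>h. c powr (1 + h)) has_real_derivative c * ln c) (at 0)"
      using c by (auto intro!: derivative_eq_intros)
    ultimately have "(\<Psi> has_real_derivative (c * ln c) * cos_mellin (1 + 0) + pi / 2 * (euler_mascheroni - 1) * 1 * c powr (1 + 0)) (at 0)"
      unfolding \<Psi>_def by (intro DERIV_mult)
    then show ?thesis
      by (rule DERIV_cong) (use c in \<open>simp add: cos_mellin_1 field_simps\<close>)
  qed
  then have lim: "((\<lambda>h. (\<Psi> h - \<Psi> 0) / h) \<longlongrightarrow> pi * c / 2 * (ln c + euler_mascheroni - 1)) (at 0)"
    by (simp add: has_field_derivative_iff)
  have "I \<le> pi * c / 2 * (ln c + euler_mascheroni - 1)"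
  proof (rule tendsto_lowerbound)
    show "((\<lambda>h. (\<Psi> h - \<Psi> 0) / h) \<longlongrightarrow> pi * c / 2 * (ln c + euler_mascheroni - 1)) (at_right 0)"
      by (rule tendsto_within_subset[OF lim]) auto
    show "eventually (\<lambda>h. I \<le> (\<Psi> h - \<Psi> 0) / h) (at_right 0)"
      using eventually_at_right_real[of 0 1] by (auto elim!: eventually_mono intro: upper)
  qed auto
  moreover have "pi * c / 2 * (ln c + euler_mascheroni - 1) \<le> I"
  proof (rule tendsto_upperbound)
    show "((\<lambda>h. (\<Psi> h - \<Psi> 0) / h) \<longlongrightarrow> pi * c / 2 * (ln c + euler_mascheroni - 1)) (at_left 0)"
      by (rule tendsto_within_subset[OF lim]) auto
    show "eventually (\<lambda>h. (\<Psi> h - \<Psi> 0) / h \<le> I) (at_left 0)"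
      using eventually_at_left_real[of "-1" 0] by (auto elim!: eventually_mono intro: lower)
  qed auto
  ultimately show ?thesis using int by (simp add: has_bochner_integral_iff I_def)
qed

section \<open>Integrals over the whole line and majorants for the test function\<close>

lemma nn_integral_even:
  fixes \<phi> :: "real \<Rightarrow> real"
  assumes [measurable]: "\<phi> \<in> borel_measurable borel" and even: "\<And>y. \<phi> (- y) = \<phi> y"
  shows "(\<integral>\<^sup>+y. ennreal (\<phi> y) \<partial>lborel) = 2 * (\<integral>\<^sup>+y\<in>{0<..}. ennreal (\<phi> y) \<partial>lborel)"
proof -
  have "(\<integral>\<^sup>+y. ennreal (\<phi> y) \<partial>lborel) =
      (\<integral>\<^sup>+y. ennreal (\<phi> y) * indicator {0<..} y + ennreal (\<phi> y) * indicator {..<0} y \<partial>lborel)"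
  proof (rule nn_integral_cong_AE)
    have "AE y in lborel. y \<noteq> (0::real)" by (rule AE_lborel_singleton)
    then show "AE y in lborel. ennreal (\<phi> y) = ennreal (\<phi> y) * indicator {0<..} y + ennreal (\<phi> y) * indicator {..<0} y"
      by eventually_elim (auto split: split_indicator)
  qed
  also have "\<dots> = (\<integral>\<^sup>+y\<in>{0<..}. ennreal (\<phi> y) \<partial>lborel) + (\<integral>\<^sup>+y\<in>{..<0}. ennreal (\<phi> y) \<partial>lborel)"
    by (rule nn_integral_add) auto
  also have "(\<integral>\<^sup>+y\<in>{..<0}. ennreal (\<phi> y) \<partial>lborel) = (\<integral>\<^sup>+y. ennreal (\<phi> (- y)) * indicator {..<0} (- y) \<partial>lborel)"
    by (subst nn_integral_real_affine[where c = "-1" and t = 0]) auto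
  also have "\<dots> = (\<integral>\<^sup>+y\<in>{0<..}. ennreal (\<phi> y) \<partial>lborel)"
    by (intro nn_integral_cong) (auto simp: even split: split_indicator)
  finally show ?thesis by (simp add: mult_2)
qed

lemma has_bochner_integral_even:
  fixes f :: "real \<Rightarrow> real"
  assumes f: "has_bochner_integral lborel (\<lambda>y. indicator {0<..} y * f y) I" and even: "\<And>y. f (- y) = f y"
    and [measurable]: "f \<in> borel_measurable borel"
  shows "has_bochner_integral lborel f (2 * I)"
proof -
  have "has_bochner_integral lborel (\<lambda>y. indicator {0<..} (0 + (-1) * y) * f (0 + (-1) * y)) (I /\<^sub>R \<bar>- 1\<bar>)"
    using f by (subst lborel_has_bochner_integral_real_affine_iff[symmetric]) auto
  then have "has_bochner_integral lborel (\<lambda>y. indicator {0<..} (- y) * f y) I" by (simp add: even)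
  from has_bochner_integral_add[OF f this]
  have "has_bochner_integral lborel (\<lambda>y. indicator {0<..} y * f y + indicator {0<..} (- y) * f y) (2 * I)" by simp
  moreover have "AE y in lborel. indicator {0<..} y * f y + indicator {0<..} (- y) * f y = f y"
    using AE_lborel_singleton[of 0] by eventually_elim (auto split: split_indicator)
  ultimately show ?thesis
    by (subst has_bochner_integral_cong_AE[where g = "\<lambda>y. indicator {0<..} y * f y + indicator {0<..} (- y) * f y"]) (auto elim: eventually_mono)
qed

lemma integrable_powr_cauchy:
  fixes e :: real
  assumes e: "-1 < e" "e < 1"
  shows "integrable lborel (\<lambda>y::real. \<bar>y\<bar> powr e / (1 + y\<^sup>2))"
proof (rule integrableI_nonneg)
  have eq: "(\<integral>\<^sup>+y. ennreal (\<bar>y\<bar> powr e / (1 + y\<^sup>2)) \<partial>lborel) = 2 * (\<integral>\<^sup>+y\<in>{0<..}. ennreal (\<bar>y\<bar> powr e / (1 + y\<^sup>2)) \<partial>lborel)"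
    by (rule nn_integral_even) auto
  have "(\<integral>\<^sup>+y\<in>{0<..}. ennreal (\<bar>y\<bar> powr e / (1 + y\<^sup>2)) \<partial>lborel) \<le>
      (\<integral>\<^sup>+y\<in>{0<..}. ennreal (y powr (e - 1) * (2 * y / (y\<^sup>2 + 1\<^sup>2))) \<partial>lborel)"
  proof (intro nn_integral_mono)
    fix y :: real
    have "\<bar>y\<bar> powr e / (1 + y\<^sup>2) \<le> y powr (e - 1) * (2 * y / (y\<^sup>2 + 1\<^sup>2))" if "y > 0"
    proof -
      have "y powr (e - 1) * (2 * y / (y\<^sup>2 + 1\<^sup>2)) = 2 * (y powr e / (1 + y\<^sup>2))"
        using that by (simp add: powr_diff add.commute)
      moreover have "y powr e / (1 + y\<^sup>2) \<ge> 0" by (simp add: divide_nonneg_nonneg)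
      ultimately have "y powr e / (1 + y\<^sup>2) \<le> y powr (e - 1) * (2 * y / (y\<^sup>2 + 1\<^sup>2))" by linarith
      then show ?thesis using that by simp
    qed
    then show "ennreal (\<bar>y\<bar> powr e / (1 + y\<^sup>2)) * indicator {0<..} y \<le>
       ennreal (y powr (e - 1) * (2 * y / (y\<^sup>2 + 1\<^sup>2))) * indicator {0<..} y"
      by (auto split: split_indicator intro: ennreal_leI)
  qed
  also have "\<dots> < \<infinity>" using nn_integral_Mellin_kernel[OF e, of 1] by simp
  finally show "(\<integral>\<^sup>+y. ennreal (\<bar>y\<bar> powr e / (1 + y\<^sup>2)) \<partial>lborel) < \<infinity>"
    unfolding eq by (simp add: ennreal_mult_less_top)
qed (auto intro!: AE_I2 divide_nonneg_nonneg)

context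
  fixes a :: real
  assumes a: "a > 0"
begin

lemma cayley_axis_nonneg: "cayley_axis a n t \<ge> 0"
  by (rule cayley_re_nonneg[OF a]) simp

lemma cayley_axis_bound: "cayley_axis a n t \<le> (2 + 2 * a\<^sup>2 * (real n)\<^sup>2) / (1 + t\<^sup>2)"
proof -
  have D: "a\<^sup>2 + t\<^sup>2 > 0" "1 + t\<^sup>2 > 0" using a by (auto simp: add_pos_nonneg)
  have "cayley_axis a n t * t\<^sup>2 \<le> cayley_axis a n t * (a\<^sup>2 + t\<^sup>2)" by (intro mult_left_mono cayley_axis_nonneg) auto
  also have "\<dots> \<le> 2 * a\<^sup>2 * (real n)\<^sup>2"
    using cayley_re_axis_le[OF a, of n t] D by (simp add: pos_le_divide_eq)
  finally have "cayley_axis a n t * t\<^sup>2 \<le> 2 * a\<^sup>2 * (real n)\<^sup>2" .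
  moreover have "cayley_axis a n t \<le> 2" by (rule cayley_re_le_2[OF a]) simp
  ultimately have "cayley_axis a n t * (1 + t\<^sup>2) \<le> 2 + 2 * a\<^sup>2 * (real n)\<^sup>2" by (simp add: distrib_left)
  then show ?thesis using D by (simp add: pos_le_divide_eq)
qed

text \<open>Uniform in \<open>n\<close> for the variable \<open>y = t / n\<close>; this provides the
  majorant for dominated convergence.\<close>

lemma cayley_axis_scaled_bound:
  assumes n: "n > 0"
  shows "cayley_axis a n (real n * y) \<le> (2 + 2 * a\<^sup>2) / (1 + y\<^sup>2)"
proof -
  have D: "a\<^sup>2 + (real n * y)\<^sup>2 > 0" "1 + y\<^sup>2 > 0" using a by (auto simp: add_pos_nonneg)
  have "(cayley_axis a n (real n * y) * y\<^sup>2) * (real n)\<^sup>2 \<le> cayley_axis a n (real n * y) * (a\<^sup>2 + (real n * y)\<^sup>2)"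
    using cayley_axis_nonneg[of n "real n * y"] by (simp add: power_mult_distrib algebra_simps)
  also have "\<dots> \<le> (2 * a\<^sup>2) * (real n)\<^sup>2"
    using cayley_re_axis_le[OF a, of n "real n * y"] D by (simp add: pos_le_divide_eq)
  finally have "cayley_axis a n (real n * y) * y\<^sup>2 \<le> 2 * a\<^sup>2" using n by (simp add: mult_le_cancel_right)
  moreover have "cayley_axis a n (real n * y) \<le> 2" by (rule cayley_re_le_2[OF a]) simp
  ultimately have "cayley_axis a n (real n * y) * (1 + y\<^sup>2) \<le> 2 + 2 * a\<^sup>2" by (simp add: distrib_left)
  then show ?thesis using D by (simp add: pos_le_divide_eq)
qed

lemmas cayley_axis_measurable [measurable] = measurable_cayley_re[OF a]

lemma has_bochner_integral_cayley_axis: "has_bochner_integral lborel (cayley_axis a n) (2 * pi * a * real n)"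
  by (rule has_bochner_integral_nn_integral)
     (use nn_integral_cayley_re[OF a, of n] cayley_axis_nonneg a in auto)

lemma integrable_cayley_axis_powr:
  assumes "-1 < e" "e < 1"
  shows "integrable lborel (\<lambda>t. cayley_axis a n t * \<bar>t\<bar> powr e)"
proof (rule Bochner_Integration.integrable_bound)
  show "integrable lborel (\<lambda>t. (2 + 2 * a\<^sup>2 * (real n)\<^sup>2) * (\<bar>t\<bar> powr e / (1 + t\<^sup>2)))"
    by (intro integrable_mult_right integrable_powr_cauchy assms)
  show "AE t in lborel. norm (cayley_axis a n t * \<bar>t\<bar> powr e) \<le> norm ((2 + 2 * a\<^sup>2 * (real n)\<^sup>2) * (\<bar>t\<bar> powr e / (1 + t\<^sup>2)))"
  proof (rule AE_I2)
    fix t :: real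
    have "cayley_axis a n t * \<bar>t\<bar> powr e \<le> (2 + 2 * a\<^sup>2 * (real n)\<^sup>2) / (1 + t\<^sup>2) * \<bar>t\<bar> powr e"
      by (intro mult_right_mono cayley_axis_bound) auto
    then show "norm (cayley_axis a n t * \<bar>t\<bar> powr e) \<le> norm ((2 + 2 * a\<^sup>2 * (real n)\<^sup>2) * (\<bar>t\<bar> powr e / (1 + t\<^sup>2)))"
      using cayley_axis_nonneg[of n t] by (simp add: abs_mult)
  qed
qed measurable

lemma abs_ln_abs_le: fixes t :: real shows "\<bar>ln \<bar>t\<bar>\<bar> \<le> 2 * (\<bar>t\<bar> powr (1 / 2) + \<bar>t\<bar> powr (- (1 / 2)))"
  using abs_ln_le_powr[of "\<bar>t\<bar>"] by (cases "t = 0") auto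

lemma integrable_cayley_axis_ln: "integrable lborel (\<lambda>t. cayley_axis a n t * ln \<bar>t\<bar>)"
proof (rule Bochner_Integration.integrable_bound)
  show "integrable lborel (\<lambda>t. 2 * (cayley_axis a n t * \<bar>t\<bar> powr (1 / 2) + cayley_axis a n t * \<bar>t\<bar> powr (- (1 / 2))))"
    by (intro integrable_mult_right Bochner_Integration.integrable_add integrable_cayley_axis_powr) auto
  show "AE t in lborel. norm (cayley_axis a n t * ln \<bar>t\<bar>) \<le> norm (2 * (cayley_axis a n t * \<bar>t\<bar> powr (1 / 2) + cayley_axis a n t * \<bar>t\<bar> powr (- (1 / 2))))"
  proof (rule AE_I2)
    fix t :: real
    have "cayley_axis a n t * \<bar>ln \<bar>t\<bar>\<bar> \<le> cayley_axis a n t * (2 * (\<bar>t\<bar> powr (1 / 2) + \<bar>t\<bar> powr (- (1 / 2))))"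
      by (intro mult_left_mono cayley_axis_nonneg abs_ln_abs_le)
    then show "norm (cayley_axis a n t * ln \<bar>t\<bar>) \<le> norm (2 * (cayley_axis a n t * \<bar>t\<bar> powr (1 / 2) + cayley_axis a n t * \<bar>t\<bar> powr (- (1 / 2))))"
      using cayley_axis_nonneg[of n t] by (simp add: abs_mult algebra_simps)
  qed
qed measurable

text \<open>Scaling by \<open>n\<close> yields \<open>n * n powr (- (1 / 2))\<close>, so the
  remainder \<open>O(\<bar>t\<bar> powr (- (1 / 2)))\<close> in Stirling's formula costs only
  \<open>O(sqrt n)\<close>.\<close>

lemma integral_cayley_axis_powr_bound:
  obtains c where "c \<ge> 0" "\<And>n. n > 0 \<Longrightarrow> integral\<^sup>L lborel (\<lambda>t. cayley_axis a n t * \<bar>t\<bar> powr (- (1 / 2))) \<le> c * sqrt (real n)"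
proof -
  define c where "c = integral\<^sup>L lborel (\<lambda>y::real. (2 + 2 * a\<^sup>2) * (\<bar>y\<bar> powr (- (1 / 2)) / (1 + y\<^sup>2)))"
  have "c \<ge> 0" unfolding c_def by (intro integral_nonneg_AE AE_I2) (auto intro!: mult_nonneg_nonneg divide_nonneg_nonneg)
  moreover have "integral\<^sup>L lborel (\<lambda>t. cayley_axis a n t * \<bar>t\<bar> powr (- (1 / 2))) \<le> c * sqrt (real n)" if n: "n > 0" for n
  proof -
    let ?f = "\<lambda>t. cayley_axis a n t * \<bar>t\<bar> powr (- (1 / 2))"
    have eq: "?f (real n * y) = (1 / sqrt (real n)) * (cayley_axis a n (real n * y) * \<bar>y\<bar> powr (- (1 / 2)))" for y
    proof -
      have "\<bar>real n * y\<bar> powr (- (1 / 2)) = real n powr (- (1 / 2)) * \<bar>y\<bar> powr (- (1 / 2))"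
        by (simp add: abs_mult powr_mult)
      moreover have "real n powr (- (1 / 2)) = 1 / sqrt (real n)" by (simp add: powr_minus_divide powr_half_sqrt)
      ultimately show ?thesis by simp
    qed
    have int: "integrable lborel (\<lambda>y. ?f (0 + real n * y))"
      using n by (subst lborel_integrable_real_affine_iff) (auto intro!: integrable_cayley_axis_powr)
    have "integral\<^sup>L lborel ?f = real n * integral\<^sup>L lborel (\<lambda>y. ?f (0 + real n * y))"
      using n by (subst lborel_integral_real_affine[where c = "real n" and t = 0]) auto
    also have "\<dots> \<le> real n * integral\<^sup>L lborel (\<lambda>y. (1 / sqrt (real n)) * ((2 + 2 * a\<^sup>2) * (\<bar>y\<bar> powr (- (1 / 2)) / (1 + y\<^sup>2))))"
    proof (intro mult_left_mono integral_mono int)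
      show "integrable lborel (\<lambda>y. (1 / sqrt (real n)) * ((2 + 2 * a\<^sup>2) * (\<bar>y\<bar> powr (- (1 / 2)) / (1 + y\<^sup>2))))"
        by (intro integrable_mult_right integrable_powr_cauchy) auto
      fix y :: real
      have "cayley_axis a n (real n * y) * \<bar>y\<bar> powr (- (1 / 2)) \<le> (2 + 2 * a\<^sup>2) / (1 + y\<^sup>2) * \<bar>y\<bar> powr (- (1 / 2))"
        by (intro mult_right_mono cayley_axis_scaled_bound n) auto
      then show "?f (0 + real n * y) \<le> (1 / sqrt (real n)) * ((2 + 2 * a\<^sup>2) * (\<bar>y\<bar> powr (- (1 / 2)) / (1 + y\<^sup>2)))"
        unfolding add_0 eq by (intro mult_left_mono) auto
    qed auto
    also have "\<dots> = real n * ((1 / sqrt (real n)) * c)"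
      unfolding c_def by (subst integral_mult_right_zero) simp
    also have "\<dots> = c * (real n / sqrt (real n))" by simp
    also have "real n / sqrt (real n) = sqrt (real n)" by (rule real_div_sqrt) simp
    finally show ?thesis .
  qed
  ultimately show ?thesis using that by blast
qed

text \<open>After \<open>t = n * y\<close> the logarithm splits into
  \<open>ln n + ln \<bar>y\<bar>\<close>. The first part integrates exactly against the mass
  \<open>2 * pi * a\<close>; the second converges to the cosine integral with
  \<open>c = 2 * a\<close>, doubled for the two half lines.\<close>

lemma integral_cayley_axis_ln_asymptotics:
  "(\<lambda>n. integral\<^sup>L lborel (\<lambda>t. cayley_axis a n t * ln \<bar>t\<bar>) / real n - 2 * pi * a * ln (real n))
     \<longlonglongrightarrow> 2 * pi * a * (ln (2 * a) + euler_mascheroni - 1)"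
proof -
  define w where "w y = 2 * (2 + 2 * a\<^sup>2) * (\<bar>y\<bar> powr (1 / 2) / (1 + y\<^sup>2) + \<bar>y\<bar> powr (- (1 / 2)) / (1 + y\<^sup>2))" for y :: real
  have w: "integrable lborel w"
    unfolding w_def by (intro integrable_mult_right Bochner_Integration.integrable_add integrable_powr_cauchy) auto
  have bound: "norm (cayley_axis a n (real n * y) * ln \<bar>y\<bar>) \<le> w y" if n: "n > 0" for n y
  proof -
    have "norm (cayley_axis a n (real n * y) * ln \<bar>y\<bar>) = cayley_axis a n (real n * y) * \<bar>ln \<bar>y\<bar>\<bar>"
      using cayley_axis_nonneg[of n "real n * y"] by (simp add: abs_mult)
    also have "\<dots> \<le> (2 + 2 * a\<^sup>2) / (1 + y\<^sup>2) * (2 * (\<bar>y\<bar> powr (1 / 2) + \<bar>y\<bar> powr (- (1 / 2))))"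
      by (intro mult_mono cayley_axis_scaled_bound n abs_ln_abs_le) (auto intro!: divide_nonneg_nonneg)
    also have "\<dots> = w y" by (simp add: w_def add_divide_distrib algebra_simps)
    finally show ?thesis .
  qed
  have K: "has_bochner_integral lborel (\<lambda>y. (1 - cos (2 * a / y)) * ln \<bar>y\<bar>) (2 * (pi * (2 * a) / 2 * (ln (2 * a) + euler_mascheroni - 1)))"
  proof (rule has_bochner_integral_even)
    have "has_bochner_integral lborel (\<lambda>y. indicator {0<..} y * ((1 - cos (2 * a / y)) * ln y)) (pi * (2 * a) / 2 * (ln (2 * a) + euler_mascheroni - 1))"
      by (rule has_bochner_integral_cos_ln) (use a in simp)
    also have "(\<lambda>y. indicator {0<..} y * ((1 - cos (2 * a / y)) * ln y)) = (\<lambda>y. indicator {0<..} y * ((1 - cos (2 * a / y)) * ln \<bar>y\<bar>))"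
      by (auto simp: fun_eq_iff split: split_indicator)
    finally show "has_bochner_integral lborel (\<lambda>y. indicator {0<..} y * ((1 - cos (2 * a / y)) * ln \<bar>y\<bar>)) (pi * (2 * a) / 2 * (ln (2 * a) + euler_mascheroni - 1))" .
  qed auto
  \<comment> \<open>Shifted to \<open>Suc n\<close>, since the majorant requires
    \<open>n > 0\<close>.\<close>
  have lim: "(\<lambda>n. integral\<^sup>L lborel (\<lambda>y. cayley_axis a (Suc n) (real (Suc n) * y) * ln \<bar>y\<bar>)) \<longlonglongrightarrow>
      integral\<^sup>L lborel (\<lambda>y. (1 - cos (2 * a / y)) * ln \<bar>y\<bar>)"
  proof (rule integral_dominated_convergence[OF _ _ w])
    show "AE y in lborel. (\<lambda>n. cayley_axis a (Suc n) (real (Suc n) * y) * ln \<bar>y\<bar>) \<longlonglongrightarrow> (1 - cos (2 * a / y)) * ln \<bar>y\<bar>"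
      using AE_lborel_singleton[of "0::real"]
    proof eventually_elim
      case (elim y)
      have "(\<lambda>n. cayley_axis a (Suc n) (real (Suc n) * y)) \<longlonglongrightarrow> 1 - cos (2 * a / y)"
        using LIMSEQ_Suc[OF cayley_re_scaled_tendsto[OF a elim]] .
      then show ?case by (intro tendsto_mult tendsto_const)
    qed
    show "AE y in lborel. norm (cayley_axis a (Suc n) (real (Suc n) * y) * ln \<bar>y\<bar>) \<le> w y" for n
      using bound[of "Suc n"] by (intro AE_I2) auto
  qed measurable
  have eq: "integral\<^sup>L lborel (\<lambda>t. cayley_axis a n t * ln \<bar>t\<bar>) / real n - 2 * pi * a * ln (real n) =
      integral\<^sup>L lborel (\<lambda>y. cayley_axis a n (real n * y) * ln \<bar>y\<bar>)" if n: "n > 0" for n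
  proof -
    have 1: "has_bochner_integral lborel (\<lambda>y. cayley_axis a n (0 + real n * y)) (2 * pi * a)"
    proof -
      have "has_bochner_integral lborel (\<lambda>y. cayley_axis a n (0 + real n * y)) ((2 * pi * a * real n) /\<^sub>R \<bar>real n\<bar>)"
        using has_bochner_integral_cayley_axis[of n] n
        by (subst lborel_has_bochner_integral_real_affine_iff[symmetric]) auto
      also have "(2 * pi * a * real n) /\<^sub>R \<bar>real n\<bar> = 2 * pi * a" using n by simp
      finally show ?thesis .
    qed
    have [measurable]: "(\<lambda>y. cayley_axis a n (real n * y)) \<in> borel_measurable borel"
      by (rule measurable_compose[OF _ cayley_axis_measurable]) measurable
    have 2: "integrable lborel (\<lambda>y. cayley_axis a n (real n * y) * ln \<bar>y\<bar>)"
    proof (rule Bochner_Integration.integrable_bound[OF w])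
      show "(\<lambda>y. cayley_axis a n (real n * y) * ln \<bar>y\<bar>) \<in> borel_measurable lborel" by measurable
      have "norm (cayley_axis a n (real n * y) * ln \<bar>y\<bar>) \<le> norm (w y)" for y
        using bound[OF n, of y] abs_ge_self[of "w y"] unfolding real_norm_def by (rule order_trans)
      then show "AE y in lborel. norm (cayley_axis a n (real n * y) * ln \<bar>y\<bar>) \<le> norm (w y)" by (intro AE_I2)
    qed
    have "integral\<^sup>L lborel (\<lambda>t. cayley_axis a n t * ln \<bar>t\<bar>) = real n * integral\<^sup>L lborel (\<lambda>y. cayley_axis a n (0 + real n * y) * ln \<bar>0 + real n * y\<bar>)"
      using n by (subst lborel_integral_real_affine[where c = "real n" and t = 0]) auto
    also have "integral\<^sup>L lborel (\<lambda>y. cayley_axis a n (0 + real n * y) * ln \<bar>0 + real n * y\<bar>) =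
        integral\<^sup>L lborel (\<lambda>y. cayley_axis a n (0 + real n * y) * ln (real n) + cayley_axis a n (real n * y) * ln \<bar>y\<bar>)"
    proof (rule integral_cong_AE)
      show "AE y in lborel. cayley_axis a n (0 + real n * y) * ln \<bar>0 + real n * y\<bar> = cayley_axis a n (0 + real n * y) * ln (real n) + cayley_axis a n (real n * y) * ln \<bar>y\<bar>"
        using AE_lborel_singleton[of "0::real"]
        by eventually_elim (use n in \<open>auto simp: abs_mult ln_mult algebra_simps\<close>)
    qed (unfold add_0, measurable)
    also have "\<dots> = 2 * pi * a * ln (real n) + integral\<^sup>L lborel (\<lambda>y. cayley_axis a n (real n * y) * ln \<bar>y\<bar>)"
      using 1 2 by (subst Bochner_Integration.integral_add) (auto simp: has_bochner_integral_iff)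
    finally show ?thesis using n by (simp add: field_simps)
  qed
  show ?thesis
  proof (rule LIMSEQ_imp_Suc)
    have K2: "integral\<^sup>L lborel (\<lambda>y. (1 - cos (2 * a / y)) * ln \<bar>y\<bar>) = 2 * pi * a * (ln (2 * a) + euler_mascheroni - 1)"
      unfolding has_bochner_integral_integral_eq[OF K] by simp
    have "(\<lambda>n. integral\<^sup>L lborel (\<lambda>t. cayley_axis a (Suc n) t * ln \<bar>t\<bar>) / real (Suc n) - 2 * pi * a * ln (real (Suc n))) =
       (\<lambda>n. integral\<^sup>L lborel (\<lambda>y. cayley_axis a (Suc n) (real (Suc n) * y) * ln \<bar>y\<bar>))"
      by (rule ext) (rule eq, simp)
    then show "(\<lambda>n. integral\<^sup>L lborel (\<lambda>t. cayley_axis a (Suc n) t * ln \<bar>t\<bar>) / real (Suc n) - 2 * pi * a * ln (real (Suc n)))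
       \<longlonglongrightarrow> 2 * pi * a * (ln (2 * a) + euler_mascheroni - 1)"
      using lim by (simp only: K2)
  qed
qed

end

section \<open>Sums over the ordinates\<close>

definition ordinate_sum :: "(real \<Rightarrow> real) \<Rightarrow> real \<Rightarrow> real" where
  "ordinate_sum F T = (\<Sum>g | g \<in> ordinates \<and> \<bar>g\<bar> \<le> T. zero_mult g * F g)"

lemma ordinate_sum_mono:
  assumes "\<And>g. F g \<ge> 0" "S \<le> T"
  shows "ordinate_sum F S \<le> ordinate_sum F T"
  unfolding ordinate_sum_def using finite_ordinates assms
  by (intro sum_mono2) (auto intro!: mult_nonneg_nonneg zero_mult_nonneg)

lemma ordinate_sum_le:
  assumes "\<And>g. F g \<le> G g"
  shows "ordinate_sum F T \<le> ordinate_sum G T"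
  unfolding ordinate_sum_def by (intro sum_mono mult_left_mono assms zero_mult_nonneg)

lemma ordinate_sum_nonneg: "(\<And>g. F g \<ge> 0) \<Longrightarrow> ordinate_sum F T \<ge> 0"
  unfolding ordinate_sum_def by (intro sum_nonneg mult_nonneg_nonneg zero_mult_nonneg)

lemma ordinate_sum_cmult: "ordinate_sum (\<lambda>g. c * F g) T = c * ordinate_sum F T"
  unfolding ordinate_sum_def by (simp add: sum_distrib_left mult_ac)

lemma ordinate_sum_le_limit:
  assumes "(ordinate_sum F \<longlongrightarrow> L) at_top" "\<And>g. F g \<ge> 0"
  shows "ordinate_sum F T \<le> L"
proof (rule tendsto_lowerbound[OF assms(1)])
  show "eventually (\<lambda>S. ordinate_sum F T \<le> ordinate_sum F S) at_top"
    using eventually_ge_at_top[of T] by eventually_elim (rule ordinate_sum_mono[OF assms(2)])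
qed simp

lemma ordinate_sum_tendsto:
  assumes "\<And>g. F g \<ge> 0" "\<And>T. ordinate_sum F T \<le> B"
  obtains L where "(ordinate_sum F \<longlongrightarrow> L) at_top"
proof
  have bdd: "bdd_above (range (ordinate_sum F))" using assms(2) by (auto simp: bdd_above_def)
  show "(ordinate_sum F \<longlongrightarrow> (SUP T. ordinate_sum F T)) at_top"
  proof (rule increasing_tendsto)
    show "eventually (\<lambda>T. ordinate_sum F T \<le> (SUP T. ordinate_sum F T)) at_top"
      by (intro always_eventually allI cSUP_upper bdd) auto
    fix y assume "y < (SUP T. ordinate_sum F T)"
    then obtain T0 where T0: "y < ordinate_sum F T0" using less_cSUP_iff[OF _ bdd] by auto
    show "eventually (\<lambda>T. y < ordinate_sum F T) at_top"
      using eventually_ge_at_top[of T0]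
    proof eventually_elim
      case (elim T)
      show ?case by (rule less_le_trans[OF T0 ordinate_sum_mono[OF assms(1) elim]])
    qed
  qed
qed

lemma RH_ordinate_sum_poisson:
  assumes riemann_hypothesis "x > 0"
  shows "(ordinate_sum (\<lambda>g. x / (x\<^sup>2 + (t - g)\<^sup>2)) \<longlongrightarrow>
     Re (deriv xi (1 / 2 + Complex x t) / xi (1 / 2 + Complex x t))) at_top"
  using RH_poisson_sum[OF assms, of t] by (simp add: ordinate_sum_def[abs_def])

text \<open>The Poisson sum at \<open>x = 1\<close>, \<open>t = 0\<close> already has this form; its
  convergence takes the place of an estimate for the number of zeros.\<close>

lemma RH_ordinate_sum_inverse_square:
  assumes RH: riemann_hypothesis
  obtains L where "(ordinate_sum (\<lambda>g. 1 / (1 + g\<^sup>2)) \<longlongrightarrow> L) at_top"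
proof -
  obtain P where P: "(ordinate_sum (\<lambda>g. 1 / (1\<^sup>2 + (0 - g)\<^sup>2)) \<longlongrightarrow> P) at_top"
    using RH_ordinate_sum_poisson[OF RH zero_less_one] by blast
  then show ?thesis using that by simp
qed

lemma RH_ordinate_sum_tendsto:
  assumes RH: riemann_hypothesis and F: "\<And>g. F g \<ge> 0" "\<And>g. F g \<le> C / (1 + g\<^sup>2)"
  obtains S where "(ordinate_sum F \<longlongrightarrow> S) at_top"
proof -
  obtain L where L: "(ordinate_sum (\<lambda>g. 1 / (1 + g\<^sup>2)) \<longlongrightarrow> L) at_top"
    using RH_ordinate_sum_inverse_square[OF RH] .
  have nn: "1 / (1 + g\<^sup>2) \<ge> 0" for g :: real by (simp add: divide_nonneg_nonneg)
  have C: "C \<ge> 0" using order_trans[OF F(1) F(2), of 0] by simp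
  have "ordinate_sum F T \<le> C * L" for T
  proof -
    have "ordinate_sum F T \<le> ordinate_sum (\<lambda>g. C * (1 / (1 + g\<^sup>2))) T" using F(2) by (intro ordinate_sum_le) auto
    also have "\<dots> = C * ordinate_sum (\<lambda>g. 1 / (1 + g\<^sup>2)) T" by (rule ordinate_sum_cmult)
    also have "\<dots> \<le> C * L" by (intro mult_left_mono ordinate_sum_le_limit[OF L] nn C)
    finally show ?thesis .
  qed
  from ordinate_sum_tendsto[OF F(1) this] that show ?thesis by blast
qed

lemma tendsto_real_at_top: "(f \<longlongrightarrow> L) at_top \<Longrightarrow> (\<lambda>N. f (real N)) \<longlonglongrightarrow> L"
  by (rule filterlim_compose[OF _ filterlim_real_sequentially])

context
  fixes a :: real
  assumes a: "a > 0" and RH: riemann_hypothesis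
begin

abbreviation "H n \<equiv> cayley_axis a n"

lemmas H_nonneg = cayley_axis_nonneg[OF a]
lemmas H_measurable [measurable] = cayley_axis_measurable[OF a]

definition ordinate_sum_lim :: "nat \<Rightarrow> real" where
  "ordinate_sum_lim n = Lim at_top (ordinate_sum (H n))"

lemma ordinate_sum_lim: "(ordinate_sum (H n) \<longlongrightarrow> ordinate_sum_lim n) at_top"
proof -
  obtain S where S: "(ordinate_sum (H n) \<longlongrightarrow> S) at_top"
    using RH_ordinate_sum_tendsto[OF RH H_nonneg cayley_axis_bound[OF a]] .
  then have "ordinate_sum_lim n = S" unfolding ordinate_sum_lim_def by (intro tendsto_Lim) auto
  then show ?thesis using S by simp
qed

text \<open>For a finite cut-off the Poisson formula applies term by term. As all terms are
  non-negative, the integrands increase with the cut-off and monotone convergence passes to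
  \<open>W\<close>.\<close>

lemma ordinate_sum_cayley_poisson:
  fixes x :: real
  assumes x: "x > 0"
  defines "W \<equiv> \<lambda>t. Re (deriv xi (1 / 2 + Complex x t) / xi (1 / 2 + Complex x t))"
  assumes int: "integrable lborel (\<lambda>t. H n t * W t)"
  shows "(\<lambda>N. pi * ordinate_sum (\<lambda>g. cayley_re a n (Complex x g)) (real N)) \<longlonglongrightarrow> integral\<^sup>L lborel (\<lambda>t. H n t * W t)"
proof -
  define p where "p g t = x / (x\<^sup>2 + (t - g)\<^sup>2)" for g t
  have p: "p g t \<ge> 0" for g t using x by (simp add: p_def divide_nonneg_nonneg)
  have [measurable]: "p g \<in> borel_measurable borel" for g unfolding p_def by measurable
  have W: "(ordinate_sum (\<lambda>g. p g t) \<longlongrightarrow> W t) at_top" for t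
    unfolding p_def W_def by (rule RH_ordinate_sum_poisson[OF RH x])
  have W_nonneg: "W t \<ge> 0" for t
    using ordinate_sum_nonneg[OF p] ordinate_sum_le_limit[OF W p] by (rule order_trans)
  have Hx: "cayley_re a n (Complex x g) \<ge> 0" for g by (rule cayley_re_nonneg[OF a]) (use x in simp)
  have fin: "(\<integral>\<^sup>+t. ennreal (H n t * ordinate_sum (\<lambda>g. p g t) T) \<partial>lborel) = ennreal (pi * ordinate_sum (\<lambda>g. cayley_re a n (Complex x g)) T)" for T
  proof -
    define A where "A = {g. g \<in> ordinates \<and> \<bar>g\<bar> \<le> T}"
    have "(\<integral>\<^sup>+t. ennreal (H n t * ordinate_sum (\<lambda>g. p g t) T) \<partial>lborel) =
        (\<integral>\<^sup>+t. (\<Sum>g\<in>A. ennreal (zero_mult g) * ennreal (H n t * p g t)) \<partial>lborel)"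
    proof (rule nn_integral_cong)
      fix t
      have "H n t * ordinate_sum (\<lambda>g. p g t) T = (\<Sum>g\<in>A. zero_mult g * (H n t * p g t))"
        by (simp add: ordinate_sum_def A_def sum_distrib_left mult_ac)
      also have "ennreal \<dots> = (\<Sum>g\<in>A. ennreal (zero_mult g * (H n t * p g t)))"
        by (intro sum_ennreal[symmetric] mult_nonneg_nonneg zero_mult_nonneg H_nonneg p)
      finally show "ennreal (H n t * ordinate_sum (\<lambda>g. p g t) T) = (\<Sum>g\<in>A. ennreal (zero_mult g) * ennreal (H n t * p g t))"
        by (simp add: ennreal_mult' zero_mult_nonneg)
    qed
    also have "\<dots> = (\<Sum>g\<in>A. \<integral>\<^sup>+t. ennreal (zero_mult g) * ennreal (H n t * p g t) \<partial>lborel)"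
      by (rule nn_integral_sum) measurable
    also have "\<dots> = (\<Sum>g\<in>A. ennreal (zero_mult g * (pi * cayley_re a n (Complex x g))))"
    proof (rule sum.cong[OF refl])
      fix g
      have "(\<integral>\<^sup>+t. ennreal (zero_mult g) * ennreal (H n t * p g t) \<partial>lborel) = ennreal (zero_mult g) * (\<integral>\<^sup>+t. ennreal (H n t * p g t) \<partial>lborel)"
        by (rule nn_integral_cmult) measurable
      also have "\<dots> = ennreal (zero_mult g * (pi * cayley_re a n (Complex x g)))"
        unfolding p_def nn_integral_poisson_cayley[OF a x] by (simp add: ennreal_mult' zero_mult_nonneg)
      finally show "(\<integral>\<^sup>+t. ennreal (zero_mult g) * ennreal (H n t * p g t) \<partial>lborel) = ennreal (zero_mult g * (pi * cayley_re a n (Complex x g)))" .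
    qed
    also have "\<dots> = ennreal (\<Sum>g\<in>A. zero_mult g * (pi * cayley_re a n (Complex x g)))"
      by (intro sum_ennreal mult_nonneg_nonneg zero_mult_nonneg Hx) auto
    also have "(\<Sum>g\<in>A. zero_mult g * (pi * cayley_re a n (Complex x g))) = pi * ordinate_sum (\<lambda>g. cayley_re a n (Complex x g)) T"
      by (simp add: ordinate_sum_def A_def sum_distrib_left mult_ac)
    finally show ?thesis .
  qed
  have "(\<lambda>N. \<integral>\<^sup>+t. ennreal (H n t * ordinate_sum (\<lambda>g. p g t) (real N)) \<partial>lborel) \<longlonglongrightarrow> (\<integral>\<^sup>+t. ennreal (H n t * W t) \<partial>lborel)"
  proof (rule nn_integral_LIMSEQ)
    show "incseq (\<lambda>N t. ennreal (H n t * ordinate_sum (\<lambda>g. p g t) (real N)))"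
      by (intro incseq_SucI le_funI ennreal_leI mult_left_mono ordinate_sum_mono H_nonneg p) auto
    show "(\<lambda>t. ennreal (H n t * ordinate_sum (\<lambda>g. p g t) (real N))) \<in> borel_measurable lborel" for N
      unfolding ordinate_sum_def by measurable
    show "(\<lambda>N. ennreal (H n t * ordinate_sum (\<lambda>g. p g t) (real N))) \<longlonglongrightarrow> ennreal (H n t * W t)" for t
      by (rule tendsto_ennrealI[OF tendsto_mult_left[OF tendsto_real_at_top[OF W]]])
  qed
  moreover have "(\<integral>\<^sup>+t. ennreal (H n t * W t) \<partial>lborel) = ennreal (integral\<^sup>L lborel (\<lambda>t. H n t * W t))"
    by (rule nn_integral_eq_integral[OF int]) (intro AE_I2 mult_nonneg_nonneg H_nonneg W_nonneg)
  ultimately have "(\<lambda>N. ennreal (pi * ordinate_sum (\<lambda>g. cayley_re a n (Complex x g)) (real N))) \<longlonglongrightarrow> ennreal (integral\<^sup>L lborel (\<lambda>t. H n t * W t))"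
    by (simp only: fin)
  then show ?thesis
    by (rule tendsto_ennrealD)
       (intro always_eventually allI integral_nonneg_AE AE_I2 mult_nonneg_nonneg H_nonneg W_nonneg ordinate_sum_nonneg Hx; simp)+
qed

text \<open>Moving the test function from the critical line to distance \<open>x\<close> is harmless, and
  at distance \<open>x\<close> the sum over zeros is an integral against \<open>Re (xi'/xi)\<close>.\<close>

lemma ordinate_sum_lim_estimate:
  fixes x :: real
  assumes x: "x \<ge> 5 / 2"
  obtains C where "C \<ge> 0" "\<And>K. \<exists>M. \<forall>n>0. \<bar>ordinate_sum_lim n -
      (integral\<^sup>L lborel (\<lambda>t. H n t * ln \<bar>t\<bar>) / (2 * pi) - a * ln (2 * pi) * real n)\<bar>
        \<le> 2 * a * 2 powr (4 - x) * real n + C * sqrt (real n) + M +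
          C * real n * (Lim at_top (ordinate_sum (\<lambda>g. 1 / (1 + g\<^sup>2))) - ordinate_sum (\<lambda>g. 1 / (1 + g\<^sup>2)) K)"
proof -
  define W where "W t = Re (deriv xi (1 / 2 + Complex x t) / xi (1 / 2 + Complex x t))" for t
  \<comment> \<open>Deviation of \<open>Re (xi'/xi)\<close> from its Stirling main term.\<close>
  define r where "r t = W t - (ln \<bar>t\<bar> - ln (2 * pi)) / 2" for t
  define \<delta> where "\<delta> = 2 powr (4 - x)"
  have x0: "x > 0" using x by simp
  obtain C1 where C1: "C1 > 0" "\<And>t. t \<noteq> 0 \<Longrightarrow> \<bar>r t\<bar> \<le> \<delta> + C1 * \<bar>t\<bar> powr (- (1 / 2))"
  proof -
    obtain C1 where C1: "C1 > 0" "\<And>t. t \<noteq> 0 \<Longrightarrow> \<bar>W t - ln (\<bar>t\<bar> / (2 * pi)) / 2\<bar> \<le> 2 powr (4 - x) + C1 * \<bar>t\<bar> powr (- (1 / 2))"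
      unfolding W_def using Re_log_deriv_xi_estimate[OF x] by blast
    have "\<bar>r t\<bar> \<le> \<delta> + C1 * \<bar>t\<bar> powr (- (1 / 2))" if "t \<noteq> 0" for t
      using C1(2)[OF that] that by (simp add: r_def \<delta>_def ln_div)
    then show ?thesis using that C1(1) by blast
  qed
  obtain c where c: "c \<ge> 0" "\<And>n. n > 0 \<Longrightarrow> integral\<^sup>L lborel (\<lambda>t. H n t * \<bar>t\<bar> powr (- (1 / 2))) \<le> c * sqrt (real n)"
    using integral_cayley_axis_powr_bound[OF a] by blast
  have [measurable]: "W \<in> borel_measurable borel"
  proof (rule borel_measurable_LIMSEQ_real)
    show "(\<lambda>N. ordinate_sum (\<lambda>g. x / (x\<^sup>2 + (t - g)\<^sup>2)) (real N)) \<longlonglongrightarrow> W t" for t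
      unfolding W_def by (rule tendsto_real_at_top[OF RH_ordinate_sum_poisson[OF RH x0]])
    show "(\<lambda>t. ordinate_sum (\<lambda>g. x / (x\<^sup>2 + (t - g)\<^sup>2)) (real N)) \<in> borel_measurable borel" for N
      unfolding ordinate_sum_def by measurable
  qed
  have [measurable]: "r \<in> borel_measurable borel" unfolding r_def by measurable
  have iH: "integrable lborel (H n)" "integral\<^sup>L lborel (H n) = 2 * pi * a * real n" for n
    using has_bochner_integral_cayley_axis[OF a, of n] by (auto simp: has_bochner_integral_iff)
  have iHp: "integrable lborel (\<lambda>t. H n t * \<bar>t\<bar> powr (- (1 / 2)))" for n
    by (rule integrable_cayley_axis_powr[OF a]) auto
  have iHl: "integrable lborel (\<lambda>t. H n t * ln \<bar>t\<bar>)" for n by (rule integrable_cayley_axis_ln[OF a])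
  have rbound: "AE t in lborel. norm (H n t * r t) \<le> \<delta> * H n t + C1 * (H n t * \<bar>t\<bar> powr (- (1 / 2)))" for n
    using AE_lborel_singleton[of "0::real"]
  proof eventually_elim
    case (elim t)
    have "norm (H n t * r t) = H n t * \<bar>r t\<bar>" using H_nonneg[of n t] by (simp add: abs_mult)
    also have "\<dots> \<le> H n t * (\<delta> + C1 * \<bar>t\<bar> powr (- (1 / 2)))" by (intro mult_left_mono C1(2) elim H_nonneg)
    finally show ?case by (simp add: algebra_simps)
  qed
  have ib: "integrable lborel (\<lambda>t. \<delta> * H n t + C1 * (H n t * \<bar>t\<bar> powr (- (1 / 2))))" for n
    by (intro Bochner_Integration.integrable_add integrable_mult_right iH iHp)
  have iHr: "integrable lborel (\<lambda>t. H n t * r t)" for n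
  proof (rule Bochner_Integration.integrable_bound[OF ib])
    show "AE t in lborel. norm (H n t * r t) \<le> norm (\<delta> * H n t + C1 * (H n t * \<bar>t\<bar> powr (- (1 / 2))))"
      using rbound[of n] by eventually_elim auto
  qed measurable
  have Hr: "\<bar>integral\<^sup>L lborel (\<lambda>t. H n t * r t)\<bar> \<le> \<delta> * (2 * pi * a * real n) + C1 * (c * sqrt (real n))" if "n > 0" for n
  proof -
    have "norm (integral\<^sup>L lborel (\<lambda>t. H n t * r t)) \<le> integral\<^sup>L lborel (\<lambda>t. \<delta> * H n t + C1 * (H n t * \<bar>t\<bar> powr (- (1 / 2))))"
      by (rule order_trans[OF integral_norm_bound integral_mono_AE[OF integrable_norm[OF iHr] ib rbound]])
    also have "\<dots> = \<delta> * (2 * pi * a * real n) + C1 * integral\<^sup>L lborel (\<lambda>t. H n t * \<bar>t\<bar> powr (- (1 / 2)))"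
      by (subst Bochner_Integration.integral_add) (auto intro!: integrable_mult_right iH iHp simp: iH(2))
    also have "\<dots> \<le> \<delta> * (2 * pi * a * real n) + C1 * (c * sqrt (real n))"
      using c(2)[OF that] C1(1) by (intro add_left_mono mult_left_mono) auto
    finally show ?thesis by simp
  qed
  have HW: "integrable lborel (\<lambda>t. H n t * W t)"
    "integral\<^sup>L lborel (\<lambda>t. H n t * W t) = integral\<^sup>L lborel (\<lambda>t. H n t * ln \<bar>t\<bar>) / 2 - ln (2 * pi) / 2 * (2 * pi * a * real n)
       + integral\<^sup>L lborel (\<lambda>t. H n t * r t)" for n
  proof -
    have eq: "(\<lambda>t. H n t * W t) = (\<lambda>t. (1 / 2) * (H n t * ln \<bar>t\<bar>) - (ln (2 * pi) / 2) * H n t + H n t * r t)"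
      by (auto simp: r_def fun_eq_iff field_simps)
    have "has_bochner_integral lborel (\<lambda>t. (1 / 2) * (H n t * ln \<bar>t\<bar>) - (ln (2 * pi) / 2) * H n t + H n t * r t)
      ((1 / 2) * integral\<^sup>L lborel (\<lambda>t. H n t * ln \<bar>t\<bar>) - (ln (2 * pi) / 2) * (2 * pi * a * real n) + integral\<^sup>L lborel (\<lambda>t. H n t * r t))"
      by (intro has_bochner_integral_add has_bochner_integral_diff has_bochner_integral_mult_right
           has_bochner_integral_cayley_axis[OF a] has_bochner_integral_integrable iHl iHr)
    then show "integrable lborel (\<lambda>t. H n t * W t)"
      "integral\<^sup>L lborel (\<lambda>t. H n t * W t) = integral\<^sup>L lborel (\<lambda>t. H n t * ln \<bar>t\<bar>) / 2 - ln (2 * pi) / 2 * (2 * pi * a * real n)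
       + integral\<^sup>L lborel (\<lambda>t. H n t * r t)"
      unfolding eq by (auto simp: has_bochner_integral_iff)
  qed
  let ?G = "\<lambda>n g. cayley_re a n (Complex x g)"
  let ?q = "\<lambda>g::real. 1 / (1 + g\<^sup>2)"
  define L where "L = Lim at_top (ordinate_sum ?q)"
  have L: "(ordinate_sum ?q \<longlongrightarrow> L) at_top"
    using RH_ordinate_sum_inverse_square[OF RH] tendsto_Lim[of at_top "ordinate_sum ?q"] unfolding L_def by (metis trivial_limit_at_top_linorder)
  have q0: "?q g \<ge> 0" for g :: real by (simp add: divide_nonneg_nonneg)
  \<comment> \<open>From \<open>1 / (a\<^sup>2 + g\<^sup>2) \<le> (1 + 1 / a\<^sup>2) / (1 +
    g\<^sup>2)\<close>, which replaces the weight depending on \<open>a\<close> by the fixed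
    one.\<close>
  define C2 where "C2 = 2 * a * x * (1 + 1 / a\<^sup>2)"
  have C2: "C2 \<ge> 0" using a x0 by (simp add: C2_def)
  have diff1: "\<bar>?G n g - H n g\<bar> \<le> C2 * real n * ?q g" for n g
  proof -
    have D: "a\<^sup>2 + g\<^sup>2 > 0" "1 + g\<^sup>2 > 0" using a by (auto simp: add_pos_nonneg)
    have "1 / (a\<^sup>2 + g\<^sup>2) \<le> (1 + 1 / a\<^sup>2) * ?q g"
    proof -
      have "(1 + 1 / a\<^sup>2) * (a\<^sup>2 + g\<^sup>2) = (1 + g\<^sup>2) + (a\<^sup>2 + g\<^sup>2 / a\<^sup>2)" using a by (simp add: field_simps)
      then have "1 + g\<^sup>2 \<le> (1 + 1 / a\<^sup>2) * (a\<^sup>2 + g\<^sup>2)" by simp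
      then show ?thesis using D by (simp add: field_simps)
    qed
    then have "2 * a * x * real n * (1 / (a\<^sup>2 + g\<^sup>2)) \<le> 2 * a * x * real n * ((1 + 1 / a\<^sup>2) * ?q g)"
      using a x0 by (intro mult_left_mono) auto
    moreover have "\<bar>?G n g - H n g\<bar> \<le> 2 * a * x * real n * (1 / (a\<^sup>2 + g\<^sup>2))"
      using cayley_re_diff_le[OF a, of x n g] x0 by simp
    moreover have "2 * a * x * real n * ((1 + 1 / a\<^sup>2) * ?q g) = C2 * real n * ?q g"
      by (simp only: C2_def mult_ac)
    ultimately show ?thesis by linarith
  qed
  have diff2: "\<bar>?G n g - H n g\<bar> \<le> 2" for n g
    using cayley_re_nonneg[OF a, of "Complex x g" n] cayley_re_le_2[OF a, of "Complex x g" n]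
      cayley_re_nonneg[OF a, of "\<i> * of_real g" n] cayley_re_le_2[OF a, of "\<i> * of_real g" n] x0
    by (simp add: abs_le_iff)
  \<comment> \<open>The zeros are split at height \<open>K\<close>. Below it the trivial bound
    \<open>2\<close> gives an error independent of \<open>n\<close>; above it the linear bound
    leaves \<open>n\<close> times a tail that is small for large \<open>K\<close>.\<close>
  have shift: "\<bar>ordinate_sum (?G n) T - ordinate_sum (H n) T\<bar> \<le> 2 * ordinate_sum (\<lambda>_. 1) K + C2 * real n * (L - ordinate_sum ?q K)" if "K \<le> T" for n K T
  proof -
    define A where "A U = {g. g \<in> ordinates \<and> \<bar>g\<bar> \<le> U}" for U
    have fin: "finite (A U)" for U unfolding A_def by (rule finite_ordinates)
    have sub: "A K \<subseteq> A T" using that by (auto simp: A_def)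
    have "\<bar>ordinate_sum (?G n) T - ordinate_sum (H n) T\<bar> = \<bar>\<Sum>g\<in>A T. zero_mult g * (?G n g - H n g)\<bar>"
      by (simp add: ordinate_sum_def A_def sum_subtractf right_diff_distrib)
    also have "\<dots> \<le> (\<Sum>g\<in>A T. zero_mult g * \<bar>?G n g - H n g\<bar>)"
      using sum_abs[of "\<lambda>g. zero_mult g * (?G n g - H n g)" "A T"] by (simp add: abs_mult zero_mult_nonneg)
    also have "\<dots> = (\<Sum>g\<in>A K. zero_mult g * \<bar>?G n g - H n g\<bar>) + (\<Sum>g\<in>A T - A K. zero_mult g * \<bar>?G n g - H n g\<bar>)"
      using sum.subset_diff[OF sub fin, of "\<lambda>g. zero_mult g * \<bar>?G n g - H n g\<bar>"] by simp
    also have "\<dots> \<le> (\<Sum>g\<in>A K. zero_mult g * 2) + (\<Sum>g\<in>A T - A K. zero_mult g * (C2 * real n * ?q g))"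
      by (intro add_mono sum_mono mult_left_mono diff1 diff2 zero_mult_nonneg)
    also have "(\<Sum>g\<in>A K. zero_mult g * 2) = 2 * ordinate_sum (\<lambda>_. 1) K" by (simp add: ordinate_sum_def A_def sum_distrib_left mult_ac)
    also have "(\<Sum>g\<in>A T - A K. zero_mult g * (C2 * real n * ?q g)) = C2 * real n * (\<Sum>g\<in>A T - A K. zero_mult g * ?q g)"
      by (simp add: sum_distrib_left mult_ac)
    also have "(\<Sum>g\<in>A T - A K. zero_mult g * ?q g) = ordinate_sum ?q T - ordinate_sum ?q K"
      using sum.subset_diff[OF sub fin, of "\<lambda>g. zero_mult g * ?q g"] by (simp add: ordinate_sum_def A_def)
    also have "C2 * real n * (ordinate_sum ?q T - ordinate_sum ?q K) \<le> C2 * real n * (L - ordinate_sum ?q K)"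
      using ordinate_sum_le_limit[OF L q0, of T] C2 by (intro mult_left_mono diff_right_mono) auto
    finally show ?thesis by simp
  qed
  have shift_lim: "\<bar>integral\<^sup>L lborel (\<lambda>t. H n t * W t) / pi - ordinate_sum_lim n\<bar> \<le> 2 * ordinate_sum (\<lambda>_. 1) K + C2 * real n * (L - ordinate_sum ?q K)" for n K
  proof (rule tendsto_upperbound)
    have "(\<lambda>N. pi * ordinate_sum (?G n) (real N) / pi) \<longlonglongrightarrow> integral\<^sup>L lborel (\<lambda>t. H n t * W t) / pi"
      using ordinate_sum_cayley_poisson[OF x0 HW(1)[unfolded W_def]] unfolding W_def by (rule tendsto_divide) auto
    then have "(\<lambda>N. ordinate_sum (?G n) (real N)) \<longlonglongrightarrow> integral\<^sup>L lborel (\<lambda>t. H n t * W t) / pi" by simp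
    then show "(\<lambda>N. \<bar>ordinate_sum (?G n) (real N) - ordinate_sum (H n) (real N)\<bar>) \<longlonglongrightarrow> \<bar>integral\<^sup>L lborel (\<lambda>t. H n t * W t) / pi - ordinate_sum_lim n\<bar>"
      by (intro tendsto_rabs tendsto_diff tendsto_real_at_top[OF ordinate_sum_lim])
    obtain M :: nat where M: "real M \<ge> K" using real_arch_simple by blast
    show "eventually (\<lambda>N. \<bar>ordinate_sum (?G n) (real N) - ordinate_sum (H n) (real N)\<bar> \<le> 2 * ordinate_sum (\<lambda>_. 1) K + C2 * real n * (L - ordinate_sum ?q K)) sequentially"
      using eventually_ge_at_top[of M] by eventually_elim (rule shift, use M in \<open>meson of_nat_mono order_trans\<close>)
  qed auto
  define C where "C = C1 * c / pi + C2"
  have CC: "C \<ge> 0" "C1 * c / pi \<le> C" "C2 \<le> C" using C1(1) c(1) C2 by (auto simp: C_def)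
  have "\<exists>M. \<forall>n>0. \<bar>ordinate_sum_lim n - (integral\<^sup>L lborel (\<lambda>t. H n t * ln \<bar>t\<bar>) / (2 * pi) - a * ln (2 * pi) * real n)\<bar>
        \<le> 2 * a * 2 powr (4 - x) * real n + C * sqrt (real n) + M + C * real n * (L - ordinate_sum ?q K)" for K
  \<comment> \<open>The witness is twice the number of zeros up to height \<open>K\<close>, with
    multiplicity: it depends on \<open>K\<close> but not on \<open>n\<close>.\<close>
  proof (intro exI[of _ "2 * ordinate_sum (\<lambda>_. 1) K"] allI impI)
    fix n :: nat assume n: "n > 0"
    define J where "J = integral\<^sup>L lborel (\<lambda>t. H n t * ln \<bar>t\<bar>)"
    define R where "R = integral\<^sup>L lborel (\<lambda>t. H n t * r t)"
    have 1: "integral\<^sup>L lborel (\<lambda>t. H n t * W t) / pi = J / (2 * pi) - a * ln (2 * pi) * real n + R / pi"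
      unfolding HW(2) J_def R_def by (simp add: add_divide_distrib diff_divide_distrib)
    have "\<bar>R\<bar> / pi \<le> (\<delta> * (2 * pi * a * real n) + C1 * (c * sqrt (real n))) / pi"
      using Hr[OF n] by (intro divide_right_mono) (auto simp: R_def)
    also have "\<dots> = 2 * a * \<delta> * real n + C1 * c / pi * sqrt (real n)" by (simp add: add_divide_distrib)
    also have "\<dots> \<le> 2 * a * \<delta> * real n + C * sqrt (real n)"
      using CC by (intro add_left_mono mult_right_mono) auto
    finally have 2: "\<bar>R / pi\<bar> \<le> 2 * a * \<delta> * real n + C * sqrt (real n)" by simp
    have "C2 * real n * (L - ordinate_sum ?q K) \<le> C * real n * (L - ordinate_sum ?q K)"
      using CC ordinate_sum_le_limit[OF L q0, of K] by (intro mult_right_mono) auto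
    then show "\<bar>ordinate_sum_lim n - (integral\<^sup>L lborel (\<lambda>t. H n t * ln \<bar>t\<bar>) / (2 * pi) - a * ln (2 * pi) * real n)\<bar>
        \<le> 2 * a * 2 powr (4 - x) * real n + C * sqrt (real n) + 2 * ordinate_sum (\<lambda>_. 1) K + C * real n * (L - ordinate_sum ?q K)"
      using shift_lim[of n K] 2 unfolding 1 J_def[symmetric] \<delta>_def[symmetric] by linarith
  qed
  then show ?thesis using that CC(1) unfolding L_def by blast
qed

text \<open>The choices are made in the order \<open>x\<close>, \<open>K\<close>, \<open>n\<close>:
  \<open>x\<close> makes the zeta'/zeta contribution small, \<open>K\<close> the tail of the sum
  over zeros, and \<open>n\<close> absorbs all that depends on both. The constants combine through
  \<open>ln (2 * a) - ln (2 * pi) = - ln (pi / a)\<close>.\<close>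

lemma ordinate_sum_lim_asymptotics:
  "(\<lambda>n. (ordinate_sum_lim n - (a * real n * ln (real n) + a * (euler_mascheroni - 1 - ln (pi / a)) * real n)) / real n) \<longlonglongrightarrow> 0"
proof (rule LIMSEQ_I)
  fix \<epsilon> :: real assume \<epsilon>: "\<epsilon> > 0"
  \<comment> \<open>Five error terms stay below \<open>e\<close> each, with one share to
    spare.\<close>
  define e where "e = \<epsilon> / 6"
  have e: "e > 0" using \<epsilon> by (simp add: e_def)
  have "((\<lambda>x::real. 2 * a * 2 powr (4 - x)) \<longlongrightarrow> 0) at_top" by real_asymp
  then have "eventually (\<lambda>x::real. 2 * a * 2 powr (4 - x) < e) at_top"
    using e by (rule order_tendstoD)
  then obtain x :: real where x: "x \<ge> 5 / 2" "2 * a * 2 powr (4 - x) < e"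
    using eventually_happens[OF eventually_conj[OF _ eventually_ge_at_top[of "5/2"]]] by fastforce
  let ?q = "\<lambda>g::real. 1 / (1 + g\<^sup>2)"
  define L where "L = Lim at_top (ordinate_sum ?q)"
  have L: "(ordinate_sum ?q \<longlongrightarrow> L) at_top"
    using RH_ordinate_sum_inverse_square[OF RH] tendsto_Lim[of at_top "ordinate_sum ?q"] unfolding L_def by (metis trivial_limit_at_top_linorder)
  define J where "J n = integral\<^sup>L lborel (\<lambda>t. H n t * ln \<bar>t\<bar>)" for n
  obtain C where C: "C \<ge> 0" "\<And>K. \<exists>M. \<forall>n>0. \<bar>ordinate_sum_lim n - (J n / (2 * pi) - a * ln (2 * pi) * real n)\<bar>
        \<le> 2 * a * 2 powr (4 - x) * real n + C * sqrt (real n) + M + C * real n * (L - ordinate_sum ?q K)"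
    using ordinate_sum_lim_estimate[OF x(1)] unfolding J_def L_def by blast
  have "((\<lambda>K. C * (L - ordinate_sum ?q K)) \<longlongrightarrow> C * (L - L)) at_top" by (intro tendsto_intros L)
  then have "eventually (\<lambda>K. C * (L - ordinate_sum ?q K) < e) at_top" using e by (intro order_tendstoD(2)[where y = "C * (L - L)"]) auto
  from eventually_happens[OF this] obtain K where K: "C * (L - ordinate_sum ?q K) < e" by auto
  obtain M where M: "\<And>n. n > 0 \<Longrightarrow> \<bar>ordinate_sum_lim n - (J n / (2 * pi) - a * ln (2 * pi) * real n)\<bar>
        \<le> 2 * a * 2 powr (4 - x) * real n + C * sqrt (real n) + M + C * real n * (L - ordinate_sum ?q K)"
    using C(2)[of K] by blast
  define j where "j n = J n / real n - 2 * pi * a * ln (real n) - 2 * pi * a * (ln (2 * a) + euler_mascheroni - 1)" for n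
  have "(\<lambda>n. J n / real n - 2 * pi * a * ln (real n) - 2 * pi * a * (ln (2 * a) + euler_mascheroni - 1)) \<longlonglongrightarrow>
      2 * pi * a * (ln (2 * a) + euler_mascheroni - 1) - 2 * pi * a * (ln (2 * a) + euler_mascheroni - 1)"
    unfolding J_def by (intro tendsto_diff tendsto_const integral_cayley_axis_ln_asymptotics[OF a])
  then have "j \<longlonglongrightarrow> 0" by (simp add: j_def[abs_def])
  then have "(\<lambda>n. \<bar>j n\<bar> / (2 * pi)) \<longlonglongrightarrow> \<bar>0\<bar> / (2 * pi)" by (intro tendsto_intros) auto
  then have "eventually (\<lambda>n. \<bar>j n\<bar> / (2 * pi) < e) sequentially" using e by (intro order_tendstoD(2)) auto
  moreover have "(\<lambda>n. C * sqrt (real n) / real n) \<longlonglongrightarrow> 0" by real_asymp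
  then have "eventually (\<lambda>n. C * sqrt (real n) / real n < e) sequentially" using e by (intro order_tendstoD(2)) auto
  moreover have "(\<lambda>n. M / real n) \<longlonglongrightarrow> 0" by real_asymp
  then have "eventually (\<lambda>n. M / real n < e) sequentially" using e by (intro order_tendstoD(2)) auto
  ultimately have "eventually (\<lambda>n. \<bar>(ordinate_sum_lim n - (a * real n * ln (real n) + a * (euler_mascheroni - 1 - ln (pi / a)) * real n)) / real n\<bar> < \<epsilon>) sequentially"
    using eventually_gt_at_top[of 0]
  proof eventually_elim
    case (elim n)
    define main where "main = a * real n * ln (real n) + a * (euler_mascheroni - 1 - ln (pi / a)) * real n"
    define D where "D = ordinate_sum_lim n - (J n / (2 * pi) - a * ln (2 * pi) * real n)"
    have n: "real n > 0" using elim by simp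
    have Jn: "J n = real n * (j n + 2 * pi * a * ln (real n) + 2 * pi * a * (ln (2 * a) + euler_mascheroni - 1))"
      using n by (simp add: j_def)
    have lns: "ln (2 * a) - ln (2 * pi) = - ln (pi / a)" using a by (simp add: ln_mult ln_div)
    have "J n / (2 * pi) = real n * (j n / (2 * pi)) + a * real n * ln (real n) + a * real n * (ln (2 * a) + euler_mascheroni - 1)"
      unfolding Jn by (simp add: field_simps)
    then have "J n / (2 * pi) - a * ln (2 * pi) * real n = real n * (j n / (2 * pi)) + a * real n * ln (real n)
        + a * real n * ((ln (2 * a) - ln (2 * pi)) + euler_mascheroni - 1)"
      by (simp add: algebra_simps)
    then have "J n / (2 * pi) - a * ln (2 * pi) * real n = main + real n * (j n / (2 * pi))"
      unfolding lns main_def by (simp add: algebra_simps)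
    then have "(ordinate_sum_lim n - main) / real n = D / real n + j n / (2 * pi)"
      using n by (simp add: D_def field_simps)
    then have "\<bar>(ordinate_sum_lim n - main) / real n\<bar> \<le> \<bar>D\<bar> / real n + \<bar>j n\<bar> / (2 * pi)"
      using abs_triangle_ineq[of "D / real n" "j n / (2 * pi)"] n by simp
    also have "\<bar>D\<bar> / real n \<le> (2 * a * 2 powr (4 - x) * real n + C * sqrt (real n) + M + C * real n * (L - ordinate_sum ?q K)) / real n"
      unfolding D_def using M[of n] n by (intro divide_right_mono) auto
    also have "\<dots> = 2 * a * 2 powr (4 - x) + C * sqrt (real n) / real n + M / real n + C * (L - ordinate_sum ?q K)"
      using n by (simp add: add_divide_distrib)
    finally have "\<bar>(ordinate_sum_lim n - main) / real n\<bar> \<le>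
        2 * a * 2 powr (4 - x) + C * sqrt (real n) / real n + M / real n + C * (L - ordinate_sum ?q K) + \<bar>j n\<bar> / (2 * pi)" by simp
    also have "\<dots> < e + e + e + e + e" using x(2) K elim by (intro add_strict_mono)
    also have "\<dots> < \<epsilon>" using \<epsilon> by (simp add: e_def)
    finally show ?case unfolding main_def .
  qed
  then show "\<exists>no. \<forall>n\<ge>no. norm ((ordinate_sum_lim n - (a * real n * ln (real n) + a * (euler_mascheroni - 1 - ln (pi / a)) * real n)) / real n - 0) < \<epsilon>"
    by (simp add: eventually_sequentially)
qed

section \<open>Conjugate pairs and the two forms of the summand\<close>

lemma sum_ordinates_minus:
  "(\<Sum>g | g \<in> ordinates \<and> \<bar>g\<bar> \<le> T. F (- g)) = (\<Sum>g | g \<in> ordinates \<and> \<bar>g\<bar> \<le> T. F g)"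
  by (rule sum.reindex_bij_witness[of _ uminus uminus]) (auto simp: ordinates_minus)

text \<open>Conjugation exchanges the terms at \<open>g\<close> and \<open>- g\<close>, which carry
  equal multiplicity, so every symmetric partial sum is already real.\<close>

lemma sum_cayley_eq_ordinate_sum:
  "(\<Sum>g | g \<in> ordinates \<and> \<bar>g\<bar> \<le> T. of_real (zero_mult g) * (1 - cayley a (\<i> * of_real g) ^ n)) = complex_of_real (ordinate_sum (H n) T)"
proof -
  let ?t = "\<lambda>g. of_real (zero_mult g) * (1 - cayley a (\<i> * of_real g) ^ n)"
  define Z where "Z = (\<Sum>g | g \<in> ordinates \<and> \<bar>g\<bar> \<le> T. ?t g)"
  have "cnj (cayley a (\<i> * of_real g)) = cayley a (\<i> * of_real (- g))" for g
  proof -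
    have "cnj (cayley a (\<i> * of_real g)) = (- (\<i> * of_real g) - of_real a) / (- (\<i> * of_real g) + of_real a)"
      by (simp add: cayley_def)
    then show ?thesis by (simp add: cayley_def)
  qed
  then have "cnj (?t g) = ?t (- g)" for g by (simp add: zero_mult_minus)
  then have "cnj Z = (\<Sum>g | g \<in> ordinates \<and> \<bar>g\<bar> \<le> T. ?t (- g))" unfolding Z_def cnj_sum by simp
  also have "\<dots> = Z" unfolding Z_def by (rule sum_ordinates_minus)
  finally have "Im Z = 0" by (metis cnj.simps(2) neg_equal_zero)
  moreover have "Re Z = ordinate_sum (H n) T"
    unfolding Z_def ordinate_sum_def Re_sum by (intro sum.cong refl) (simp add: cayley_re_def)
  ultimately show ?thesis unfolding Z_def[symmetric] by (simp add: complex_eq_iff)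
qed

lemma has_zero_sum_cayley:
  assumes f: "\<And>g. f (1 / 2 + \<i> * of_real g) = 1 - cayley a (\<i> * of_real g) ^ n"
  shows "has_zero_sum f (of_real (ordinate_sum_lim n))"
proof -
  have eq: "zero_sum_upto f = (\<lambda>T. of_real (ordinate_sum (H n) T))"
    unfolding zero_sum_upto_eq[OF RH, abs_def] f sum_cayley_eq_ordinate_sum ..
  show ?thesis unfolding has_zero_sum_def eq by (rule tendsto_of_real[OF ordinate_sum_lim])
qed

text \<open>On the axis the reciprocal of the base is its value at \<open>- g\<close>, and the
  symmetric cut-off is invariant under \<open>g \<mapsto> - g\<close>. The two forms of the summand
  therefore have identical partial sums, not merely the same limit.\<close>

lemma has_zero_sum_cayley_minus:
  assumes f: "\<And>g. f (1 / 2 + \<i> * of_real g) = 1 - cayley a (\<i> * of_real (- g)) ^ n"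
  shows "has_zero_sum f (of_real (ordinate_sum_lim n))"
proof -
  have "zero_sum_upto f T = of_real (ordinate_sum (H n) T)" for T
  proof -
    have "zero_sum_upto f T = (\<Sum>g | g \<in> ordinates \<and> \<bar>g\<bar> \<le> T. of_real (zero_mult (- g)) * (1 - cayley a (\<i> * of_real (- g)) ^ n))"
      unfolding zero_sum_upto_eq[OF RH] f zero_mult_minus ..
    also have "\<dots> = of_real (ordinate_sum (H n) T)"
      unfolding sum_ordinates_minus[of "\<lambda>g. of_real (zero_mult g) * (1 - cayley a (\<i> * of_real g) ^ n)" T] by (rule sum_cayley_eq_ordinate_sum)
    finally show ?thesis .
  qed
  then have eq: "zero_sum_upto f = (\<lambda>T. of_real (ordinate_sum (H n) T))" ..
  show ?thesis unfolding has_zero_sum_def eq by (rule tendsto_of_real[OF ordinate_sum_lim])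
qed

end

theorem theorem6:
  fixes b :: real
  assumes RH: "riemann_hypothesis"
    and b: "b \<noteq> - 1 / 2"
  shows "(\<forall>n. has_zero_sum (\<lambda>\<rho>. 1 - ((\<rho> + of_real b) / (\<rho> - 1 - of_real b)) ^ n) (k_sum n b)) \<and>
         (\<forall>n. has_zero_sum (\<lambda>\<rho>. 1 - ((\<rho> - of_real b - 1) / (\<rho> + of_real b)) ^ n) (k_sum n b)) \<and>
         (\<lambda>n. k_sum n b -
            of_real (\<bar>2 * b + 1\<bar> / 2 * real n * ln (real n) +
                     \<bar>2 * b + 1\<bar> / 2 *
                       (euler_mascheroni - 1 - ln (2 * pi / \<bar>2 * b + 1\<bar>)) * real n))
           \<in> o(\<lambda>n. of_nat n)"
proof -
  define a where "a = \<bar>2 * b + 1\<bar> / 2"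
  have a: "a > 0" using b by (auto simp: a_def)
  let ?f = "\<lambda>n \<rho>. 1 - ((\<rho> + of_real b) / (\<rho> - 1 - of_real b)) ^ n :: complex"
  let ?g = "\<lambda>n \<rho>. 1 - ((\<rho> - of_real b - 1) / (\<rho> + of_real b)) ^ n :: complex"
  define S where "S n = complex_of_real (ordinate_sum_lim a n)" for n
  \<comment> \<open>The sign of \<open>b + 1 / 2\<close> decides which of the two quotients is the
    Cayley transform with the positive parameter \<open>a\<close>, and which is its value at
    \<open>- g\<close>.\<close>
  have sgn: "a = b + 1 / 2 \<or> a = - (b + 1 / 2)" by (auto simp: a_def abs_if)
  have fg: "has_zero_sum (?f n) (S n) \<and> has_zero_sum (?g n) (S n)" for n
  proof -
    have frac: "(1 / 2 + \<i> * of_real g + of_real b) / (1 / 2 + \<i> * of_real g - 1 - of_real b) =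
        (\<i> * of_real g + of_real (b + 1 / 2)) / (\<i> * of_real g - of_real (b + 1 / 2))"
      "(1 / 2 + \<i> * of_real g - of_real b - 1) / (1 / 2 + \<i> * of_real g + of_real b) =
        (\<i> * of_real g - of_real (b + 1 / 2)) / (\<i> * of_real g + of_real (b + 1 / 2))" for g
      by (simp_all add: algebra_simps)
    have neg: "cayley c (\<i> * of_real (- g)) = (\<i> * of_real g + of_real c) / (\<i> * of_real g - of_real c)" for c g
    proof -
      have "cayley c (\<i> * of_real (- g)) = (- (\<i> * of_real g + of_real c)) / (- (\<i> * of_real g - of_real c))"
        by (simp add: cayley_def)
      then show ?thesis by (simp only: minus_divide_divide)
    qed
    from sgn show ?thesis
    proof
      assume eq: "a = b + 1 / 2"
      have "has_zero_sum (?f n) (S n)"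
        unfolding S_def by (rule has_zero_sum_cayley_minus[OF a RH]) (simp only: frac neg eq)
      moreover have "has_zero_sum (?g n) (S n)"
        unfolding S_def by (rule has_zero_sum_cayley[OF a RH]) (simp only: frac cayley_def eq)
      ultimately show ?thesis by simp
    next
      assume eq: "a = - (b + 1 / 2)"
      have r: "complex_of_real (b + 1 / 2) = - of_real a" by (simp add: eq)
      have "has_zero_sum (?f n) (S n)"
        unfolding S_def by (rule has_zero_sum_cayley[OF a RH]) (simp only: frac r cayley_def add_uminus_conv_diff diff_minus_eq_add)
      moreover have "has_zero_sum (?g n) (S n)"
        unfolding S_def by (rule has_zero_sum_cayley_minus[OF a RH]) (simp only: frac r neg add_uminus_conv_diff diff_minus_eq_add)
      ultimately show ?thesis by simp
    qed
  qed
  \<comment> \<open>Uniqueness of limits resolves the description operator in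
    \<open>zero_sum\<close>.\<close>
  have k: "k_sum n b = S n" for n
    unfolding k_sum_def zero_sum_def
  proof (rule the_equality)
    show "has_zero_sum (?f n) (S n)" using fg by blast
    fix L assume "has_zero_sum (?f n) L"
    then show "L = S n" using fg[of n] unfolding has_zero_sum_def
      using tendsto_unique[OF trivial_limit_at_top_linorder] by blast
  qed
  have "(\<lambda>n. (ordinate_sum_lim a n - (a * real n * ln (real n) + a * (euler_mascheroni - 1 - ln (pi / a)) * real n)) / real n) \<longlonglongrightarrow> 0"
    by (rule ordinate_sum_lim_asymptotics[OF a RH])
  from tendsto_of_real[OF this, where 'a = complex]
  have "(\<lambda>n. (S n - of_real (a * real n * ln (real n) + a * (euler_mascheroni - 1 - ln (pi / a)) * real n)) / of_nat n) \<longlonglongrightarrow> 0"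
    by (simp add: S_def)
  then have o: "(\<lambda>n. S n - of_real (a * real n * ln (real n) + a * (euler_mascheroni - 1 - ln (pi / a)) * real n)) \<in> o(\<lambda>n. of_nat n)"
    by (rule smalloI_tendsto) (use eventually_gt_at_top[of 0] in \<open>auto elim: eventually_mono\<close>)
  have eq: "pi / a = 2 * pi / \<bar>2 * b + 1\<bar>" by (simp add: a_def)
  show ?thesis unfolding k eq[symmetric] a_def[symmetric] using fg o by blast
qed

end
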